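(* Suppose that the map $\boldsymbol{x}\mapsto\nabla f(\boldsymbol{x},\cdot)$ is Lipschitz from $d_n$ to the uniform norm $\|\cdot\|$, with Lipschitz constant $$L := \sup\Big\{\frac{\|\nabla f(\boldsymbol{x},\cdot) - \nabla f(\boldsymbol{y},\cdot)\|}{d_n(\boldsymbol{x},\boldsymbol{y})}:\ \boldsymbol{x},\boldsymbol{y} \in \prod_{i=1}^n K_i\ \text{distinct}\Big\}<\infty .$$ Let $\delta>0$ and let $\mathcal{P}$ be a finite partition of $\prod_{i=1}^n K_i$ into nonempty Borel sets such that $\|\nabla f(\boldsymbol{x},\cdot) - \nabla f(\boldsymbol{y},\cdot)\|<\delta n$ whenever $\boldsymbol{x},\boldsymbol{y}$ lie in the same part of $\mathcal{P}$. For each $P\in\mathcal{P}$ let $\boldsymbol{y}_P\in P$ be a point which (when $\mu(P)>0$) minimizes $\overline{d_n}(\mu_{|P},\xi_{\nabla f(\boldsymbol{y},\cdot)})$ over $\boldsymbol{y}\in P$, and let $g_P:=\nabla f(\boldsymbol{y}_P,\cdot)$. Then $$\sum_{P\in\mathcal{P}}\mu(P)\Big\|g_P - \int \nabla f(\boldsymbol{x},\cdot)\ \xi_{g_P}(d\boldsymbol{x})\Big\| \leq \delta n + L\sqrt{\frac{1}{2}\Big(\frac{\mathrm{H}_\mu(\mathcal{P})}{n} + \delta \Big)}.$$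
   Context: Setting. Let $n\ge 1$ and $[n]=\{1,\dots,n\}$. Let $(K_1,d_{K_1}),\dots,(K_n,d_{K_n})$ be nonempty, complete, separable metric spaces, all of diameter at most one. For each $i$ let $\lambda_i$ be a fixed Borel probability measure on $K_i$ and $\ast_i\in K_i$ a fixed reference point. Let $f:\prod_{i=1}^n K_i\to\mathbb{R}$ be bounded and continuous, and let $\mu$ be the Gibbs measure $\mu(d\boldsymbol{x}) = \frac1Z e^{f(\boldsymbol{x})}\prod_{i=1}^n\lambda_i(dx_i)$, where $Z$ is the normalizing constant. $\|\cdot\|$ denotes the uniform (sup) norm of functions on $\prod_i K_i$. Discrete gradient. For $\boldsymbol{x}\in\prod_iK_i$, $i\in[n]$, $y\in K_i$, put $\partial_i f(\boldsymbol{x},y) := f(x_1,\dots,x_{i-1},y,x_{i+1},\dots,x_n) - f(x_1,\dots,x_{i-1},\ast_i,x_{i+1},\dots,x_n)$, and for $\boldsymbol{x},\boldsymbol{y}\in\prod_iK_i$ put $\nabla f(\boldsymbol{x},\boldsymbol{y}) := \sum_{i=1}^n\partial_if(\boldsymbol{x},y_i)$. For a probability measure $\nu$, $\int\nabla f(\boldsymbol{x},\cdot)\,\nu(d\boldsymbol{x})$ denotes the function $\boldsymbol{z}\mapsto\int\nabla f(\boldsymbol{x},\boldsymbol{z})\,\nu(d\boldsymbol{x})$. Product Gibbs measures. A function $g$ on $\prod_iK_i$ is additively separable if $g(\boldsymbol{x})=g_1(x_1)+\dots+g_n(x_n)$ with each $g_i:K_i\to\mathbb{R}$ bounded and continuous.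 For such $g$, $\xi_g$ denotes the probability measure proportional to $e^{g(\boldsymbol{x})}\prod_i\lambda_i(dx_i)$; it is a product measure. Each $\nabla f(\boldsymbol{x},\cdot)$ is additively separable. Transportation metric. $d_n(\boldsymbol{x},\boldsymbol{y}):=\frac1n\sum_{i=1}^nd_{K_i}(x_i,y_i)$, and for Borel probability measures $\nu,\nu'$ on $\prod_iK_i$, $\overline{d_n}(\nu,\nu'):=\inf_\lambda\int d_n(\boldsymbol{x},\boldsymbol{y})\,\lambda(d\boldsymbol{x},d\boldsymbol{y})$, the infimum being over all couplings $\lambda$ of $\nu$ and $\nu'$. Further notation. $\mu_{|P}=\mu(\cdot\mid P)$ for $\mu(P)>0$. $\mathrm{H}_\mu(\mathcal{P})=-\sum_{P\in\mathcal{P}}\mu(P)\log\mu(P)$ with natural logarithm and $0\log0=0$. If $\prod_iK_i$ is a single point, $L$ is taken to be $0$. *)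

theory Defs
  imports "HOL-Probability.Probability"
begin

definition borel_of :: "'a topology \<Rightarrow> 'a measure" where
  "borel_of X = sigma (topspace X) {U. openin X U}"

text \<open>The metric spaces \<open>K 1, \<dots>, K n\<close> are carriers-with-metric over one common type \<open>'a\<close>; this
  loses no generality, since finitely many spaces always embed into a disjoint sum.  Points of
  their product are the extensional functions in \<open>PiE {1..n} (\<lambda>i. mspace (K i))\<close>.\<close>

definition prod_top :: "nat \<Rightarrow> (nat \<Rightarrow> 'a metric) \<Rightarrow> (nat \<Rightarrow> 'a) topology" where
  "prod_top n K = product_topology (\<lambda>i. mtopology_of (K i)) {1..n}"

abbreviation prod_pts :: "nat \<Rightarrow> (nat \<Rightarrow> 'a metric) \<Rightarrow> (nat \<Rightarrow> 'a) set" where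
  "prod_pts n K \<equiv> topspace (prod_top n K)"

definition unif_norm :: "nat \<Rightarrow> (nat \<Rightarrow> 'a metric) \<Rightarrow> ((nat \<Rightarrow> 'a) \<Rightarrow> real) \<Rightarrow> real" where
  "unif_norm n K h = (SUP z\<in>prod_pts n K. \<bar>h z\<bar>)"

definition dn :: "nat \<Rightarrow> (nat \<Rightarrow> 'a metric) \<Rightarrow> (nat \<Rightarrow> 'a) \<Rightarrow> (nat \<Rightarrow> 'a) \<Rightarrow> real" where
  "dn n K x y = (\<Sum>i=1..n. mdist (K i) (x i) (y i)) / real n"

text \<open>In the next two definitions \<open>b i\<close> is the reference point of \<open>K i\<close>.\<close>

definition pdiff :: "(nat \<Rightarrow> 'a) \<Rightarrow> ((nat \<Rightarrow> 'a) \<Rightarrow> real) \<Rightarrow> nat \<Rightarrow> (nat \<Rightarrow> 'a) \<Rightarrow> 'a \<Rightarrow> real" where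
  "pdiff b f i x u = f (x(i := u)) - f (x(i := b i))"

definition grad ::
  "nat \<Rightarrow> (nat \<Rightarrow> 'a) \<Rightarrow> ((nat \<Rightarrow> 'a) \<Rightarrow> real) \<Rightarrow> (nat \<Rightarrow> 'a) \<Rightarrow> (nat \<Rightarrow> 'a) \<Rightarrow> real" where
  "grad n b f x y = (\<Sum>i=1..n. pdiff b f i x (y i))"

text \<open>The measure lives on the product sigma-algebra of the Borel sigma-algebras of the \<open>K i\<close>.  As
  the \<open>K i\<close> are separable, this is the Borel sigma-algebra of \<open>prod_top n K\<close>.  The same definition
  with an additively separable \<open>f\<close> gives the product measure \<open>\<xi>\<^sub>f\<close>.\<close>

definition gibbs ::
  "nat \<Rightarrow> (nat \<Rightarrow> 'a measure) \<Rightarrow> ((nat \<Rightarrow> 'a) \<Rightarrow> real) \<Rightarrow> (nat \<Rightarrow> 'a) measure" where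
  "gibbs n lam f = density (PiM {1..n} lam)
     (\<lambda>x. ennreal (exp (f x) / (\<integral>w. exp (f w) \<partial>PiM {1..n} lam)))"

definition couplings :: "'b measure \<Rightarrow> 'b measure \<Rightarrow> ('b \<times> 'b) measure set" where
  "couplings \<nu> \<nu>' = {\<gamma>. sets \<gamma> = sets (\<nu> \<Otimes>\<^sub>M \<nu>') \<and> distr \<gamma> \<nu> fst = \<nu> \<and> distr \<gamma> \<nu>' snd = \<nu>'}"

definition dn_bar ::
  "nat \<Rightarrow> (nat \<Rightarrow> 'a metric) \<Rightarrow> (nat \<Rightarrow> 'a) measure \<Rightarrow> (nat \<Rightarrow> 'a) measure \<Rightarrow> real" where
  "dn_bar n K \<nu> \<nu>' = (INF \<gamma>\<in>couplings \<nu> \<nu>'. \<integral>p. dn n K (fst p) (snd p) \<partial>\<gamma>)"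

definition lip_quotients ::
  "nat \<Rightarrow> (nat \<Rightarrow> 'a metric) \<Rightarrow> (nat \<Rightarrow> 'a) \<Rightarrow> ((nat \<Rightarrow> 'a) \<Rightarrow> real) \<Rightarrow> real set" where
  "lip_quotients n K b f =
     {unif_norm n K (\<lambda>z. grad n b f x z - grad n b f y z) / dn n K x y | x y.
        x \<in> prod_pts n K \<and> y \<in> prod_pts n K \<and> x \<noteq> y}"

text \<open>The set of quotients is empty exactly when the (nonempty) product is a single point.\<close>

definition lip_const ::
  "nat \<Rightarrow> (nat \<Rightarrow> 'a metric) \<Rightarrow> (nat \<Rightarrow> 'a) \<Rightarrow> ((nat \<Rightarrow> 'a) \<Rightarrow> real) \<Rightarrow> real" where
  "lip_const n K b f =
     (if lip_quotients n K b f = {} then 0 else Sup (lip_quotients n K b f))"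

text \<open>Since \<open>ln 0 = 0\<close> in HOL, null parts contribute \<open>0\<close>.\<close>

definition part_entropy :: "'b measure \<Rightarrow> 'b set set \<Rightarrow> real" where
  "part_entropy M \<P> = - (\<Sum>P\<in>\<P>. measure M P * ln (measure M P))"

end

theory Submission
  imports Defs
begin

text \<open>
  Fix a part \<open>P\<close> with \<open>\<mu> P > 0\<close> and \<open>w \<in> P\<close>. Marton's inequality for the product measure
  \<open>\<xi>\<^sub>w = \<xi>\<^sub>g\<close>, \<open>g = \<nabla>f(w, \<cdot>)\<close>, bounds the transport distance \<open>D\<close> from \<open>\<mu>\<^sub>P\<close> to \<open>\<xi>\<^sub>w\<close> by the
  relative entropy, in the linear form \<open>l n D \<le> H(\<mu>\<^sub>P | \<xi>\<^sub>w) + n l\<^sup>2 / 8\<close> for all \<open>l > 0\<close>. As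
  \<open>\<nabla>f(w, \<cdot>)\<close> is within \<open>\<delta> n\<close> of \<open>\<nabla>f(x, \<cdot>)\<close> on \<open>P\<close>, that entropy is at most
  \<open>- ln \<mu>(P) + \<delta> n + c(w) + \<integral> (f x - ln Z - \<nabla>f(x, x)) \<mu>\<^sub>P(dx)\<close> with
  \<open>c(w) = ln \<integral> exp (\<nabla>f(w, \<cdot>))\<close>. By minimality of \<open>y\<^sub>P\<close> the bound holds for the distance from
  \<open>\<mu>\<^sub>P\<close> to \<open>\<xi>\<close> at \<open>y\<^sub>P\<close> with every \<open>w \<in> P\<close> on the right. Averaging over \<open>w\<close> under
  \<open>\<mu>\<^sub>P\<close> and over \<open>P\<close> leaves the entropy of the partition, \<open>\<delta> n\<close>, and
  \<open>\<integral> (f x - ln Z - \<nabla>f(x, x) + c x) \<mu>(dx)\<close>. The last integral is minus the dual total correlation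
  of \<open>\<mu>\<close>, because the \<open>i\<close>-th factor of \<open>\<xi>\<^sub>x\<close> is the conditional law of the \<open>i\<close>-th coordinate given
  the others; hence it is nonpositive. Optimising \<open>l\<close> gives the square root, and the Lipschitz
  condition turns transport distances into differences of the means of \<open>\<nabla>f\<close>.
\<close>

subsection \<open>Averaging out one coordinate\<close>

text \<open>The tolerance \<open>\<delta> n\<close> is spent twice: inside the root, where the
  gradient at \<open>w\<close> is exchanged for the one at \<open>x\<close>, and outside it, where
  \<open>g P\<close> is exchanged for the mean of the gradient under \<open>\<mu>\<close>
  conditioned on \<open>P\<close>. The transport bound stays linear in \<open>l\<close> because a
  square root is not additive: the average over \<open>w\<close> and the sum over the parts are
  taken first, and \<open>l\<close> is optimised only once. Minimality of \<open>y P\<close> makes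
  the left side constant on \<open>P\<close>, so the averaging never asks how the transport distance
  varies with \<open>w\<close>. A metric bounded by 1 is dominated by the discrete one, so transport
  is controlled by total variation, and couplings are built by maximal couplings of one coordinate
  at a time. The constant 1/8 is Hoeffding's lemma for variables with values in [0, 1]. Conditional
  laws enter through densities relative to the product measure, and a conditional expectation is an
  integral over single coordinates. It is therefore defined at every point and not merely almost
  everywhere.\<close>

context finite_product_prob_space
begin

lemma measurable_update [measurable]:
  assumes "i \<in> I"
  shows "(\<lambda>(x, u). x(i := u)) \<in> PiM I M \<Otimes>\<^sub>M M i \<rightarrow>\<^sub>M PiM I M"
  using measurable_add_dim[of i I M] assms by (simp add: insert_absorb)

lemma measurable_update_compose [measurable (raw)]:
  assumes "i \<in> I" "f \<in> N \<rightarrow>\<^sub>M PiM I M" "g \<in> N \<rightarrow>\<^sub>M M i"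
  shows "(\<lambda>w. (f w)(i := g w)) \<in> N \<rightarrow>\<^sub>M PiM I M"
  using measurable_compose[OF measurable_Pair[OF assms(2,3)] measurable_update[OF assms(1)]]
  by simp

lemma update_in_space:
  "i \<in> I \<Longrightarrow> x \<in> space (PiM I M) \<Longrightarrow> u \<in> space (M i) \<Longrightarrow> x(i := u) \<in> space (PiM I M)"
  by (auto simp: space_PiM PiE_iff extensional_def)

text \<open>The old coordinate \<open>i\<close> is forgotten, so the preimage of a box is the box
  with its \<open>i\<close>-th side freed, times \<open>A i\<close>. The integral identities for
  averaging out a coordinate rest on this invariance.\<close>

lemma distr_update:
  assumes i: "i \<in> I"
  shows "distr (PiM I M \<Otimes>\<^sub>M M i) (PiM I M) (\<lambda>(x, u). x(i := u)) = PiM I M"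
proof (rule PiM_eqI)
  fix A assume A: "\<And>j. j \<in> I \<Longrightarrow> A j \<in> sets (M j)"
  let ?B = "A(i := space (M i))"
  have A': "?B j \<in> sets (M j)" if "j \<in> I" for j using A that by auto
  have eq: "(\<lambda>(x, u). x(i := u)) -` Pi\<^sub>E I A \<inter> space (PiM I M \<Otimes>\<^sub>M M i) = Pi\<^sub>E I ?B \<times> A i"
    using i A sets.sets_into_space[OF A]
    by (auto simp: space_pair_measure space_PiM PiE_iff extensional_def split: if_splits) (metis subsetD)+
  have "emeasure (distr (PiM I M \<Otimes>\<^sub>M M i) (PiM I M) (\<lambda>(x, u). x(i := u))) (Pi\<^sub>E I A)
      = emeasure (PiM I M) (Pi\<^sub>E I ?B) * emeasure (M i) (A i)"
    using i A A' finite_index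
    by (subst emeasure_distr) (auto simp: eq intro!: M.emeasure_pair_measure_Times sets_PiM_I_finite)
  also have "\<dots> = (\<Prod>j\<in>I. emeasure (M j) (?B j)) * emeasure (M i) (A i)"
    using A' finite_index by (subst emeasure_PiM) auto
  also have "(\<Prod>j\<in>I. emeasure (M j) (?B j)) = (\<Prod>j\<in>I - {i}. emeasure (M j) (A j))"
    using i finite_index by (subst prod.remove[of _ i]) (auto simp: M.emeasure_space_1 intro!: prod.cong)
  also have "\<dots> * emeasure (M i) (A i) = (\<Prod>j\<in>I. emeasure (M j) (A j))"
    using i finite_index by (subst (2) prod.remove[of _ i]) (auto simp: mult.commute)
  finally show "emeasure (distr (PiM I M \<Otimes>\<^sub>M M i) (PiM I M) (\<lambda>(x, u). x(i := u))) (Pi\<^sub>E I A)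
      = (\<Prod>j\<in>I. emeasure (M j) (A j))" .
qed (use finite_index in auto)

lemma nn_integral_update:
  assumes i: "i \<in> I" and [measurable]: "h \<in> borel_measurable (PiM I M)"
  shows "(\<integral>\<^sup>+x. h x \<partial>PiM I M) = (\<integral>\<^sup>+x. \<integral>\<^sup>+u. h (x(i := u)) \<partial>M i \<partial>PiM I M)"
proof -
  have "(\<integral>\<^sup>+x. h x \<partial>PiM I M) = (\<integral>\<^sup>+x. h x \<partial>distr (PiM I M \<Otimes>\<^sub>M M i) (PiM I M) (\<lambda>(x, u). x(i := u)))"
    by (simp only: distr_update[OF i])
  also have "\<dots> = (\<integral>\<^sup>+p. h ((fst p)(i := snd p)) \<partial>(PiM I M \<Otimes>\<^sub>M M i))"
    using i by (subst nn_integral_distr) (auto simp: split_beta)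
  also have "\<dots> = (\<integral>\<^sup>+x. \<integral>\<^sup>+u. h (x(i := u)) \<partial>M i \<partial>PiM I M)"
    using i by (subst M.nn_integral_fst[symmetric]) auto
  finally show ?thesis .
qed

text \<open>A class closed under sums, products, \<open>exp\<close>, \<open>cavg\<close>, and
  \<open>ln\<close> of functions bounded away from 0, so that the shape of an integrand settles its
  integrability. The bound is asked on the space only, since nothing is known of \<open>f\<close>
  elsewhere.\<close>

definition bfun :: "(('a \<Rightarrow> 'b) \<Rightarrow> real) \<Rightarrow> bool" where
  "bfun h \<longleftrightarrow> h \<in> borel_measurable (PiM I M) \<and> (\<exists>B. \<forall>x\<in>space (PiM I M). \<bar>h x\<bar> \<le> B)"

text \<open>\<open>cavg i h\<close> is the conditional expectation of \<open>h\<close> given all coordinates but \<open>i\<close>.\<close>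

definition cavg :: "'a \<Rightarrow> (('a \<Rightarrow> 'b) \<Rightarrow> real) \<Rightarrow> ('a \<Rightarrow> 'b) \<Rightarrow> real" where
  "cavg i h x = (\<integral>u. h (x(i := u)) \<partial>M i)"

text \<open>Independence of a coordinate is exact, not almost sure, so that factors leave
  \<open>cavg\<close> pointwise and no null sets have to be tracked.\<close>

definition free_of :: "'a \<Rightarrow> (('a \<Rightarrow> 'b) \<Rightarrow> real) \<Rightarrow> bool" where
  "free_of i h \<longleftrightarrow> (\<forall>x\<in>space (PiM I M). \<forall>u\<in>space (M i). h (x(i := u)) = h x)"

lemma bfun_measurable [measurable_dest]: "bfun h \<Longrightarrow> h \<in> borel_measurable (PiM I M)"
  by (simp add: bfun_def)

lemma bfunI:
  "h \<in> borel_measurable (PiM I M) \<Longrightarrow> (\<And>x. x \<in> space (PiM I M) \<Longrightarrow> \<bar>h x\<bar> \<le> B) \<Longrightarrow> bfun h"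
  by (auto simp: bfun_def)

lemma bfun_bound:
  assumes "bfun h" obtains B where "B \<ge> 0" "\<And>x. x \<in> space (PiM I M) \<Longrightarrow> \<bar>h x\<bar> \<le> B"
  using assms unfolding bfun_def by (meson abs_ge_zero order_trans linear)

lemma bfun_const: "bfun (\<lambda>_. c)"
  by (rule bfunI) auto

lemma bfun_add: assumes a: "bfun a" and b: "bfun b" shows "bfun (\<lambda>x. a x + b x)"
proof -
  obtain A where A: "A \<ge> 0" "\<And>x. x \<in> space (PiM I M) \<Longrightarrow> \<bar>a x\<bar> \<le> A" using bfun_bound[OF a] by metis
  obtain B where B: "B \<ge> 0" "\<And>x. x \<in> space (PiM I M) \<Longrightarrow> \<bar>b x\<bar> \<le> B" using bfun_bound[OF b] by metis
  show ?thesis using a b by (intro bfunI[of _ "A + B"]) (auto intro!: order_trans[OF abs_triangle_ineq] add_mono A B)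
qed

lemma bfun_mult: assumes a: "bfun a" and b: "bfun b" shows "bfun (\<lambda>x. a x * b x)"
proof -
  obtain A where A: "A \<ge> 0" "\<And>x. x \<in> space (PiM I M) \<Longrightarrow> \<bar>a x\<bar> \<le> A" using bfun_bound[OF a] by metis
  obtain B where B: "B \<ge> 0" "\<And>x. x \<in> space (PiM I M) \<Longrightarrow> \<bar>b x\<bar> \<le> B" using bfun_bound[OF b] by metis
  show ?thesis using a b by (intro bfunI[of _ "A * B"]) (auto simp: abs_mult intro!: mult_mono A B)
qed

lemma bfun_diff: "bfun a \<Longrightarrow> bfun b \<Longrightarrow> bfun (\<lambda>x. a x - b x)"
  using bfun_add[of a "\<lambda>x. -1 * b x"] bfun_mult[OF bfun_const[of "-1"], of b] by simp

lemma bfun_sum: "finite J \<Longrightarrow> (\<And>j. j \<in> J \<Longrightarrow> bfun (a j)) \<Longrightarrow> bfun (\<lambda>x. \<Sum>j\<in>J. a j x)"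
  by (induction J rule: finite_induct) (auto intro: bfun_const bfun_add)

lemma bfun_exp: assumes a: "bfun a" shows "bfun (\<lambda>x. exp (a x))"
proof -
  obtain A where "\<And>x. x \<in> space (PiM I M) \<Longrightarrow> \<bar>a x\<bar> \<le> A" using bfun_bound[OF a] by metis
  thus ?thesis using a by (intro bfunI[of _ "exp A"]) (auto simp: abs_le_iff)
qed

lemma bfun_max0: assumes a: "bfun a" shows "bfun (\<lambda>x. max 0 (a x))"
proof -
  obtain A where "A \<ge> 0" "\<And>x. x \<in> space (PiM I M) \<Longrightarrow> \<bar>a x\<bar> \<le> A" using bfun_bound[OF a] by metis
  thus ?thesis using a by (intro bfunI[of _ A]) (auto simp: abs_le_iff max_def)
qed

lemma bfun_indicator: "S \<in> sets (PiM I M) \<Longrightarrow> bfun (indicat_real S)"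
  by (rule bfunI[of _ 1]) (auto simp: indicator_def)

lemma bfun_ln:
  assumes a: "bfun a" and c: "c > 0" "\<And>x. x \<in> space (PiM I M) \<Longrightarrow> c \<le> a x"
  shows "bfun (\<lambda>x. ln (a x))"
proof -
  obtain A where A: "\<And>x. x \<in> space (PiM I M) \<Longrightarrow> \<bar>a x\<bar> \<le> A" using bfun_bound[OF a] by metis
  have "\<bar>ln (a x)\<bar> \<le> \<bar>ln c\<bar> + \<bar>ln A\<bar>" if "x \<in> space (PiM I M)" for x
  proof -
    have "ln c \<le> ln (a x)" "ln (a x) \<le> ln A"
      using A[OF that] c(2)[OF that] c(1) by auto
    thus ?thesis by linarith
  qed
  thus ?thesis using a by (intro bfunI) auto
qed

lemma bfun_integrable: assumes "bfun h" shows "integrable (PiM I M) h"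
proof -
  obtain B where "\<And>x. x \<in> space (PiM I M) \<Longrightarrow> \<bar>h x\<bar> \<le> B" using bfun_bound[OF assms] by metis
  thus ?thesis using assms by (intro P.integrable_const_bound[of _ B]) (auto intro!: AE_I2)
qed

lemma bfun_integrable_update:
  assumes i: "i \<in> I" and h: "bfun h" and x: "x \<in> space (PiM I M)"
  shows "integrable (M i) (\<lambda>u. h (x(i := u)))"
proof -
  note bfun_measurable[OF h, measurable]
  have [measurable]: "(\<lambda>u. x(i := u)) \<in> M i \<rightarrow>\<^sub>M PiM I M"
    using i x by measurable
  obtain B where B: "\<And>x. x \<in> space (PiM I M) \<Longrightarrow> \<bar>h x\<bar> \<le> B" using bfun_bound[OF h] by metis
  show ?thesis using i x
    by (intro M.integrable_const_bound[where B = B]) (auto intro!: AE_I2 B update_in_space)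
qed

lemma bfun_cavg: assumes i: "i \<in> I" and h: "bfun h" shows "bfun (cavg i h)"
proof -
  obtain B where B: "B \<ge> 0" "\<And>x. x \<in> space (PiM I M) \<Longrightarrow> \<bar>h x\<bar> \<le> B" using bfun_bound[OF h] by metis
  have "\<bar>cavg i h x\<bar> \<le> B" if x: "x \<in> space (PiM I M)" for x
  proof -
    have "\<bar>cavg i h x\<bar> \<le> (\<integral>u. \<bar>h (x(i := u))\<bar> \<partial>M i)"
      unfolding cavg_def by (rule integral_abs_bound)
    also have "\<dots> \<le> (\<integral>u. B \<partial>M i)"
      using bfun_integrable_update[OF i h x] x i
      by (intro integral_mono) (auto intro!: B update_in_space)
    finally show ?thesis by (simp add: M.prob_space)
  qed
  moreover have "cavg i h \<in> borel_measurable (PiM I M)"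
  proof -
    note i[measurable] bfun_measurable[OF h, measurable]
    show ?thesis unfolding cavg_def by measurable
  qed
  ultimately show ?thesis by (rule bfunI[rotated])
qed

lemma integral_cavg:
  assumes i: "i \<in> I" and h: "bfun h"
  shows "(\<integral>x. cavg i h x \<partial>PiM I M) = (\<integral>x. h x \<partial>PiM I M)"
proof -
  interpret pp: pair_prob_space "PiM I M" "M i" ..
  obtain B where B: "\<And>x. x \<in> space (PiM I M) \<Longrightarrow> \<bar>h x\<bar> \<le> B" using bfun_bound[OF h] by metis
  have [measurable]: "h \<in> borel_measurable (PiM I M)" using h by measurable
  have int: "integrable (PiM I M \<Otimes>\<^sub>M M i) (\<lambda>(x, u). h (x(i := u)))"
    using i by (intro pp.P.integrable_const_bound[of _ B])
      (auto intro!: AE_I2 B update_in_space simp: space_pair_measure)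
  have "(\<integral>x. h x \<partial>PiM I M) = (\<integral>x. h x \<partial>distr (PiM I M \<Otimes>\<^sub>M M i) (PiM I M) (\<lambda>(x, u). x(i := u)))"
    by (simp only: distr_update[OF i])
  also have "\<dots> = (\<integral>p. (\<lambda>(x, u). h (x(i := u))) p \<partial>(PiM I M \<Otimes>\<^sub>M M i))"
    using i by (subst integral_distr) (auto simp: split_beta')
  also have "\<dots> = (\<integral>x. cavg i h x \<partial>PiM I M)"
    unfolding cavg_def by (rule pp.integral_fst'[symmetric, OF int, simplified])
  finally show ?thesis ..
qed

lemma cavg_mono:
  assumes "i \<in> I" "bfun a" "bfun b" "x \<in> space (PiM I M)"
    and "\<And>x. x \<in> space (PiM I M) \<Longrightarrow> a x \<le> b x"
  shows "cavg i a x \<le> cavg i b x"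
  unfolding cavg_def using assms update_in_space[OF assms(1,4)] by (intro integral_mono bfun_integrable_update) auto

lemma cavg_const: "i \<in> I \<Longrightarrow> cavg i (\<lambda>_. c) x = c"
  by (simp add: cavg_def M.prob_space)

lemma free_of_cavg_same: "free_of i (cavg i h)"
  by (simp add: free_of_def cavg_def)

lemma free_of_cavg:
  assumes "i \<in> I" "j \<in> I" "free_of j h"
  shows "free_of j (cavg i h)"
proof (cases "i = j")
  case False
  have "h ((x(j := v))(i := u)) = h (x(i := u))"
    if "x \<in> space (PiM I M)" "v \<in> space (M j)" "u \<in> space (M i)" for x u v
    using assms False that update_in_space[of i x u]
    by (subst fun_upd_twist) (auto simp: free_of_def)
  thus ?thesis unfolding free_of_def cavg_def by (auto intro!: Bochner_Integration.integral_cong)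
qed (simp add: free_of_cavg_same)

lemma cavg_mult_free:
  assumes "i \<in> I" "free_of i a" "x \<in> space (PiM I M)"
  shows "cavg i (\<lambda>x. a x * h x) x = a x * cavg i h x"
proof -
  have "cavg i (\<lambda>x. a x * h x) x = (\<integral>u. a x * h (x(i := u)) \<partial>M i)"
    unfolding cavg_def using assms by (intro Bochner_Integration.integral_cong) (auto simp: free_of_def)
  thus ?thesis by (simp add: cavg_def)
qed

lemma free_of_comp2:
  "free_of i a \<Longrightarrow> free_of i b \<Longrightarrow> free_of i (\<lambda>x. F (a x) (b x))"
  by (simp add: free_of_def)

text \<open>The coordinates of \<open>x\<close> are exchanged for those of \<open>z\<close> one at a
  time, each exchange being an update in a free coordinate. Extensionality makes the end result
  equal to \<open>z\<close>.\<close>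

lemma constant_if_free:
  assumes "\<And>i. i \<in> I \<Longrightarrow> free_of i h" "x \<in> space (PiM I M)" "z \<in> space (PiM I M)"
  shows "h x = h z"
proof -
  have "J \<subseteq> I \<longrightarrow> h (override_on x z J) = h x \<and> override_on x z J \<in> space (PiM I M)" if "finite J" for J
    using that
  proof (induction J rule: finite_induct)
    case (insert j J)
    show ?case
    proof (intro impI)
      assume J: "insert j J \<subseteq> I"
      have "override_on x z (insert j J) = (override_on x z J)(j := z j)"
        by (auto simp: override_on_def)
      moreover have "z j \<in> space (M j)" using J assms(3) by (auto simp: space_PiM)
      ultimately show "h (override_on x z (insert j J)) = h x \<and> override_on x z (insert j J) \<in> space (PiM I M)"
        using insert J assms(1)[of j] update_in_space[of j "override_on x z J" "z j"]
        by (auto simp: free_of_def)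
    qed
  qed (simp add: assms)
  from this[of I] have "h (override_on x z I) = h x" using finite_index by simp
  moreover have "override_on x z I = z"
    using assms(2,3) by (auto simp: space_PiM PiE_iff extensional_def override_on_def fun_eq_iff)
  ultimately show ?thesis by simp
qed

end

subsection \<open>Maximal couplings\<close>

text \<open>Subtraction on \<open>ennreal\<close> truncates at 0, so here and below
  \<open>p - 1\<close> is the excess of a density over 1 and \<open>1 - p\<close> its
  deficit.\<close>

lemma min_one_add_excess: "min p 1 + (p - 1) = (p::ennreal)"
  by (cases "p \<le> 1")
    (auto simp: min_def add_diff_inverse_ennreal diff_eq_0_iff_ennreal intro: order_le_less_trans)

context prob_space
begin

text \<open>Both \<open>p\<close> and the constant 1 have mass 1 and share the part
  \<open>min p 1\<close>, whose mass is finite and can be cancelled. The common value is the total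
  variation distance between the two laws.\<close>

lemma excess_eq_deficit:
  assumes [measurable]: "p \<in> borel_measurable M" and p: "(\<integral>\<^sup>+u. p u \<partial>M) = 1"
  shows "(\<integral>\<^sup>+u. (p u - 1) \<partial>M) = (\<integral>\<^sup>+u. (1 - p u) \<partial>M)"
proof -
  let ?m = "\<integral>\<^sup>+u. min (p u) 1 \<partial>M"
  have "?m + (\<integral>\<^sup>+u. (p u - 1) \<partial>M) = (\<integral>\<^sup>+u. p u \<partial>M)"
    by (subst nn_integral_add[symmetric]) (auto simp: min_one_add_excess)
  also have "\<dots> = (\<integral>\<^sup>+u. 1 \<partial>M)" by (simp add: p emeasure_space_1)
  also have "\<dots> = (\<integral>\<^sup>+u. (min (p u) 1 + (1 - p u)) \<partial>M)"
    by (intro nn_integral_cong)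
      (auto simp: min_def diff_eq_0_ennreal add_diff_inverse_ennreal)
  also have "\<dots> = ?m + (\<integral>\<^sup>+u. (1 - p u) \<partial>M)"
    by (subst nn_integral_add) auto
  finally have "?m + (\<integral>\<^sup>+u. (p u - 1) \<partial>M) = ?m + (\<integral>\<^sup>+u. (1 - p u) \<partial>M)" .
  moreover have "?m \<le> (\<integral>\<^sup>+u. 1 \<partial>M)" by (intro nn_integral_mono) auto
  hence "?m \<noteq> top" by (auto simp: emeasure_space_1 top_unique)
  ultimately show ?thesis by (simp add: ennreal_add_left_cancel)
qed

text \<open>Normaliser of the off-diagonal part of the maximal coupling, whose density is excess
  times deficit. If the total variation distance is 0, the excess vanishes almost everywhere, and
  the value 0 avoids \<open>inverse 0 = top\<close>.\<close>

definition excess_inv :: "('a \<Rightarrow> ennreal) \<Rightarrow> ennreal" where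
  "excess_inv p = (if (\<integral>\<^sup>+u. (1 - p u) \<partial>M) = 0 then 0 else inverse (\<integral>\<^sup>+u. (1 - p u) \<partial>M))"

lemma excess_inv_cases:
  assumes [measurable]: "p \<in> borel_measurable M"
  shows "(\<integral>\<^sup>+u. (1 - p u) \<partial>M) = 0 \<and> excess_inv p = 0
       \<or> (\<integral>\<^sup>+u. (1 - p u) \<partial>M) * excess_inv p = 1"
proof -
  have "(\<integral>\<^sup>+u. (1 - p u) \<partial>M) \<le> (\<integral>\<^sup>+u. 1 \<partial>M)"
    by (intro nn_integral_mono) (auto simp: diff_le_self_ennreal)
  hence "(\<integral>\<^sup>+u. (1 - p u) \<partial>M) \<noteq> top" by (auto simp: emeasure_space_1 top_unique)
  thus ?thesis
    by (auto simp: excess_inv_def divide_ennreal_def[symmetric] ennreal_divide_self less_top)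
qed

text \<open>Integrating out \<open>v\<close> cancels the normaliser, so the off-diagonal part
  contributes the excess, which completes the diagonal part \<open>min p 1\<close> to
  \<open>p\<close>. This identifies the first marginal of the maximal coupling through test
  functions \<open>F\<close>.\<close>

lemma maximal_coupling_fst:
  assumes p[measurable]: "p \<in> borel_measurable M" and p1: "(\<integral>\<^sup>+u. p u \<partial>M) = 1"
    and [measurable]: "F \<in> borel_measurable M"
  shows "(\<integral>\<^sup>+u. min (p u) 1 * F u \<partial>M)
       + (\<integral>\<^sup>+u. \<integral>\<^sup>+v. (p u - 1) * (1 - p v) * excess_inv p * F u \<partial>M \<partial>M)
       = (\<integral>\<^sup>+u. p u * F u \<partial>M)"
proof -
  let ?E = "\<integral>\<^sup>+u. (1 - p u) \<partial>M"
  have "(\<integral>\<^sup>+u. \<integral>\<^sup>+v. (p u - 1) * (1 - p v) * excess_inv p * F u \<partial>M \<partial>M)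
      = (\<integral>\<^sup>+u. (p u - 1) * (?E * excess_inv p) * F u \<partial>M)"
  proof (intro nn_integral_cong)
    fix u
    have "(\<integral>\<^sup>+v. (p u - 1) * (1 - p v) * excess_inv p * F u \<partial>M)
        = (\<integral>\<^sup>+v. (1 - p v) * ((p u - 1) * excess_inv p * F u) \<partial>M)"
      by (intro nn_integral_cong) (auto simp: mult_ac)
    thus "(\<integral>\<^sup>+v. (p u - 1) * (1 - p v) * excess_inv p * F u \<partial>M)
        = (p u - 1) * (?E * excess_inv p) * F u"
      by (subst (asm) nn_integral_multc) (simp_all add: mult_ac)
  qed
  also have "\<dots> = (\<integral>\<^sup>+u. (p u - 1) * F u \<partial>M)"
    using excess_inv_cases[OF p]
  proof
    assume "?E * excess_inv p = 1" thus ?thesis by simp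
  next
    assume "?E = 0 \<and> excess_inv p = 0"
    hence *: "AE u in M. p u - 1 = 0"
      using excess_eq_deficit[OF p p1] by (subst nn_integral_0_iff_AE[symmetric]) auto
    show ?thesis by (intro nn_integral_cong_AE eventually_mono[OF *]) simp
  qed
  finally have "(\<integral>\<^sup>+u. min (p u) 1 * F u \<partial>M)
       + (\<integral>\<^sup>+u. \<integral>\<^sup>+v. (p u - 1) * (1 - p v) * excess_inv p * F u \<partial>M \<partial>M)
       = (\<integral>\<^sup>+u. (min (p u) 1 * F u + (p u - 1) * F u) \<partial>M)"
    by (simp add: nn_integral_add)
  thus ?thesis by (simp flip: distrib_right add: min_one_add_excess)
qed

text \<open>Integrating out \<open>u\<close> replaces the excess by its mass, which is also the mass
  of the deficit and cancels the normaliser. The deficit that remains completes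
  \<open>min p 1\<close> to 1.\<close>

lemma maximal_coupling_snd:
  assumes p[measurable]: "p \<in> borel_measurable M" and p1: "(\<integral>\<^sup>+u. p u \<partial>M) = 1"
    and [measurable]: "F \<in> borel_measurable M"
  shows "(\<integral>\<^sup>+u. min (p u) 1 * F u \<partial>M)
       + (\<integral>\<^sup>+u. \<integral>\<^sup>+v. (p u - 1) * (1 - p v) * excess_inv p * F v \<partial>M \<partial>M)
       = (\<integral>\<^sup>+u. F u \<partial>M)"
proof -
  let ?E = "\<integral>\<^sup>+u. (1 - p u) \<partial>M" and ?R = "\<integral>\<^sup>+v. (1 - p v) * F v \<partial>M"
  have "(\<integral>\<^sup>+u. \<integral>\<^sup>+v. (p u - 1) * (1 - p v) * excess_inv p * F v \<partial>M \<partial>M)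
      = (\<integral>\<^sup>+u. (p u - 1) * (excess_inv p * ?R) \<partial>M)"
  proof (intro nn_integral_cong)
    fix u
    have "(\<integral>\<^sup>+v. (p u - 1) * (1 - p v) * excess_inv p * F v \<partial>M)
        = (\<integral>\<^sup>+v. ((1 - p v) * F v) * ((p u - 1) * excess_inv p) \<partial>M)"
      by (intro nn_integral_cong) (auto simp: mult_ac)
    thus "(\<integral>\<^sup>+v. (p u - 1) * (1 - p v) * excess_inv p * F v \<partial>M)
        = (p u - 1) * (excess_inv p * ?R)"
      by (subst (asm) nn_integral_multc) (simp_all add: mult_ac)
  qed
  also have "\<dots> = ?E * excess_inv p * ?R"
    by (subst nn_integral_multc) (auto simp: excess_eq_deficit[OF p p1] mult_ac)
  also have "\<dots> = ?R"
    using excess_inv_cases[OF p]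
  proof
    assume "?E * excess_inv p = 1" thus ?thesis by simp
  next
    assume E: "?E = 0 \<and> excess_inv p = 0"
    hence *: "AE u in M. 1 - p u = 0" by (subst (asm) nn_integral_0_iff_AE) auto
    have "?R = (\<integral>\<^sup>+v. 0 \<partial>M)" by (intro nn_integral_cong_AE eventually_mono[OF *]) simp
    thus ?thesis using E by simp
  qed
  finally have "(\<integral>\<^sup>+u. min (p u) 1 * F u \<partial>M)
       + (\<integral>\<^sup>+u. \<integral>\<^sup>+v. (p u - 1) * (1 - p v) * excess_inv p * F v \<partial>M \<partial>M)
       = (\<integral>\<^sup>+u. (min (p u) 1 * F u + (1 - p u) * F u) \<partial>M)"
    by (simp add: nn_integral_add)
  moreover have "min (p u) 1 + (1 - p u) = 1" for u
    by (auto simp: min_def diff_eq_0_ennreal add_diff_inverse_ennreal)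
  ultimately show ?thesis by (simp flip: distrib_right)
qed

text \<open>The diagonal part costs nothing, and the off-diagonal part has the total variation
  distance as its mass and cost at most 1 per unit.\<close>

lemma maximal_coupling_cost:
  assumes p[measurable]: "p \<in> borel_measurable M" and p1: "(\<integral>\<^sup>+u. p u \<partial>M) = 1"
    and d: "\<And>u v. u \<in> space M \<Longrightarrow> v \<in> space M \<Longrightarrow> d u v \<le> (1::ennreal)"
    and d0: "\<And>u. u \<in> space M \<Longrightarrow> d u u = 0"
  shows "(\<integral>\<^sup>+u. min (p u) 1 * d u u \<partial>M)
       + (\<integral>\<^sup>+u. \<integral>\<^sup>+v. (p u - 1) * (1 - p v) * excess_inv p * d u v \<partial>M \<partial>M)
       \<le> (\<integral>\<^sup>+u. (p u - 1) \<partial>M)"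
proof -
  have "(\<integral>\<^sup>+u. min (p u) 1 * d u u \<partial>M) = (\<integral>\<^sup>+u. 0 \<partial>M)"
    by (intro nn_integral_cong) (simp add: d0)
  moreover
  have "(\<integral>\<^sup>+u. \<integral>\<^sup>+v. (p u - 1) * (1 - p v) * excess_inv p * d u v \<partial>M \<partial>M)
      \<le> (\<integral>\<^sup>+u. \<integral>\<^sup>+v. (1 - p v) * ((p u - 1) * excess_inv p) \<partial>M \<partial>M)"
  proof (intro nn_integral_mono)
    fix u v assume "u \<in> space M" "v \<in> space M"
    hence "(p u - 1) * (1 - p v) * excess_inv p * d u v \<le> (p u - 1) * (1 - p v) * excess_inv p * 1"
      by (intro mult_left_mono d) auto
    thus "(p u - 1) * (1 - p v) * excess_inv p * d u v \<le> (1 - p v) * ((p u - 1) * excess_inv p)"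
      by (simp add: mult_ac)
  qed
  moreover have "(\<integral>\<^sup>+u. \<integral>\<^sup>+v. (1 - p v) * ((p u - 1) * excess_inv p) \<partial>M \<partial>M)
      = (\<integral>\<^sup>+v. (1 - p v) \<partial>M) * excess_inv p * (\<integral>\<^sup>+v. (1 - p v) \<partial>M)"
    by (simp add: nn_integral_multc nn_integral_cmult excess_eq_deficit[OF p p1] mult_ac)
  moreover have "(\<integral>\<^sup>+v. (1 - p v) \<partial>M) * excess_inv p * (\<integral>\<^sup>+v. (1 - p v) \<partial>M) \<le> (\<integral>\<^sup>+u. (p u - 1) \<partial>M)"
    using excess_inv_cases[OF p] by (auto simp: excess_eq_deficit[OF p p1])
  ultimately show ?thesis by simp
qed

end

section \<open>Resampling one coordinate of a coupling\<close>

context finite_product_prob_space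
begin

text \<open>Resamples coordinate \<open>i\<close> of both points of a coupling: the first point from density
  \<open>p x\<close>, the second from \<open>M i\<close>, by the maximal coupling of the two. The flag \<open>s\<close> says whether the
  new coordinates are forced to agree.\<close>

definition coupling_update ::
  "'a \<Rightarrow> (('a \<Rightarrow> 'b) \<Rightarrow> 'b \<Rightarrow> ennreal) \<Rightarrow> (('a \<Rightarrow> 'b) \<times> ('a \<Rightarrow> 'b)) measure \<Rightarrow> (('a \<Rightarrow> 'b) \<times> ('a \<Rightarrow> 'b)) measure"
where
  "coupling_update i p \<gamma> =
     distr (density (\<gamma> \<Otimes>\<^sub>M (count_space UNIV \<Otimes>\<^sub>M (M i \<Otimes>\<^sub>M M i)))
         (\<lambda>(q, s, u, v). if s then min (p (fst q) u) 1
            else (p (fst q) u - 1) * (1 - p (fst q) v) * prob_space.excess_inv (M i) (p (fst q))))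
       (PiM I M \<Otimes>\<^sub>M PiM I M)
       (\<lambda>(q, s, u, v). ((fst q)(i := u), (snd q)(i := if s then u else v)))"

text \<open>The diagonal part of a maximal coupling need not have a density relative to the product
  of \<open>M i\<close> with itself. The boolean flag gives it a sheet of its own, and the integral
  over the flag becomes the sum of the two parts.\<close>

lemma nn_integral_coupling_update:
  assumes i[measurable]: "i \<in> I"
    and \<gamma>: "sets \<gamma> = sets (PiM I M \<Otimes>\<^sub>M PiM I M)"
    and [measurable]: "(\<lambda>(x, u). p x u) \<in> borel_measurable (PiM I M \<Otimes>\<^sub>M M i)"
    and [measurable]: "\<Phi> \<in> borel_measurable (PiM I M \<Otimes>\<^sub>M PiM I M)"
  shows "(\<integral>\<^sup>+r. \<Phi> r \<partial>coupling_update i p \<gamma>) =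
    (\<integral>\<^sup>+q. (\<integral>\<^sup>+u. min (p (fst q) u) 1 * \<Phi> ((fst q)(i := u), (snd q)(i := u)) \<partial>M i)
      + (\<integral>\<^sup>+u. \<integral>\<^sup>+v. (p (fst q) u - 1) * (1 - p (fst q) v) * prob_space.excess_inv (M i) (p (fst q))
           * \<Phi> ((fst q)(i := u), (snd q)(i := v)) \<partial>M i \<partial>M i) \<partial>\<gamma>)"
proof -
  interpret pp: pair_prob_space "M i" "M i" ..
  interpret cb: sigma_finite_measure "count_space (UNIV::bool set)"
    by (rule sigma_finite_measure_count_space_finite) simp
  interpret cc: pair_sigma_finite "count_space (UNIV::bool set)" "M i \<Otimes>\<^sub>M M i" ..
  note \<gamma>[measurable_cong]
  have [measurable]: "(\<lambda>x. prob_space.excess_inv (M i) (p x)) \<in> borel_measurable (PiM I M)"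
    unfolding M.excess_inv_def by measurable
  let ?W = "\<lambda>q s u v. if s then min (p (fst q) u) 1
            else (p (fst q) u - 1) * (1 - p (fst q) v) * prob_space.excess_inv (M i) (p (fst q))"
  let ?F = "\<lambda>q s u v. \<Phi> ((fst q)(i := u), (snd q)(i := if s then u else v))"
  have joint: "(\<lambda>(q, s, u, v). ?W q s u v * ?F q s u v)
      \<in> borel_measurable (\<gamma> \<Otimes>\<^sub>M (count_space UNIV \<Otimes>\<^sub>M (M i \<Otimes>\<^sub>M M i)))"
    by measurable
  have "(\<integral>\<^sup>+r. \<Phi> r \<partial>coupling_update i p \<gamma>)
      = (\<integral>\<^sup>+(q, s, u, v). ?W q s u v * ?F q s u v \<partial>(\<gamma> \<Otimes>\<^sub>M (count_space UNIV \<Otimes>\<^sub>M (M i \<Otimes>\<^sub>M M i))))"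
    unfolding coupling_update_def
    by (subst nn_integral_distr, measurable, subst nn_integral_density, measurable)
      (auto simp: split_beta')
  also have "\<dots> = (\<integral>\<^sup>+q. \<integral>\<^sup>+(s, u, v). ?W q s u v * ?F q s u v \<partial>(count_space UNIV \<Otimes>\<^sub>M (M i \<Otimes>\<^sub>M M i)) \<partial>\<gamma>)"
    by (subst cc.P.nn_integral_fst[symmetric]) (auto simp: split_beta' cong: if_cong)
  also have "\<dots> = (\<integral>\<^sup>+q. \<integral>\<^sup>+s. \<integral>\<^sup>+(u, v). ?W q s u v * ?F q s u v \<partial>(M i \<Otimes>\<^sub>M M i) \<partial>count_space UNIV \<partial>\<gamma>)"
  proof (intro nn_integral_cong)
    fix q assume q: "q \<in> space \<gamma>"
    show "(\<integral>\<^sup>+(s, u, v). ?W q s u v * ?F q s u v \<partial>(count_space UNIV \<Otimes>\<^sub>M (M i \<Otimes>\<^sub>M M i)))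
        = (\<integral>\<^sup>+s. \<integral>\<^sup>+(u, v). ?W q s u v * ?F q s u v \<partial>(M i \<Otimes>\<^sub>M M i) \<partial>count_space UNIV)"
      by (subst pp.P.nn_integral_fst[symmetric])
        (use measurable_compose[OF measurable_Pair1'[OF q] joint] in \<open>auto simp: split_beta' cong: if_cong\<close>)
  qed
  also have "\<dots> = (\<integral>\<^sup>+q. \<integral>\<^sup>+s. \<integral>\<^sup>+u. \<integral>\<^sup>+v. ?W q s u v * ?F q s u v \<partial>M i \<partial>M i \<partial>count_space UNIV \<partial>\<gamma>)"
  proof (intro nn_integral_cong)
    fix q and s :: bool assume q: "q \<in> space \<gamma>"
    have "(\<lambda>t. (s, t)) \<in> M i \<Otimes>\<^sub>M M i \<rightarrow>\<^sub>M count_space UNIV \<Otimes>\<^sub>M (M i \<Otimes>\<^sub>M M i)" by simp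
    from measurable_compose[OF this measurable_compose[OF measurable_Pair1'[OF q] joint]]
    show "(\<integral>\<^sup>+(u, v). ?W q s u v * ?F q s u v \<partial>(M i \<Otimes>\<^sub>M M i))
        = (\<integral>\<^sup>+u. \<integral>\<^sup>+v. ?W q s u v * ?F q s u v \<partial>M i \<partial>M i)"
      by (subst M.nn_integral_fst[symmetric]) (auto simp: split_beta' cong: if_cong)
  qed
  \<comment> \<open>For \<open>s = True\<close> the integrand does not involve \<open>v\<close>, so
    the integral over \<open>v\<close> only contributes the mass 1 of \<open>M i\<close>.\<close>
  also have "\<dots> = (\<integral>\<^sup>+q. (\<integral>\<^sup>+u. min (p (fst q) u) 1 * \<Phi> ((fst q)(i := u), (snd q)(i := u)) \<partial>M i)
      + (\<integral>\<^sup>+u. \<integral>\<^sup>+v. (p (fst q) u - 1) * (1 - p (fst q) v) * prob_space.excess_inv (M i) (p (fst q))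
           * \<Phi> ((fst q)(i := u), (snd q)(i := v)) \<partial>M i \<partial>M i) \<partial>\<gamma>)"
    by (simp add: nn_integral_count_space_finite UNIV_bool M.emeasure_space_1 add.commute)
  finally show ?thesis .
qed

text \<open>The densities \<open>a\<close> and \<open>b\<close> differ only in the conditional law
  of coordinate \<open>i\<close> given the others: under \<open>a\<close> it is \<open>M i\<close>,
  as \<open>a\<close> is free of \<open>i\<close>; under \<open>b\<close> it has density
  \<open>b / a\<close>. Maximal coupling of these two laws costs at most their total variation
  distance, and its mean under \<open>a\<close> is the integral of the positive part of
  \<open>b - a\<close>, which \<open>ennreal\<close> takes silently.\<close>

lemma coupling_step:
  assumes i[measurable]: "i \<in> I"
    and \<gamma>: "sets \<gamma> = sets (PiM I M \<Otimes>\<^sub>M PiM I M)"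
    and \<gamma>1: "distr \<gamma> (PiM I M) fst = density (PiM I M) (\<lambda>x. ennreal (a x))"
    and \<gamma>2: "distr \<gamma> (PiM I M) snd = PiM I M"
    and a: "bfun a" "\<And>x. x \<in> space (PiM I M) \<Longrightarrow> 0 \<le> a x" "free_of i a"
    and b: "bfun b" "\<And>x. x \<in> space (PiM I M) \<Longrightarrow> 0 \<le> b x"
    and ab: "\<And>x. x \<in> space (PiM I M) \<Longrightarrow> cavg i b x = a x"
  obtains \<gamma>' where "sets \<gamma>' = sets (PiM I M \<Otimes>\<^sub>M PiM I M)"
    "distr \<gamma>' (PiM I M) fst = density (PiM I M) (\<lambda>x. ennreal (b x))"
    "distr \<gamma>' (PiM I M) snd = PiM I M"
    "\<And>j \<phi>. j \<in> I \<Longrightarrow> j \<noteq> i \<Longrightarrow> (\<lambda>(u, v). \<phi> u v) \<in> borel_measurable (M j \<Otimes>\<^sub>M M j) \<Longrightarrow>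
        (\<integral>\<^sup>+q. \<phi> (fst q j) (snd q j) \<partial>\<gamma>') = (\<integral>\<^sup>+q. \<phi> (fst q j) (snd q j) \<partial>\<gamma>)"
    "\<And>d. (\<lambda>(u, v). d u v) \<in> borel_measurable (M i \<Otimes>\<^sub>M M i) \<Longrightarrow>
        (\<And>u v. u \<in> space (M i) \<Longrightarrow> v \<in> space (M i) \<Longrightarrow> d u v \<le> 1) \<Longrightarrow>
        (\<And>u. u \<in> space (M i) \<Longrightarrow> d u u = 0) \<Longrightarrow>
        (\<integral>\<^sup>+q. d (fst q i) (snd q i) \<partial>\<gamma>') \<le> (\<integral>\<^sup>+x. ennreal (b x - a x) \<partial>PiM I M)"
proof -
  note \<gamma>[measurable_cong]
  note [measurable] = bfun_measurable[OF a(1)] bfun_measurable[OF b(1)]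
  have space_\<gamma>: "space \<gamma> = space (PiM I M) \<times> space (PiM I M)"
    using sets_eq_imp_space_eq[OF \<gamma>] by (simp add: space_pair_measure)
  \<comment> \<open>The value 1 where \<open>a x = 0\<close> keeps \<open>p x\<close> a probability
    density at every \<open>x\<close>. Nothing is lost there: \<open>b\<close> is nonnegative with
    fibre mean \<open>a x = 0\<close>, hence vanishes almost everywhere on that fibre.\<close>
  define p where "p = (\<lambda>x u. if a x = 0 then 1 else ennreal (b (x(i := u)) / a x))"
  have p[measurable]: "(\<lambda>(x, u). p x u) \<in> borel_measurable (PiM I M \<Otimes>\<^sub>M M i)"
    unfolding p_def by measurable
  have int_b: "(\<integral>\<^sup>+u. ennreal (b (x(i := u))) \<partial>M i) = ennreal (a x)"
    if x: "x \<in> space (PiM I M)" for x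
  proof -
    have "(\<integral>\<^sup>+u. ennreal (b (x(i := u))) \<partial>M i) = ennreal (cavg i b x)"
      unfolding cavg_def
      using bfun_integrable_update[OF i b(1) x] b(2) update_in_space[OF i x]
      by (intro nn_integral_eq_integral) auto
    thus ?thesis using ab[OF x] by simp
  qed
  have meas_x[measurable]: "(\<lambda>u. x(i := u)) \<in> M i \<rightarrow>\<^sub>M PiM I M" if "x \<in> space (PiM I M)" for x
    using that by measurable
  have px: "p x \<in> borel_measurable (M i)" if "x \<in> space (PiM I M)" for x
    using measurable_compose[OF measurable_Pair1'[OF that] p] by simp
  have p_mult: "(\<integral>\<^sup>+u. p x u * F u \<partial>M i) * a x = (\<integral>\<^sup>+u. b (x(i := u)) * F u \<partial>M i)"
    if x: "x \<in> space (PiM I M)" and [measurable]: "F \<in> borel_measurable (M i)"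
    for x and F :: "'b \<Rightarrow> ennreal"
  proof (cases "a x = 0")
    case True
    have "AE u in M i. ennreal (b (x(i := u))) = 0"
      using int_b[OF x] x True by (subst nn_integral_0_iff_AE[symmetric]) auto
    hence "(\<integral>\<^sup>+u. b (x(i := u)) * F u \<partial>M i) = (\<integral>\<^sup>+u. 0 \<partial>M i)"
      by (intro nn_integral_cong_AE) (auto elim: eventually_mono)
    thus ?thesis using True by simp
  next
    case False
    hence pos: "a x > 0" using a(2)[OF x] by simp
    have "(\<integral>\<^sup>+u. p x u * F u \<partial>M i) * a x = (\<integral>\<^sup>+u. p x u * F u * a x \<partial>M i)"
      using x px[OF x] by (subst nn_integral_multc) auto
    also have "\<dots> = (\<integral>\<^sup>+u. b (x(i := u)) * F u \<partial>M i)"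
    proof (intro nn_integral_cong)
      fix u assume "u \<in> space (M i)"
      hence "b (x(i := u)) \<ge> 0" using b(2) update_in_space[OF i x] by simp
      hence eq: "p x u * ennreal (a x) = b (x(i := u))"
        using pos by (simp add: p_def ennreal_mult'[symmetric])
      thus "p x u * F u * a x = b (x(i := u)) * F u" by (simp add: mult_ac flip: eq)
    qed
    finally show ?thesis .
  qed
  have p1: "(\<integral>\<^sup>+u. p x u \<partial>M i) = 1" if x: "x \<in> space (PiM I M)" for x
  proof (cases "a x = 0")
    case False
    hence pos: "a x > 0" using a(2)[OF x] by simp
    have "(\<integral>\<^sup>+u. p x u \<partial>M i) = (\<integral>\<^sup>+u. ennreal (b (x(i := u))) * ennreal (1 / a x) \<partial>M i)"
      using pos b(2) update_in_space[OF i x]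
      by (intro nn_integral_cong) (simp add: p_def ennreal_mult[symmetric])
    also have "\<dots> = ennreal (a x) * ennreal (1 / a x)"
      using x by (subst nn_integral_multc) (auto simp: int_b)
    finally show ?thesis using pos by (simp add: ennreal_mult[symmetric])
  qed (simp add: p_def M.emeasure_space_1)
  have int_\<gamma>1: "(\<integral>\<^sup>+q. F (fst q) \<partial>\<gamma>) = (\<integral>\<^sup>+x. a x * F x \<partial>PiM I M)"
    if [measurable]: "F \<in> borel_measurable (PiM I M)" for F :: "_ \<Rightarrow> ennreal"
  proof -
    have "(\<integral>\<^sup>+q. F (fst q) \<partial>\<gamma>) = (\<integral>\<^sup>+x. F x \<partial>distr \<gamma> (PiM I M) fst)"
      by (subst nn_integral_distr) auto
    thus ?thesis by (simp add: \<gamma>1 nn_integral_density)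
  qed
  have int_\<gamma>2: "(\<integral>\<^sup>+q. F (snd q) \<partial>\<gamma>) = (\<integral>\<^sup>+x. F x \<partial>PiM I M)"
    if [measurable]: "F \<in> borel_measurable (PiM I M)" for F :: "_ \<Rightarrow> ennreal"
  proof -
    have "(\<integral>\<^sup>+q. F (snd q) \<partial>\<gamma>) = (\<integral>\<^sup>+x. F x \<partial>distr \<gamma> (PiM I M) snd)"
      by (subst nn_integral_distr) auto
    thus ?thesis by (simp add: \<gamma>2)
  qed
  let ?g = "coupling_update i p \<gamma>"
  have sets': "sets ?g = sets (PiM I M \<Otimes>\<^sub>M PiM I M)"
    by (simp add: coupling_update_def)
  note sets'[measurable_cong]
  note formula = nn_integral_coupling_update[OF i \<gamma> p]
  have fst': "distr ?g (PiM I M) fst = density (PiM I M) (\<lambda>x. ennreal (b x))"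
  proof (rule measure_eqI)
    fix A assume "A \<in> sets (distr ?g (PiM I M) fst)"
    hence A[measurable]: "A \<in> sets (PiM I M)" by simp
    have "emeasure (distr ?g (PiM I M) fst) A = (\<integral>\<^sup>+x. indicator A x \<partial>distr ?g (PiM I M) fst)"
      by simp
    also have "\<dots> = (\<integral>\<^sup>+r. indicator A (fst r) \<partial>?g)"
      by (subst nn_integral_distr) auto
    also have "\<dots> = (\<integral>\<^sup>+q. \<integral>\<^sup>+u. p (fst q) u * indicator A ((fst q)(i := u)) \<partial>M i \<partial>\<gamma>)"
      by (subst formula, measurable, intro nn_integral_cong, simp, rule M.maximal_coupling_fst)
        (auto simp: space_\<gamma> p1 px)
    also have "\<dots> = (\<integral>\<^sup>+x. a x * (\<integral>\<^sup>+u. p x u * indicator A (x(i := u)) \<partial>M i) \<partial>PiM I M)"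
      by (rule int_\<gamma>1) measurable
    also have "\<dots> = (\<integral>\<^sup>+x. \<integral>\<^sup>+u. ennreal (b (x(i := u))) * indicator A (x(i := u)) \<partial>M i \<partial>PiM I M)"
      by (intro nn_integral_cong, subst p_mult[symmetric]) (auto simp: mult.commute)
    also have "\<dots> = (\<integral>\<^sup>+x. ennreal (b x) * indicator A x \<partial>PiM I M)"
      by (rule nn_integral_update[OF i, symmetric]) measurable
    also have "\<dots> = emeasure (density (PiM I M) (\<lambda>x. ennreal (b x))) A"
      by (simp add: emeasure_density)
    finally show "emeasure (distr ?g (PiM I M) fst) A = \<dots>" .
  qed simp
  have snd': "distr ?g (PiM I M) snd = PiM I M"
  proof (rule measure_eqI)
    fix A assume "A \<in> sets (distr ?g (PiM I M) snd)"
    hence A[measurable]: "A \<in> sets (PiM I M)" by simp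
    have "emeasure (distr ?g (PiM I M) snd) A = (\<integral>\<^sup>+x. indicator A x \<partial>distr ?g (PiM I M) snd)"
      by simp
    also have "\<dots> = (\<integral>\<^sup>+r. indicator A (snd r) \<partial>?g)"
      by (subst nn_integral_distr) auto
    also have "\<dots> = (\<integral>\<^sup>+q. \<integral>\<^sup>+u. indicator A ((snd q)(i := u)) \<partial>M i \<partial>\<gamma>)"
      by (subst formula, measurable, intro nn_integral_cong, simp, rule M.maximal_coupling_snd)
        (auto simp: space_\<gamma> p1 px)
    also have "\<dots> = (\<integral>\<^sup>+x. \<integral>\<^sup>+u. indicator A (x(i := u)) \<partial>M i \<partial>PiM I M)"
      by (rule int_\<gamma>2) measurable
    also have "\<dots> = (\<integral>\<^sup>+x. indicator A x \<partial>PiM I M)"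
      by (rule nn_integral_update[OF i, symmetric]) measurable
    finally show "emeasure (distr ?g (PiM I M) snd) A = emeasure (PiM I M) A" by simp
  qed simp
  show ?thesis
  proof (rule that[OF sets' fst' snd'])
    fix j and \<phi> :: "'b \<Rightarrow> 'b \<Rightarrow> ennreal"
    assume j[measurable]: "j \<in> I" and ji: "j \<noteq> i"
      and [measurable]: "(\<lambda>(u, v). \<phi> u v) \<in> borel_measurable (M j \<Otimes>\<^sub>M M j)"
    have "(\<integral>\<^sup>+q. \<phi> (fst q j) (snd q j) \<partial>?g)
        = (\<integral>\<^sup>+q. \<integral>\<^sup>+u. p (fst q) u * \<phi> (fst q j) (snd q j) \<partial>M i \<partial>\<gamma>)"
      using ji by (subst formula, measurable, intro nn_integral_cong, simp, intro M.maximal_coupling_fst)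
        (auto simp: space_\<gamma> p1 px)
    also have "\<dots> = (\<integral>\<^sup>+q. \<phi> (fst q j) (snd q j) \<partial>\<gamma>)"
      by (intro nn_integral_cong, subst nn_integral_multc) (auto simp: space_\<gamma> p1 px)
    finally show "(\<integral>\<^sup>+q. \<phi> (fst q j) (snd q j) \<partial>?g) = (\<integral>\<^sup>+q. \<phi> (fst q j) (snd q j) \<partial>\<gamma>)" .
  next
    fix d :: "'b \<Rightarrow> 'b \<Rightarrow> ennreal"
    assume [measurable]: "(\<lambda>(u, v). d u v) \<in> borel_measurable (M i \<Otimes>\<^sub>M M i)"
      and d1: "\<And>u v. u \<in> space (M i) \<Longrightarrow> v \<in> space (M i) \<Longrightarrow> d u v \<le> 1"
      and d0: "\<And>u. u \<in> space (M i) \<Longrightarrow> d u u = 0"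
    have "(\<integral>\<^sup>+q. d (fst q i) (snd q i) \<partial>?g) \<le> (\<integral>\<^sup>+q. \<integral>\<^sup>+u. (p (fst q) u - 1) \<partial>M i \<partial>\<gamma>)"
      by (subst formula, measurable, intro nn_integral_mono, simp, intro M.maximal_coupling_cost)
        (auto simp: space_\<gamma> p1 px d1 d0)
    also have "\<dots> = (\<integral>\<^sup>+x. a x * (\<integral>\<^sup>+u. (p x u - 1) \<partial>M i) \<partial>PiM I M)"
      by (rule int_\<gamma>1) measurable
    \<comment> \<open>As \<open>a\<close> is free of \<open>i\<close>, \<open>a x\<close> may be
      written \<open>a (x(i := u))\<close>; the integrand then depends on the updated point alone
      and \<open>nn_integral_update\<close> removes the inner integral.\<close>
    also have "\<dots> \<le> (\<integral>\<^sup>+x. \<integral>\<^sup>+u. ennreal (b (x(i := u)) - a (x(i := u))) \<partial>M i \<partial>PiM I M)"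
    proof (intro nn_integral_mono)
      fix x assume x: "x \<in> space (PiM I M)"
      have "ennreal (a x) * (\<integral>\<^sup>+u. (p x u - 1) \<partial>M i) = (\<integral>\<^sup>+u. a x * (p x u - 1) \<partial>M i)"
        using px[OF x] by (subst nn_integral_cmult) auto
      also have "\<dots> \<le> (\<integral>\<^sup>+u. ennreal (b (x(i := u)) - a (x(i := u))) \<partial>M i)"
      proof (intro nn_integral_mono)
        fix u assume u: "u \<in> space (M i)"
        have au: "a (x(i := u)) = a x" using a(3) x u by (simp add: free_of_def)
        have bu: "b (x(i := u)) \<ge> 0" using b(2) update_in_space[OF i x u] by simp
        show "ennreal (a x) * (p x u - 1) \<le> ennreal (b (x(i := u)) - a (x(i := u)))"
        proof (cases "a x = 0")
          case False
          hence pos: "a x > 0" using a(2)[OF x] by simp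
          have "p x u - 1 = ennreal (b (x(i := u)) / a x - 1)"
            using pos bu by (simp add: p_def ennreal_minus flip: ennreal_1)
          also have "ennreal (a x) * \<dots> = ennreal (a x * (b (x(i := u)) / a x - 1))"
            using pos by (simp add: ennreal_mult')
          also have "a x * (t / a x - 1) = t - a x" for t
            using pos by (simp add: right_diff_distrib)
          finally show ?thesis by (simp only: au)
        qed simp
      qed
      finally show "ennreal (a x) * (\<integral>\<^sup>+u. (p x u - 1) \<partial>M i)
          \<le> (\<integral>\<^sup>+u. ennreal (b (x(i := u)) - a (x(i := u))) \<partial>M i)" .
    qed
    also have "\<dots> = (\<integral>\<^sup>+x. ennreal (b x - a x) \<partial>PiM I M)"
      by (rule nn_integral_update[OF i, symmetric]) measurable
    finally show "(\<integral>\<^sup>+q. d (fst q i) (snd q i) \<partial>?g) \<le> (\<integral>\<^sup>+x. ennreal (b x - a x) \<partial>PiM I M)" .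
  qed
qed

end

subsection \<open>Marton's inequality\<close>

text \<open>Otherwise the index set \<open>{1..n}\<close> of the locales below is rewritten to \<open>{Suc 0..n}\<close>.\<close>
declare One_nat_def [simp del]

text \<open>Legendre duality between \<open>h ln h - h\<close> and \<open>exp\<close>, from
  \<open>ln t \<le> t - 1\<close> at \<open>t = exp s / h\<close>. At \<open>h = 0\<close> the
  convention \<open>ln 0 = 0\<close> gives the right value. Integrated, it is the lower bound in the
  variational formula for entropy.\<close>

lemma entropy_young:
  fixes h s :: real
  assumes "h \<ge> 0"
  shows "h * s - exp s \<le> h * ln h - h"
proof (cases "h = 0")
  case False
  hence h: "h > 0" using assms by simp
  have "s - ln h \<le> exp s / h - 1"
    using ln_le_minus_one[of "exp s / h"] h by (simp add: ln_div)
  hence "h * (s - ln h) \<le> h * (exp s / h - 1)" using h by (intro mult_left_mono) auto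
  thus ?thesis using h by (simp add: right_diff_distrib)
qed simp

lemma abs_mult_ln_le:
  fixes h :: real
  assumes "0 \<le> h" "h \<le> B"
  shows "\<bar>h * ln h\<bar> \<le> 1 + B\<^sup>2"
proof (cases "h = 0")
  case False
  hence h: "h > 0" using assms by simp
  have "h * ln h \<le> h * (h - 1)" using h ln_le_minus_one[OF h] by (intro mult_left_mono) auto
  also have "\<dots> \<le> h * h" using h by (intro mult_left_mono) auto
  also have "\<dots> \<le> B\<^sup>2" using assms by (simp add: power2_eq_square mult_mono)
  finally have "h * ln h \<le> 1 + B\<^sup>2" by simp
  moreover have "h * ln h \<ge> -1" using entropy_young[of h 0] assms by simp
  ultimately show ?thesis by (smt (verit) zero_le_power2)
qed simp

context finite_product_prob_space
begin

lemma bfun_mult_ln: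
  assumes h: "bfun h" "\<And>x. x \<in> space (PiM I M) \<Longrightarrow> 0 \<le> h x"
  shows "bfun (\<lambda>x. h x * ln (h x))"
proof -
  obtain B where "\<And>x. x \<in> space (PiM I M) \<Longrightarrow> \<bar>h x\<bar> \<le> B" using bfun_bound[OF h(1)] by metis
  hence "\<bar>h x * ln (h x)\<bar> \<le> 1 + B\<^sup>2" if "x \<in> space (PiM I M)" for x
    using abs_mult_ln_le[of "h x" B] h(2) that by (metis abs_le_D1)
  thus ?thesis using h by (intro bfunI) auto
qed

text \<open>Hoeffding's lemma on a single fibre, for a variable ranging in an interval of length 1;
  the constant 1/8 enters here.\<close>

lemma cavg_exp_centered:
  assumes i: "i \<in> I" and \<phi>: "bfun \<phi>" "\<And>x. x \<in> space (PiM I M) \<Longrightarrow> \<phi> x \<in> {0..1}"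
    and l: "l > 0" and x: "x \<in> space (PiM I M)"
  shows "cavg i (\<lambda>x. exp (l * (\<phi> x - cavg i \<phi> x))) x \<le> exp (l\<^sup>2 / 8)"
proof -
  have meas: "(\<lambda>u. \<phi> (x(i := u))) \<in> borel_measurable (M i)"
    using bfun_integrable_update[OF i \<phi>(1) x] by (rule borel_measurable_integrable)
  interpret iv: interval_bounded_random_variable "M i" "\<lambda>u. \<phi> (x(i := u))" 0 1
    using meas \<phi>(2) update_in_space[OF i x] by unfold_locales (auto intro!: AE_I2)
  have bf: "bfun (\<lambda>x. exp (l * (\<phi> x - cavg i \<phi> x)))"
    using i \<phi> by (intro bfun_exp bfun_mult bfun_const bfun_diff bfun_cavg)
  have "ennreal (cavg i (\<lambda>x. exp (l * (\<phi> x - cavg i \<phi> x))) x)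
      = (\<integral>\<^sup>+u. exp (l * (\<phi> (x(i := u)) - cavg i \<phi> (x(i := u)))) \<partial>M i)"
    using bfun_integrable_update[OF i bf x]
    by (subst cavg_def, intro nn_integral_eq_integral[symmetric]) auto
  also have "\<dots> = (\<integral>\<^sup>+u. exp (l * (\<phi> (x(i := u)) - (\<integral>u. \<phi> (x(i := u)) \<partial>M i))) \<partial>M i)"
    by (simp add: cavg_def)
  also have "\<dots> \<le> ennreal (exp (l\<^sup>2 / 8))"
    using iv.Hoeffdings_lemma_nn_integral[OF l] by simp
  finally show ?thesis by simp
qed

end

section \<open>Conditional expectations given the first coordinates\<close>

locale nat_product_prob_space = finite_product_prob_space M "{1..n}"
  for M :: "nat \<Rightarrow> 'b measure" and n :: nat
begin

text \<open>The conditional expectation of \<open>h\<close> given the first \<open>k\<close>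
  coordinates. Folding from the right makes \<open>Suc k\<close> the outermost average, so lowering
  \<open>k\<close> by one applies one further \<open>cavg\<close>.\<close>

definition tail_avg :: "((nat \<Rightarrow> 'b) \<Rightarrow> real) \<Rightarrow> nat \<Rightarrow> (nat \<Rightarrow> 'b) \<Rightarrow> real" where
  "tail_avg h k = foldr cavg [Suc k..<Suc n] h"

lemma tail_avg_n [simp]: "tail_avg h n = h"
  by (simp add: tail_avg_def)

lemma tail_avg_step: "k < n \<Longrightarrow> tail_avg h k = cavg (Suc k) (tail_avg h (Suc k))"
  by (simp add: tail_avg_def upt_conv_Cons del: upt_Suc)

lemma tail_avg_pred: "k \<in> {1..n} \<Longrightarrow> tail_avg h (k - 1) = cavg k (tail_avg h k)"
  using tail_avg_step[of "k - 1" h] by auto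

lemma bfun_tail_avg:
  assumes h: "bfun h" and k: "k \<le> n" shows "bfun (tail_avg h k)"
  using k by (induction k rule: inc_induct) (auto simp: tail_avg_step h intro!: bfun_cavg)

lemma tail_avg_ge:
  assumes h: "bfun h" "\<And>x. x \<in> space (PiM {1..n} M) \<Longrightarrow> c \<le> h x"
  shows "k \<le> n \<Longrightarrow> x \<in> space (PiM {1..n} M) \<Longrightarrow> c \<le> tail_avg h k x"
proof (induction k arbitrary: x rule: inc_induct)
  case (step k)
  have "cavg (Suc k) (\<lambda>_. c) x \<le> cavg (Suc k) (tail_avg h (Suc k)) x"
    using step h by (intro cavg_mono bfun_const bfun_tail_avg) auto
  thus ?case using step by (simp add: tail_avg_step cavg_const)
qed (use h in auto)

lemma free_of_tail_avg:
  assumes "k \<le> n" "j \<in> {k<..n}" shows "free_of j (tail_avg h k)"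
  using assms
proof (induction k rule: inc_induct)
  case (step k)
  show ?case
  proof (cases "j = Suc k")
    case True thus ?thesis using step by (simp add: tail_avg_step free_of_cavg_same)
  next
    case False
    thus ?thesis using step by (auto simp: tail_avg_step intro!: free_of_cavg)
  qed
qed auto

text \<open>A factor free of the averaged coordinates passes through each \<open>cavg\<close>, and
  \<open>cavg\<close> preserves integrals. This is the defining property of conditional
  expectation.\<close>

lemma integral_mult_tail_avg:
  assumes h: "bfun h" and a: "bfun a" "\<And>j. j \<in> {k<..n} \<Longrightarrow> free_of j a" and k: "k \<le> n"
  shows "(\<integral>x. a x * tail_avg h k x \<partial>PiM {1..n} M) = (\<integral>x. a x * h x \<partial>PiM {1..n} M)"
  using k a(2)
proof (induction k rule: inc_induct)
  case (step k)
  have k: "Suc k \<in> {1..n}" using step by auto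
  have "(\<integral>x. a x * tail_avg h k x \<partial>PiM {1..n} M)
      = (\<integral>x. cavg (Suc k) (\<lambda>x. a x * tail_avg h (Suc k) x) x \<partial>PiM {1..n} M)"
    using step k by (intro Bochner_Integration.integral_cong) (auto simp: tail_avg_step cavg_mult_free)
  also have "\<dots> = (\<integral>x. a x * tail_avg h (Suc k) x \<partial>PiM {1..n} M)"
    using k h a by (intro integral_cavg bfun_mult bfun_tail_avg) auto
  finally show ?case using step by auto
qed simp

lemma tail_avg_0:
  assumes h: "bfun h" and x: "x \<in> space (PiM {1..n} M)"
  shows "tail_avg h 0 x = (\<integral>x. h x \<partial>PiM {1..n} M)"
proof -
  have "(\<integral>x. h x \<partial>PiM {1..n} M) = (\<integral>z. tail_avg h 0 z \<partial>PiM {1..n} M)"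
    using integral_mult_tail_avg[OF h bfun_const[of 1], of 0] by (simp add: free_of_def)
  also have "\<dots> = (\<integral>z. tail_avg h 0 x \<partial>PiM {1..n} M)"
    using x by (intro Bochner_Integration.integral_cong constant_if_free[of "tail_avg h 0"] free_of_tail_avg) auto
  finally show ?thesis by (simp add: P.prob_space)
qed

text \<open>The Azuma-Hoeffding argument: the first \<open>m\<close> increments are free of
  coordinate \<open>Suc m\<close>, so averaging over that coordinate acts on the last factor only
  and costs \<open>exp (l\<^sup>2 / 8)\<close>.\<close>

lemma integral_exp_martingale_le:
  assumes l: "l > 0"
    and \<phi>: "\<And>k. k \<in> {1..n} \<Longrightarrow> bfun (\<phi> k)"
      "\<And>k x. k \<in> {1..n} \<Longrightarrow> x \<in> space (PiM {1..n} M) \<Longrightarrow> \<phi> k x \<in> {0..1}"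
      "\<And>j k. k \<in> {1..n} \<Longrightarrow> j \<in> {k<..n} \<Longrightarrow> free_of j (\<phi> k)"
    and m: "m \<le> n"
  shows "(\<integral>x. exp (\<Sum>k=1..m. l * (\<phi> k x - cavg k (\<phi> k) x)) \<partial>PiM {1..n} M) \<le> exp (real m * (l\<^sup>2 / 8))"
  using m
proof (induction m)
  case (Suc m)
  let ?D = "\<lambda>k x. l * (\<phi> k x - cavg k (\<phi> k) x)"
  let ?S = "\<lambda>x. \<Sum>k=1..m. ?D k x"
  have k: "Suc m \<in> {1..n}" using Suc.prems by auto
  have bD: "bfun (?D k)" if "k \<in> {1..n}" for k
    using \<phi>(1)[OF that] that by (intro bfun_mult bfun_const bfun_diff bfun_cavg)
  have bS: "bfun ?S" using Suc.prems bD by (intro bfun_sum) auto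
  have freeS: "free_of (Suc m) (\<lambda>x. exp (?S x))"
  proof -
    have "free_of (Suc m) (?D k)" if "k \<in> {1..m}" for k
      using that Suc.prems by (intro free_of_comp2[of _ _ _ "\<lambda>a b. l * (a - b)"] \<phi>(3) free_of_cavg) auto
    thus ?thesis unfolding free_of_def by (intro ballI arg_cong[of _ _ exp] sum.cong refl) blast
  qed
  have "(\<integral>x. exp (\<Sum>k=1..Suc m. ?D k x) \<partial>PiM {1..n} M)
      = (\<integral>x. exp (?S x) * exp (?D (Suc m) x) \<partial>PiM {1..n} M)"
    by (simp add: exp_add)
  also have "\<dots> = (\<integral>x. cavg (Suc m) (\<lambda>x. exp (?S x) * exp (?D (Suc m) x)) x \<partial>PiM {1..n} M)"
    by (rule integral_cavg[OF k bfun_mult[OF bfun_exp[OF bS] bfun_exp[OF bD[OF k]]], symmetric])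
  also have "\<dots> \<le> (\<integral>x. exp (?S x) * exp (l\<^sup>2 / 8) \<partial>PiM {1..n} M)"
  proof (rule integral_mono)
    show "integrable (PiM {1..n} M) (cavg (Suc m) (\<lambda>x. exp (?S x) * exp (?D (Suc m) x)))"
      by (rule bfun_integrable[OF bfun_cavg[OF k bfun_mult[OF bfun_exp[OF bS] bfun_exp[OF bD[OF k]]]]])
    show "integrable (PiM {1..n} M) (\<lambda>x. exp (?S x) * exp (l\<^sup>2 / 8))"
      by (rule bfun_integrable[OF bfun_mult[OF bfun_exp[OF bS] bfun_const]])
    fix x assume x: "x \<in> space (PiM {1..n} M)"
    show "cavg (Suc m) (\<lambda>x. exp (?S x) * exp (?D (Suc m) x)) x \<le> exp (?S x) * exp (l\<^sup>2 / 8)"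
      using cavg_exp_centered[OF k \<phi>(1)[OF k] \<phi>(2)[OF k] l x]
      by (subst cavg_mult_free[OF k freeS x]) (auto intro!: mult_left_mono)
  qed
  also have "\<dots> \<le> exp (real m * (l\<^sup>2 / 8)) * exp (l\<^sup>2 / 8)"
    using Suc by simp
  also have "\<dots> = exp (real (Suc m) * (l\<^sup>2 / 8))"
    by (simp add: exp_add[symmetric] algebra_simps)
  finally show ?case .
qed (simp add: P.prob_space)

text \<open>The entropy is bounded below by its variational formula, tested on the martingale
  \<open>s = l \<Sum> (\<phi> k - E[\<phi> k | coordinates < k])\<close>, where \<open>\<phi> k\<close> marks the set on which the \<open>k\<close>-th
  increment is positive. This avoids conditional densities, which may be \<open>0 / 0\<close>.\<close>

lemma sum_increments_le_entropy:
  assumes h: "bfun h" "\<And>x. x \<in> space (PiM {1..n} M) \<Longrightarrow> 0 \<le> h x" "(\<integral>x. h x \<partial>PiM {1..n} M) = 1"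
    and l: "l > 0"
  shows "l * (\<Sum>k=1..n. \<integral>x. max 0 (tail_avg h k x - tail_avg h (k - 1) x) \<partial>PiM {1..n} M)
       \<le> (\<integral>x. h x * ln (h x) \<partial>PiM {1..n} M) + real n * l\<^sup>2 / 8"
proof -
  let ?P = "PiM {1..n} M"
  define \<phi> where "\<phi> = (\<lambda>k x. if tail_avg h (k - 1) x < tail_avg h k x then 1 else 0 :: real)"
  have b\<phi>: "bfun (\<phi> k)" if k: "k \<in> {1..n}" for k
  proof -
    have [measurable]: "tail_avg h k \<in> borel_measurable ?P" "tail_avg h (k - 1) \<in> borel_measurable ?P"
      using k by (auto intro!: bfun_measurable bfun_tail_avg h)
    show ?thesis by (rule bfunI[of _ 1]) (auto simp: \<phi>_def)
  qed
  have f\<phi>: "free_of j (\<phi> k)" if "k \<in> {1..n}" "j \<in> {k<..n}" for j k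
    unfolding \<phi>_def using that
    by (intro free_of_comp2[where F = "\<lambda>a b. if a < b then 1 else 0"] free_of_tail_avg) auto
  have bc\<phi>: "bfun (cavg k (\<phi> k))" if "k \<in> {1..n}" for k
    using that by (intro bfun_cavg b\<phi>)
  let ?s = "\<lambda>x. \<Sum>k=1..n. l * (\<phi> k x - cavg k (\<phi> k) x)"
  have bs: "bfun ?s"
    by (intro bfun_sum bfun_mult bfun_const bfun_diff b\<phi> bc\<phi>) auto
  \<comment> \<open>The indicator \<open>\<phi> k\<close> selects the positive part, and then both
    conditional expectations are traded for \<open>h\<close>: the first because
    \<open>\<phi> k\<close> is free of later coordinates, the second after \<open>\<phi> k\<close>
    is averaged over coordinate \<open>k\<close>.\<close>
  have incr: "(\<integral>x. max 0 (tail_avg h k x - tail_avg h (k - 1) x) \<partial>?P)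
      = (\<integral>x. h x * (\<phi> k x - cavg k (\<phi> k) x) \<partial>?P)" if k: "k \<in> {1..n}" for k
  proof -
    have bt: "bfun (tail_avg h k)" "bfun (tail_avg h (k - 1))"
      using k by (auto intro!: bfun_tail_avg h)
    have "(\<integral>x. max 0 (tail_avg h k x - tail_avg h (k - 1) x) \<partial>?P)
        = (\<integral>x. \<phi> k x * tail_avg h k x - \<phi> k x * tail_avg h (k - 1) x \<partial>?P)"
      by (intro Bochner_Integration.integral_cong) (auto simp: \<phi>_def)
    also have "\<dots> = (\<integral>x. \<phi> k x * tail_avg h k x \<partial>?P) - (\<integral>x. \<phi> k x * tail_avg h (k - 1) x \<partial>?P)"
      using k bt by (intro Bochner_Integration.integral_diff bfun_integrable bfun_mult b\<phi>)
    also have "(\<integral>x. \<phi> k x * tail_avg h k x \<partial>?P) = (\<integral>x. \<phi> k x * h x \<partial>?P)"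
      using k by (intro integral_mult_tail_avg h b\<phi> f\<phi>) auto
    also have "(\<integral>x. \<phi> k x * tail_avg h (k - 1) x \<partial>?P)
        = (\<integral>x. cavg k (\<lambda>x. tail_avg h (k - 1) x * \<phi> k x) x \<partial>?P)"
      using k bt by (subst integral_cavg) (auto intro!: bfun_mult b\<phi> simp: mult.commute)
    also have "\<dots> = (\<integral>x. cavg k (\<phi> k) x * tail_avg h (k - 1) x \<partial>?P)"
      using k by (intro Bochner_Integration.integral_cong refl)
        (auto simp: cavg_mult_free free_of_tail_avg)
    also have "\<dots> = (\<integral>x. cavg k (\<phi> k) x * h x \<partial>?P)"
    proof (intro integral_mult_tail_avg h bc\<phi> k)
      fix j assume j: "j \<in> {k - 1<..n}"
      show "free_of j (cavg k (\<phi> k))"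
      proof (cases "j = k")
        case False
        thus ?thesis using j k by (intro free_of_cavg f\<phi>) auto
      qed (simp add: free_of_cavg_same)
    qed (use k in auto)
    also have "(\<integral>x. \<phi> k x * h x \<partial>?P) - (\<integral>x. cavg k (\<phi> k) x * h x \<partial>?P)
        = (\<integral>x. \<phi> k x * h x - cavg k (\<phi> k) x * h x \<partial>?P)"
      using k h by (intro Bochner_Integration.integral_diff[symmetric] bfun_integrable bfun_mult b\<phi> bc\<phi>)
    finally show ?thesis by (simp add: algebra_simps)
  qed
  \<comment> \<open>Lowering the test function by \<open>?c\<close> brings the mean of its
    exponential down to at most 1, which offsets the \<open>- 1\<close> contributed by the integral
    of \<open>- h\<close>.\<close>
  let ?c = "real n * l\<^sup>2 / 8"
  have "l * (\<Sum>k=1..n. \<integral>x. max 0 (tail_avg h k x - tail_avg h (k - 1) x) \<partial>?P)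
      = (\<Sum>k=1..n. \<integral>x. h x * (l * (\<phi> k x - cavg k (\<phi> k) x)) \<partial>?P)"
    by (simp add: incr sum_distrib_left mult.left_commute[of _ l])
  also have "\<dots> = (\<integral>x. h x * ?s x \<partial>?P)"
    unfolding sum_distrib_left using h
    by (intro Bochner_Integration.integral_sum[symmetric] bfun_integrable bfun_mult bfun_const bfun_diff b\<phi> bc\<phi>) auto
  finally have 1: "l * (\<Sum>k=1..n. \<integral>x. max 0 (tail_avg h k x - tail_avg h (k - 1) x) \<partial>?P)
      = (\<integral>x. h x * ?s x \<partial>?P)" .
  have "(\<integral>x. h x * (?s x - ?c) - exp (?s x - ?c) \<partial>?P) \<le> (\<integral>x. h x * ln (h x) - h x \<partial>?P)"
    using h bs by (intro integral_mono bfun_integrable bfun_diff bfun_mult bfun_exp bfun_const bfun_mult_ln entropy_young)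
  also have "\<dots> = (\<integral>x. h x * ln (h x) \<partial>?P) - 1"
    using h by (subst Bochner_Integration.integral_diff) (auto intro!: bfun_integrable bfun_mult_ln)
  finally have "(\<integral>x. h x * (?s x - ?c) - exp (?s x - ?c) \<partial>?P) \<le> (\<integral>x. h x * ln (h x) \<partial>?P) - 1" .
  moreover have "(\<integral>x. h x * (?s x - ?c) - exp (?s x - ?c) \<partial>?P)
      = (\<integral>x. (h x * ?s x - h x * ?c) - exp (?s x) * exp (- ?c) \<partial>?P)"
    unfolding exp_add[symmetric] right_diff_distrib[symmetric] by simp
  moreover have "\<dots> = (\<integral>x. h x * ?s x - h x * ?c \<partial>?P) - (\<integral>x. exp (?s x) * exp (- ?c) \<partial>?P)"
    by (intro Bochner_Integration.integral_diff bfun_integrable bfun_diff bfun_mult bfun_exp bfun_const bs h)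
  moreover have "(\<integral>x. h x * ?s x - h x * ?c \<partial>?P) = (\<integral>x. h x * ?s x \<partial>?P) - (\<integral>x. h x * ?c \<partial>?P)"
    by (intro Bochner_Integration.integral_diff bfun_integrable bfun_mult bfun_const bs h)
  moreover have "(\<integral>x. h x * ?c \<partial>?P) = ?c" using h by simp
  moreover have "(\<integral>x. exp (?s x) * exp (- ?c) \<partial>?P) \<le> exp ?c * exp (- ?c)"
    using integral_exp_martingale_le[of l \<phi> n, OF l b\<phi> _ f\<phi>]
    by (auto simp: \<phi>_def intro!: mult_right_mono)
  hence "(\<integral>x. exp (?s x) * exp (- ?c) \<partial>?P) \<le> 1" by (simp add: exp_minus_inverse)
  ultimately show ?thesis using 1 by linarith
qed

text \<open>The density \<open>tail_avg h k\<close> keeps the law of the first \<open>k\<close> coordinates under \<open>h\<close> and makes the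
  others independent; step \<open>k\<close> of the induction resamples coordinate \<open>k\<close> only, so the cost of each
  coordinate is fixed once that coordinate has been treated.\<close>

lemma hybrid_coupling:
  assumes h: "bfun h" "\<And>x. x \<in> space (PiM {1..n} M) \<Longrightarrow> 0 \<le> h x" "(\<integral>x. h x \<partial>PiM {1..n} M) = 1"
    and d: "\<And>i. i \<in> {1..n} \<Longrightarrow> (\<lambda>(u, v). d i u v) \<in> borel_measurable (M i \<Otimes>\<^sub>M M i)"
      "\<And>i u v. i \<in> {1..n} \<Longrightarrow> u \<in> space (M i) \<Longrightarrow> v \<in> space (M i) \<Longrightarrow> d i u v \<le> (1::ennreal)"
      "\<And>i u. i \<in> {1..n} \<Longrightarrow> u \<in> space (M i) \<Longrightarrow> d i u u = 0"
  shows "k \<le> n \<Longrightarrow> \<exists>\<gamma>. sets \<gamma> = sets (PiM {1..n} M \<Otimes>\<^sub>M PiM {1..n} M) \<and>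
    distr \<gamma> (PiM {1..n} M) fst = density (PiM {1..n} M) (\<lambda>x. ennreal (tail_avg h k x)) \<and>
    distr \<gamma> (PiM {1..n} M) snd = PiM {1..n} M \<and>
    (\<forall>i\<in>{1..k}. (\<integral>\<^sup>+q. d i (fst q i) (snd q i) \<partial>\<gamma>)
        \<le> (\<integral>\<^sup>+x. ennreal (tail_avg h i x - tail_avg h (i - 1) x) \<partial>PiM {1..n} M))"
proof (induction k)
  case 0
  let ?P = "PiM {1..n} M" and ?\<gamma> = "distr (PiM {1..n} M) (PiM {1..n} M \<Otimes>\<^sub>M PiM {1..n} M) (\<lambda>x. (x, x))"
  \<comment> \<open>\<open>tail_avg h 0\<close> is the constant mean of \<open>h\<close>, which is
    1, so the diagonal coupling of the product measure with itself starts the induction.\<close>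
  have "density ?P (\<lambda>x. ennreal (tail_avg h 0 x)) = density ?P (\<lambda>_. 1)"
    by (rule density_cong)
      (use bfun_measurable[OF bfun_tail_avg[OF h(1)]] in \<open>auto simp: tail_avg_0 h intro!: AE_I2\<close>)
  thus ?case
    by (intro exI[of _ ?\<gamma>]) (auto simp: distr_distr comp_def density_1)
next
  case (Suc k)
  let ?P = "PiM {1..n} M"
  from Suc obtain \<gamma> where \<gamma>: "sets \<gamma> = sets (?P \<Otimes>\<^sub>M ?P)"
      "distr \<gamma> ?P fst = density ?P (\<lambda>x. ennreal (tail_avg h k x))" "distr \<gamma> ?P snd = ?P"
      and cost: "\<And>i. i \<in> {1..k} \<Longrightarrow> (\<integral>\<^sup>+q. d i (fst q i) (snd q i) \<partial>\<gamma>)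
        \<le> (\<integral>\<^sup>+x. ennreal (tail_avg h i x - tail_avg h (i - 1) x) \<partial>?P)"
    by auto
  have k: "Suc k \<in> {1..n}" using Suc.prems by auto
  obtain \<gamma>' where \<gamma>': "sets \<gamma>' = sets (?P \<Otimes>\<^sub>M ?P)"
      "distr \<gamma>' ?P fst = density ?P (\<lambda>x. ennreal (tail_avg h (Suc k) x))" "distr \<gamma>' ?P snd = ?P"
    and others: "\<And>j \<phi>. j \<in> {1..n} \<Longrightarrow> j \<noteq> Suc k \<Longrightarrow> (\<lambda>(u, v). \<phi> u v) \<in> borel_measurable (M j \<Otimes>\<^sub>M M j) \<Longrightarrow>
        (\<integral>\<^sup>+q. \<phi> (fst q j) (snd q j) \<partial>\<gamma>') = (\<integral>\<^sup>+q. \<phi> (fst q j) (snd q j) \<partial>\<gamma>)"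
    and new: "\<And>d. (\<lambda>(u, v). d u v) \<in> borel_measurable (M (Suc k) \<Otimes>\<^sub>M M (Suc k)) \<Longrightarrow>
        (\<And>u v. u \<in> space (M (Suc k)) \<Longrightarrow> v \<in> space (M (Suc k)) \<Longrightarrow> d u v \<le> 1) \<Longrightarrow>
        (\<And>u. u \<in> space (M (Suc k)) \<Longrightarrow> d u u = 0) \<Longrightarrow>
        (\<integral>\<^sup>+q. d (fst q (Suc k)) (snd q (Suc k)) \<partial>\<gamma>')
          \<le> (\<integral>\<^sup>+x. ennreal (tail_avg h (Suc k) x - tail_avg h k x) \<partial>?P)"
  proof (rule coupling_step[OF k \<gamma>])
    show "bfun (tail_avg h k)" "bfun (tail_avg h (Suc k))" "free_of (Suc k) (tail_avg h k)"
      using h Suc.prems by (auto intro: bfun_tail_avg free_of_tail_avg)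
    show "0 \<le> tail_avg h k x" "0 \<le> tail_avg h (Suc k) x" if "x \<in> space ?P" for x
      using h Suc.prems that by (auto intro!: tail_avg_ge)
    show "cavg (Suc k) (tail_avg h (Suc k)) x = tail_avg h k x" for x
      using Suc.prems by (simp add: tail_avg_step)
  qed blast
  have "(\<integral>\<^sup>+q. d i (fst q i) (snd q i) \<partial>\<gamma>')
        \<le> (\<integral>\<^sup>+x. ennreal (tail_avg h i x - tail_avg h (i - 1) x) \<partial>?P)" if i: "i \<in> {1..Suc k}" for i
  proof (cases "i = Suc k")
    case True
    thus ?thesis using new[of "d (Suc k)"] d k by auto
  next
    case False
    thus ?thesis using others[of i "d i"] d(1)[of i] cost[of i] i Suc.prems by auto
  qed
  thus ?case using \<gamma>' by blast
qed

text \<open>At \<open>k = n\<close> the hybrid density is \<open>h\<close> itself, and the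
  coordinate costs are the positive parts of its martingale increments, whose sum the entropy
  controls. The coupling is chosen before \<open>l\<close>.\<close>

lemma marton_coupling:
  assumes h: "bfun h" "\<And>x. x \<in> space (PiM {1..n} M) \<Longrightarrow> 0 \<le> h x" "(\<integral>x. h x \<partial>PiM {1..n} M) = 1"
    and d: "\<And>i. i \<in> {1..n} \<Longrightarrow> (\<lambda>(u, v). d i u v) \<in> borel_measurable (M i \<Otimes>\<^sub>M M i)"
      "\<And>i u v. i \<in> {1..n} \<Longrightarrow> u \<in> space (M i) \<Longrightarrow> v \<in> space (M i) \<Longrightarrow> d i u v \<in> {0..1::real}"
      "\<And>i u. i \<in> {1..n} \<Longrightarrow> u \<in> space (M i) \<Longrightarrow> d i u u = 0"
  obtains \<gamma> where "\<gamma> \<in> couplings (density (PiM {1..n} M) (\<lambda>x. ennreal (h x))) (PiM {1..n} M)"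
    "\<And>l. l > 0 \<Longrightarrow> l * (\<Sum>i=1..n. \<integral>q. d i (fst q i) (snd q i) \<partial>\<gamma>)
       \<le> (\<integral>x. h x * ln (h x) \<partial>PiM {1..n} M) + real n * l\<^sup>2 / 8"
proof -
  let ?P = "PiM {1..n} M"
  have "\<exists>\<gamma>. sets \<gamma> = sets (?P \<Otimes>\<^sub>M ?P) \<and>
    distr \<gamma> ?P fst = density ?P (\<lambda>x. ennreal (tail_avg h n x)) \<and> distr \<gamma> ?P snd = ?P \<and>
    (\<forall>i\<in>{1..n}. (\<integral>\<^sup>+q. ennreal (d i (fst q i) (snd q i)) \<partial>\<gamma>)
        \<le> (\<integral>\<^sup>+x. ennreal (tail_avg h i x - tail_avg h (i - 1) x) \<partial>?P))"
  proof (rule hybrid_coupling[OF h, of "\<lambda>i u v. ennreal (d i u v)"])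
    show "(\<lambda>(u, v). ennreal (d i u v)) \<in> borel_measurable (M i \<Otimes>\<^sub>M M i)" if "i \<in> {1..n}" for i
      using measurable_compose[OF d(1)[OF that] measurable_ennreal] by (simp add: split_beta')
  qed (use d in auto)
  then obtain \<gamma> where \<gamma>: "sets \<gamma> = sets (?P \<Otimes>\<^sub>M ?P)"
      "distr \<gamma> ?P fst = density ?P (\<lambda>x. ennreal (h x))" "distr \<gamma> ?P snd = ?P"
      and cost: "\<And>i. i \<in> {1..n} \<Longrightarrow> (\<integral>\<^sup>+q. ennreal (d i (fst q i) (snd q i)) \<partial>\<gamma>)
        \<le> (\<integral>\<^sup>+x. ennreal (tail_avg h i x - tail_avg h (i - 1) x) \<partial>?P)"
    by auto
  have space_\<gamma>: "space \<gamma> = space ?P \<times> space ?P"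
    using sets_eq_imp_space_eq[OF \<gamma>(1)] by (simp add: space_pair_measure)
  have "distr \<gamma> (density ?P (\<lambda>x. ennreal (h x))) fst = distr \<gamma> ?P fst"
    by (rule distr_cong) auto
  moreover have "sets (density ?P (\<lambda>x. ennreal (h x)) \<Otimes>\<^sub>M ?P) = sets (?P \<Otimes>\<^sub>M ?P)"
    by (rule sets_pair_measure_cong) auto
  ultimately have \<gamma>_coupling: "\<gamma> \<in> couplings (density ?P (\<lambda>x. ennreal (h x))) ?P"
    using \<gamma> by (simp add: couplings_def)
  have le: "(\<integral>q. d i (fst q i) (snd q i) \<partial>\<gamma>)
      \<le> (\<integral>x. max 0 (tail_avg h i x - tail_avg h (i - 1) x) \<partial>?P)" if i: "i \<in> {1..n}" for i
  proof -
    have "(\<lambda>q. (fst q i, snd q i)) \<in> ?P \<Otimes>\<^sub>M ?P \<rightarrow>\<^sub>M M i \<Otimes>\<^sub>M M i"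
      using i by (intro measurable_Pair measurable_compose[OF measurable_fst] measurable_compose[OF measurable_snd]
        measurable_component_singleton)
    hence "(\<lambda>q. (fst q i, snd q i)) \<in> \<gamma> \<rightarrow>\<^sub>M M i \<Otimes>\<^sub>M M i"
      by (simp add: measurable_cong_sets[OF \<gamma>(1) refl])
    from measurable_compose[OF this d(1)[OF i]]
    have "(\<lambda>q. d i (fst q i) (snd q i)) \<in> borel_measurable \<gamma>"
      by simp
    hence eq: "(\<integral>q. d i (fst q i) (snd q i) \<partial>\<gamma>) = enn2real (\<integral>\<^sup>+q. ennreal (d i (fst q i) (snd q i)) \<partial>\<gamma>)"
      using d(2)[OF i] i by (intro integral_eq_nn_integral AE_I2) (auto simp: space_\<gamma> space_PiM PiE_iff)
    have "(\<integral>\<^sup>+q. ennreal (d i (fst q i) (snd q i)) \<partial>\<gamma>)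
        \<le> (\<integral>\<^sup>+x. ennreal (max 0 (tail_avg h i x - tail_avg h (i - 1) x)) \<partial>?P)"
      using cost[OF i] unfolding ennreal_max_0 .
    also have "\<dots> = ennreal (\<integral>x. max 0 (tail_avg h i x - tail_avg h (i - 1) x) \<partial>?P)"
      using i h by (intro nn_integral_eq_integral bfun_integrable bfun_max0 bfun_diff bfun_tail_avg) auto
    finally show ?thesis unfolding eq by (rule enn2real_leI[rotated]) simp
  qed
  show ?thesis
  proof (rule that[OF \<gamma>_coupling])
    fix l :: real assume l: "l > 0"
    have "l * (\<Sum>i=1..n. \<integral>q. d i (fst q i) (snd q i) \<partial>\<gamma>)
        \<le> l * (\<Sum>k=1..n. \<integral>x. max 0 (tail_avg h k x - tail_avg h (k - 1) x) \<partial>?P)"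
      using l le by (intro mult_left_mono sum_mono) auto
    also have "\<dots> \<le> (\<integral>x. h x * ln (h x) \<partial>?P) + real n * l\<^sup>2 / 8"
      by (rule sum_increments_le_entropy[OF h l])
    finally show "l * (\<Sum>i=1..n. \<integral>q. d i (fst q i) (snd q i) \<partial>\<gamma>)
       \<le> (\<integral>x. h x * ln (h x) \<partial>?P) + real n * l\<^sup>2 / 8" .
  qed
qed

end

subsection \<open>Gibbs measures and dual total correlation\<close>

lemma nat_product_prob_spaceI:
  assumes "\<And>i. prob_space (M i)" shows "nat_product_prob_space M n"
proof -
  have "product_prob_space M" using assms by (rule product_prob_spaceI)
  thus ?thesis
    by (auto simp: nat_product_prob_space_def finite_product_prob_space_def
        finite_product_sigma_finite_def finite_product_sigma_finite_axioms_def product_prob_space_def)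
qed

context finite_product_prob_space
begin

lemma bfun_inverse:
  assumes a: "bfun a" and c: "c > 0" "\<And>x. x \<in> space (PiM I M) \<Longrightarrow> c \<le> a x"
  shows "bfun (\<lambda>x. inverse (a x))"
proof (rule bfunI)
  show "(\<lambda>x. inverse (a x)) \<in> borel_measurable (PiM I M)" using a by measurable
  fix x assume "x \<in> space (PiM I M)"
  from c(2)[OF this] c(1) show "\<bar>inverse (a x)\<bar> \<le> inverse c" by simp
qed

lemma cavg_ge:
  assumes "i \<in> I" "bfun a" "x \<in> space (PiM I M)" "\<And>x. x \<in> space (PiM I M) \<Longrightarrow> c \<le> a x"
  shows "c \<le> cavg i a x"
  using cavg_mono[OF assms(1) bfun_const assms(2,3), of c] assms by (simp add: cavg_const)

lemma bfun_ge_exp: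
  assumes "bfun a"
  obtains c where "c > 0" "\<And>x. x \<in> space (PiM I M) \<Longrightarrow> c \<le> exp (a x)"
proof -
  obtain A where "\<And>x. x \<in> space (PiM I M) \<Longrightarrow> \<bar>a x\<bar> \<le> A" using bfun_bound[OF assms] by metis
  hence "\<And>x. x \<in> space (PiM I M) \<Longrightarrow> exp (- A) \<le> exp (a x)" by (force simp: abs_le_iff)
  thus ?thesis using that[of "exp (- A)"] by simp
qed

lemma integral_exp_pos:
  assumes "bfun a" shows "(\<integral>x. exp (a x) \<partial>PiM I M) > 0"
proof -
  obtain c where c: "c > 0" "\<And>x. x \<in> space (PiM I M) \<Longrightarrow> c \<le> exp (a x)"
    using bfun_ge_exp[OF assms] by metis
  have "(\<integral>x. c \<partial>PiM I M) \<le> (\<integral>x. exp (a x) \<partial>PiM I M)"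
    using assms c by (intro integral_mono bfun_integrable bfun_exp bfun_const)
  thus ?thesis using c(1) by (simp add: P.prob_space)
qed

end

context nat_product_prob_space
begin

text \<open>The chain rule writes \<open>ln \<rho>\<close> as a sum of \<open>ln (H k / H (k - 1))\<close>; conditioning the \<open>k\<close>-th term on
  all other coordinates instead of the earlier ones can only increase its mean, by \<open>ln t \<le> t - 1\<close>.\<close>

lemma dual_total_correlation_nonneg:
  assumes \<rho>: "bfun \<rho>" "c > 0" "\<And>x. x \<in> space (PiM {1..n} M) \<Longrightarrow> c \<le> \<rho> x"
    and int1: "(\<integral>x. \<rho> x \<partial>PiM {1..n} M) = 1"
  shows "(\<integral>x. \<rho> x * ln (\<rho> x) \<partial>PiM {1..n} M)
       \<le> (\<integral>x. \<rho> x * (\<Sum>k=1..n. ln (\<rho> x) - ln (cavg k \<rho> x)) \<partial>PiM {1..n} M)"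
proof -
  let ?P = "PiM {1..n} M"
  define H where "H = tail_avg \<rho>"
  have bH: "bfun (H k)" if "k \<le> n" for k unfolding H_def by (intro bfun_tail_avg \<rho> that)
  have Hc: "c \<le> H k x" if "k \<le> n" "x \<in> space ?P" for k x
    unfolding H_def using \<rho> that by (intro tail_avg_ge) auto
  have bC: "bfun (cavg k \<rho>)" if "k \<in> {1..n}" for k by (intro bfun_cavg \<rho> that)
  have Cc: "c \<le> cavg k \<rho> x" if "k \<in> {1..n}" "x \<in> space ?P" for k x
    using \<rho> that by (intro cavg_ge)
  have blH: "bfun (\<lambda>x. ln (H k x))" if "k \<le> n" for k
    by (rule bfun_ln[OF bH \<rho>(2)]) (use that Hc in auto)
  have blC: "bfun (\<lambda>x. ln (cavg k \<rho> x))" if "k \<in> {1..n}" for k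
    by (rule bfun_ln[OF bC \<rho>(2)]) (use that Cc in auto)
  have bl\<rho>: "bfun (\<lambda>x. ln (\<rho> x))" by (rule bfun_ln[OF \<rho>])
  \<comment> \<open>\<open>H n\<close> is \<open>\<rho>\<close>, and \<open>H 0\<close> is its
    integral 1, whose logarithm vanishes.\<close>
  have telescope: "(\<Sum>k=1..n. ln (H k x) - ln (H (k - 1) x)) = ln (\<rho> x)" if x: "x \<in> space ?P" for x
  proof -
    have "(\<Sum>k=1..m. ln (H k x) - ln (H (k - 1) x)) = ln (H m x) - ln (H 0 x)" for m
      by (induction m) auto
    thus ?thesis using tail_avg_0[OF \<rho>(1) x] int1 by (simp add: H_def)
  qed
  have step: "(\<integral>x. \<rho> x * (ln (H k x) - ln (H (k - 1) x)) \<partial>?P)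
      \<le> (\<integral>x. \<rho> x * (ln (\<rho> x) - ln (cavg k \<rho> x)) \<partial>?P)" if k: "k \<in> {1..n}" for k
  proof -
    have k': "k \<le> n" "k - 1 \<le> n" using k by auto
    \<comment> \<open>\<open>w * H k - \<rho>\<close> is the bound \<open>\<rho> * (t - 1)\<close>
      produced by \<open>ln t \<le> t - 1\<close>. As \<open>w\<close> is free of \<open>k\<close>,
      averaging over coordinate \<open>k\<close> turns \<open>H k\<close> into
      \<open>H (k - 1)\<close>, which cancels the denominator and leaves
      \<open>cavg k \<rho>\<close>, of integral 1.\<close>
    define w where "w = (\<lambda>x. cavg k \<rho> x * inverse (H (k - 1) x))"
    have bw: "bfun w"
      unfolding w_def using k' by (intro bfun_mult bC k bfun_inverse[OF bH \<rho>(2)] Hc)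
    have free: "free_of k w"
      unfolding w_def H_def using k
      by (intro free_of_comp2[of _ _ _ "\<lambda>a b. a * inverse b"] free_of_cavg_same free_of_tail_avg) auto
    have "(\<integral>x. \<rho> x * (ln (H k x) - ln (H (k - 1) x)) \<partial>?P) - (\<integral>x. \<rho> x * (ln (\<rho> x) - ln (cavg k \<rho> x)) \<partial>?P)
        = (\<integral>x. \<rho> x * (ln (H k x) - ln (H (k - 1) x)) - \<rho> x * (ln (\<rho> x) - ln (cavg k \<rho> x)) \<partial>?P)"
      using k' by (intro Bochner_Integration.integral_diff[symmetric] bfun_integrable bfun_mult bfun_diff blH blC bl\<rho> \<rho> k)
    also have "\<dots> \<le> (\<integral>x. w x * H k x - \<rho> x \<partial>?P)"
    proof (intro integral_mono bfun_integrable bfun_mult bfun_diff blH blC bl\<rho> \<rho>(1) k k' bw bH)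
      fix x assume x: "x \<in> space ?P"
      have pos: "\<rho> x > 0" "H k x > 0" "H (k - 1) x > 0" "cavg k \<rho> x > 0"
        using \<rho>(2) \<rho>(3)[OF x] Hc[OF k'(1) x] Hc[OF k'(2) x] Cc[OF k x] by linarith+
      let ?t = "H k x * cavg k \<rho> x / (H (k - 1) x * \<rho> x)"
      have "ln ?t \<le> ?t - 1" using pos by (intro ln_le_minus_one) simp
      also have "ln ?t = ln (H k x) - ln (H (k - 1) x) - (ln (\<rho> x) - ln (cavg k \<rho> x))"
        using pos by (simp add: ln_div ln_mult)
      finally have "\<rho> x * (ln (H k x) - ln (H (k - 1) x) - (ln (\<rho> x) - ln (cavg k \<rho> x))) \<le> \<rho> x * (?t - 1)"
        using pos by (intro mult_left_mono) auto
      also have "\<rho> x * (?t - 1) = w x * H k x - \<rho> x"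
        using pos by (simp add: w_def field_simps)
      finally show "\<rho> x * (ln (H k x) - ln (H (k - 1) x)) - \<rho> x * (ln (\<rho> x) - ln (cavg k \<rho> x))
          \<le> w x * H k x - \<rho> x" by (simp add: right_diff_distrib)
    qed
    also have "\<dots> = (\<integral>x. w x * H k x \<partial>?P) - 1"
      using int1 by (subst Bochner_Integration.integral_diff)
        (auto intro!: bfun_integrable bfun_mult bw bH \<rho> k')
    also have "(\<integral>x. w x * H k x \<partial>?P) = (\<integral>x. cavg k (\<lambda>x. w x * H k x) x \<partial>?P)"
      using k' by (intro integral_cavg[symmetric] k bfun_mult bw bH)
    also have "\<dots> = (\<integral>x. cavg k \<rho> x \<partial>?P)"
    proof (intro Bochner_Integration.integral_cong refl)
      fix x assume x: "x \<in> space ?P"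
      have "H (k - 1) x > 0" using \<rho>(2) Hc[OF k'(2) x] by linarith
      thus "cavg k (\<lambda>x. w x * H k x) x = cavg k \<rho> x"
        using tail_avg_pred[OF k, of \<rho>]
        by (simp add: cavg_mult_free[OF k free x]) (simp add: w_def H_def)
    qed
    also have "\<dots> = 1" using integral_cavg[OF k \<rho>(1)] int1 by simp
    finally show ?thesis by simp
  qed
  have "(\<integral>x. \<rho> x * ln (\<rho> x) \<partial>?P) = (\<integral>x. (\<Sum>k=1..n. \<rho> x * (ln (H k x) - ln (H (k - 1) x))) \<partial>?P)"
    by (intro Bochner_Integration.integral_cong refl) (simp add: telescope flip: sum_distrib_left)
  also have "\<dots> = (\<Sum>k=1..n. \<integral>x. \<rho> x * (ln (H k x) - ln (H (k - 1) x)) \<partial>?P)"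
    by (intro Bochner_Integration.integral_sum bfun_integrable bfun_mult bfun_diff blH \<rho>) auto
  also have "\<dots> \<le> (\<Sum>k=1..n. \<integral>x. \<rho> x * (ln (\<rho> x) - ln (cavg k \<rho> x)) \<partial>?P)"
    by (intro sum_mono step)
  also have "\<dots> = (\<integral>x. (\<Sum>k=1..n. \<rho> x * (ln (\<rho> x) - ln (cavg k \<rho> x))) \<partial>?P)"
    by (intro Bochner_Integration.integral_sum[symmetric] bfun_integrable bfun_mult bfun_diff bl\<rho> blC \<rho>)
  finally show ?thesis by (simp add: sum_distrib_left)
qed

end

section \<open>Gibbs measures and their one-coordinate normalisers\<close>

locale gibbs_space = nat_product_prob_space lam n
  for lam :: "nat \<Rightarrow> 'b measure" and n :: nat +
  fixes b :: "nat \<Rightarrow> 'b" and f :: "(nat \<Rightarrow> 'b) \<Rightarrow> real"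
  assumes b: "\<And>i. i \<in> {1..n} \<Longrightarrow> b i \<in> space (lam i)"
    and f: "bfun f"
begin

abbreviation "\<Lambda> \<equiv> PiM {1..n} lam"

definition Z :: "((nat \<Rightarrow> 'b) \<Rightarrow> real) \<Rightarrow> real" where
  "Z \<phi> = (\<integral>x. exp (\<phi> x) \<partial>\<Lambda>)"

lemma Z_pos: "bfun \<phi> \<Longrightarrow> Z \<phi> > 0"
  unfolding Z_def by (rule integral_exp_pos)

lemma gibbs_eq: "gibbs n lam \<phi> = density \<Lambda> (\<lambda>x. ennreal (exp (\<phi> x) / Z \<phi>))"
  by (simp add: gibbs_def Z_def)

lemma sets_gibbs [simp]: "sets (gibbs n lam \<phi>) = sets \<Lambda>"
  and space_gibbs [simp]: "space (gibbs n lam \<phi>) = space \<Lambda>"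
  by (simp_all add: gibbs_def)

lemma integral_gibbs:
  assumes "bfun \<phi>" "h \<in> borel_measurable \<Lambda>"
  shows "(\<integral>x. h x \<partial>gibbs n lam \<phi>) = (\<integral>x. exp (\<phi> x) / Z \<phi> * h x \<partial>\<Lambda>)"
proof -
  note bfun_measurable[OF assms(1), measurable]
  show ?thesis
    unfolding gibbs_eq using assms Z_pos[OF assms(1)] by (subst integral_real_density) auto
qed

lemma prob_space_gibbs: assumes "bfun \<phi>" shows "prob_space (gibbs n lam \<phi>)"
proof
  have pos: "Z \<phi> > 0" by (rule Z_pos[OF assms])
  note bfun_measurable[OF assms, measurable]
  have "emeasure (gibbs n lam \<phi>) (space (gibbs n lam \<phi>)) = (\<integral>\<^sup>+x. ennreal (exp (\<phi> x) / Z \<phi>) \<partial>\<Lambda>)"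
    unfolding gibbs_eq by (subst emeasure_density) (auto intro!: nn_integral_cong)
  also have "\<dots> = ennreal (\<integral>x. exp (\<phi> x) / Z \<phi> \<partial>\<Lambda>)"
    using pos by (intro nn_integral_eq_integral integrable_divide bfun_integrable bfun_exp assms) auto
  also have "(\<integral>x. exp (\<phi> x) / Z \<phi> \<partial>\<Lambda>) = 1"
    using pos by (simp add: Z_def)
  finally show "emeasure (gibbs n lam \<phi>) (space (gibbs n lam \<phi>)) = 1" by simp
qed

lemma measure_gibbs:
  assumes "bfun \<phi>" "A \<in> sets \<Lambda>"
  shows "measure (gibbs n lam \<phi>) A = (\<integral>x. exp (\<phi> x) / Z \<phi> * indicator A x \<partial>\<Lambda>)"
  using integral_gibbs[OF assms(1), of "indicator A"] assms(2) by simp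

text \<open>Both arguments move along measurable maps, so that the gradient in its first variable,
  in its second, and on the diagonal are all instances.\<close>

lemma bfun_pdiff:
  assumes i: "i \<in> {1..n}"
    and p: "(\<lambda>x. p x) \<in> \<Lambda> \<rightarrow>\<^sub>M \<Lambda>" "q \<in> \<Lambda> \<rightarrow>\<^sub>M lam i"
  shows "bfun (\<lambda>x. pdiff b f i (p x) (q x))"
proof -
  obtain B where B: "\<And>x. x \<in> space \<Lambda> \<Longrightarrow> \<bar>f x\<bar> \<le> B" using bfun_bound[OF f] by metis
  have "bfun (\<lambda>x. f ((p x)(i := r x)))" if r: "r \<in> \<Lambda> \<rightarrow>\<^sub>M lam i" for r
  proof (rule bfunI)
    note bfun_measurable[OF f, measurable] i[measurable] p[measurable] r[measurable]
    show "(\<lambda>x. f ((p x)(i := r x))) \<in> borel_measurable \<Lambda>" by measurable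
    show "\<bar>f ((p x)(i := r x))\<bar> \<le> B" if "x \<in> space \<Lambda>" for x
      using measurable_space[OF p(1) that] measurable_space[OF r that] i
      by (intro B update_in_space)
  qed
  from this[OF p(2)] this[of "\<lambda>_. b i"] show ?thesis
    unfolding pdiff_def using b[OF i] by (intro bfun_diff) auto
qed

lemma bfun_grad:
  assumes "p \<in> \<Lambda> \<rightarrow>\<^sub>M \<Lambda>" "q \<in> \<Lambda> \<rightarrow>\<^sub>M \<Lambda>"
  shows "bfun (\<lambda>x. grad n b f (p x) (q x))"
  unfolding grad_def using assms
  by (intro bfun_sum bfun_pdiff measurable_compose[OF assms(2) measurable_component_singleton]) auto

lemma bfun_grad_fst: "z \<in> space \<Lambda> \<Longrightarrow> bfun (\<lambda>x. grad n b f x z)"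
  by (rule bfun_grad[of "\<lambda>x. x" "\<lambda>_. z"]) auto

lemma bfun_grad_snd: "x \<in> space \<Lambda> \<Longrightarrow> bfun (grad n b f x)"
  by (rule bfun_grad[of "\<lambda>_. x" "\<lambda>z. z"]) auto

lemma bfun_grad_diag: "bfun (\<lambda>x. grad n b f x x)"
  by (rule bfun_grad) auto

lemma pdiff_integrable_exp:
  assumes i: "i \<in> {1..n}" and x: "x \<in> space \<Lambda>"
  shows "integrable (lam i) (\<lambda>u. exp (pdiff b f i x u))"
proof -
  have "integrable (lam i) (\<lambda>u. exp (f (x(i := u))) * exp (- f (x(i := b i))))"
    using bfun_integrable_update[OF i bfun_exp[OF f] x] by simp
  thus ?thesis by (simp add: pdiff_def exp_diff exp_minus divide_inverse)
qed

text \<open>Normaliser of the \<open>i\<close>-th factor of the product measure at \<open>x\<close>.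
  Since \<open>pdiff b f i x u\<close> differs from \<open>f (x(i := u))\<close> by a term free of
  \<open>u\<close>, that factor is also the conditional law of coordinate \<open>i\<close> under the
  Gibbs measure of \<open>f\<close>, given the other coordinates of \<open>x\<close>.\<close>

definition cond_Z :: "nat \<Rightarrow> (nat \<Rightarrow> 'b) \<Rightarrow> real" where
  "cond_Z i x = (\<integral>u. exp (pdiff b f i x u) \<partial>lam i)"

lemma cond_Z_eq: "cond_Z i x = cavg i (\<lambda>x. exp (f x)) x / exp (f (x(i := b i)))"
  by (simp add: cond_Z_def pdiff_def exp_diff cavg_def)

lemma cavg_exp_ge:
  obtains c where "c > 0" "\<And>i x. i \<in> {1..n} \<Longrightarrow> x \<in> space \<Lambda> \<Longrightarrow> c \<le> cavg i (\<lambda>x. exp (f x)) x"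
proof -
  obtain c where c: "c > 0" "\<And>x. x \<in> space \<Lambda> \<Longrightarrow> c \<le> exp (f x)" using bfun_ge_exp[OF f] by metis
  show ?thesis
  proof (rule that[OF c(1)])
    fix i x assume "i \<in> {1..n}" "x \<in> space \<Lambda>"
    thus "c \<le> cavg i (\<lambda>x. exp (f x)) x" by (rule cavg_ge[OF _ bfun_exp[OF f] _ c(2)])
  qed
qed

lemma cond_Z_pos: assumes "i \<in> {1..n}" "x \<in> space \<Lambda>" shows "cond_Z i x > 0"
proof -
  obtain c where "c > 0" "\<And>i x. i \<in> {1..n} \<Longrightarrow> x \<in> space \<Lambda> \<Longrightarrow> c \<le> cavg i (\<lambda>x. exp (f x)) x"
    using cavg_exp_ge by blast
  from less_le_trans[OF this(1) this(2)[OF assms]] have "cavg i (\<lambda>x. exp (f x)) x > 0" .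
  thus ?thesis by (simp add: cond_Z_eq)
qed

lemma ln_cond_Z:
  assumes "i \<in> {1..n}" "x \<in> space \<Lambda>"
  shows "ln (cond_Z i x) = ln (cavg i (\<lambda>x. exp (f x)) x) - f (x(i := b i))"
proof -
  have "cavg i (\<lambda>x. exp (f x)) x = cond_Z i x * exp (f (x(i := b i)))" by (simp add: cond_Z_eq)
  thus ?thesis using cond_Z_pos[OF assms] by (simp add: ln_mult)
qed

text \<open>The logarithm of the normaliser of \<open>grad n b f x\<close>, by
  \<open>ln_Z_grad\<close>. Written as a sum over coordinates, it inherits measurability and bounds
  in \<open>x\<close> from \<open>cavg\<close>.\<close>

definition log_z :: "(nat \<Rightarrow> 'b) \<Rightarrow> real" where
  "log_z x = (\<Sum>i=1..n. ln (cond_Z i x))"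

lemma bfun_log_z: "bfun log_z"
proof -
  obtain c where c: "c > 0" "\<And>i x. i \<in> {1..n} \<Longrightarrow> x \<in> space \<Lambda> \<Longrightarrow> c \<le> cavg i (\<lambda>x. exp (f x)) x"
    using cavg_exp_ge by blast
  have "bfun (\<lambda>x. ln (cond_Z i x))" if i: "i \<in> {1..n}" for i
  proof -
    obtain B where B: "\<And>x. x \<in> space \<Lambda> \<Longrightarrow> \<bar>f x\<bar> \<le> B" using bfun_bound[OF f] by metis
    note bfun_measurable[OF f, measurable] i[measurable] b[OF i, simp]
    have "bfun (\<lambda>x. f (x(i := b i)))"
      by (rule bfunI[of _ B]) (auto intro!: B update_in_space i)
    moreover have "bfun (\<lambda>x. ln (cavg i (\<lambda>x. exp (f x)) x))"
      using i c by (intro bfun_ln[of _ c] bfun_cavg bfun_exp f)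
    ultimately have bd: "bfun (\<lambda>x. ln (cavg i (\<lambda>x. exp (f x)) x) - f (x(i := b i)))"
      by (rule bfun_diff[rotated])
    obtain D where "\<And>x. x \<in> space \<Lambda> \<Longrightarrow> \<bar>ln (cavg i (\<lambda>x. exp (f x)) x) - f (x(i := b i))\<bar> \<le> D"
      using bfun_bound[OF bd] by metis
    moreover have "(\<lambda>x. ln (cond_Z i x)) \<in> borel_measurable \<Lambda>"
      using bfun_measurable[OF bd] by (simp add: ln_cond_Z[OF i] cong: measurable_cong)
    ultimately show ?thesis by (intro bfunI[of _ D]) (simp_all add: ln_cond_Z[OF i])
  qed
  thus ?thesis unfolding log_z_def[abs_def] by (intro bfun_sum) auto
qed

text \<open>With \<open>\<rho>\<close> the Gibbs density, \<open>\<rho> / cavg k \<rho>\<close> is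
  the conditional density of coordinate \<open>k\<close> given the others. Its logarithm is
  \<open>pdiff b f k x (x k) - ln (cond_Z k x)\<close>, because the reference term and
  \<open>Z f\<close> cancel; summed over \<open>k\<close> this is
  \<open>grad n b f x x - log_z x\<close>.\<close>

lemma gibbs_dual_total_correlation:
  "(\<integral>x. exp (f x) / Z f * (log_z x + (f x - ln (Z f) - grad n b f x x)) \<partial>\<Lambda>) \<le> 0"
proof -
  let ?\<rho> = "\<lambda>x. exp (f x) / Z f"
  have Zp: "Z f > 0" by (rule Z_pos[OF f])
  have b\<rho>: "bfun ?\<rho>"
    using bfun_mult[OF bfun_exp[OF f] bfun_const[of "1 / Z f"]] by simp
  obtain c where c: "c > 0" "\<And>x. x \<in> space \<Lambda> \<Longrightarrow> c \<le> exp (f x)" using bfun_ge_exp[OF f] by metis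
  have ln\<rho>: "ln (?\<rho> x) = f x - ln (Z f)" for x using Zp by (simp add: ln_div)
  have sum: "(\<Sum>k=1..n. ln (?\<rho> x) - ln (cavg k ?\<rho> x)) = grad n b f x x - log_z x"
    if x: "x \<in> space \<Lambda>" for x
    unfolding grad_def log_z_def sum_subtractf[symmetric]
  proof (intro sum.cong refl)
    fix k assume k: "k \<in> {1..n}"
    have "cavg k ?\<rho> x = cond_Z k x * exp (f (x(k := b k))) / Z f"
      by (simp add: cavg_def cond_Z_def pdiff_def exp_diff)
    hence "ln (cavg k ?\<rho> x) = ln (cond_Z k x) + f (x(k := b k)) - ln (Z f)"
      using Zp cond_Z_pos[OF k x] by (simp add: ln_div ln_mult)
    thus "ln (?\<rho> x) - ln (cavg k ?\<rho> x) = pdiff b f k x (x k) - ln (cond_Z k x)"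
      unfolding ln\<rho> pdiff_def by simp
  qed
  have "(\<integral>x. ?\<rho> x * (f x - ln (Z f)) \<partial>\<Lambda>) \<le> (\<integral>x. ?\<rho> x * (\<Sum>k=1..n. ln (?\<rho> x) - ln (cavg k ?\<rho> x)) \<partial>\<Lambda>)"
    unfolding ln\<rho>[symmetric]
  proof (rule dual_total_correlation_nonneg[OF b\<rho>])
    show "0 < c / Z f" using c Zp by simp
    show "c / Z f \<le> exp (f x) / Z f" if "x \<in> space \<Lambda>" for x
      using c(2)[OF that] Zp by (simp add: divide_right_mono)
    show "(\<integral>x. exp (f x) / Z f \<partial>\<Lambda>) = 1" using Zp by (simp add: Z_def)
  qed
  also have "\<dots> = (\<integral>x. ?\<rho> x * (grad n b f x x - log_z x) \<partial>\<Lambda>)"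
    by (intro Bochner_Integration.integral_cong refl) (simp only: sum)
  finally have "(\<integral>x. ?\<rho> x * (f x - ln (Z f)) \<partial>\<Lambda>) - (\<integral>x. ?\<rho> x * (grad n b f x x - log_z x) \<partial>\<Lambda>) \<le> 0"
    by simp
  also have "(\<integral>x. ?\<rho> x * (f x - ln (Z f)) \<partial>\<Lambda>) - (\<integral>x. ?\<rho> x * (grad n b f x x - log_z x) \<partial>\<Lambda>)
      = (\<integral>x. ?\<rho> x * (f x - ln (Z f)) - ?\<rho> x * (grad n b f x x - log_z x) \<partial>\<Lambda>)"
    by (intro Bochner_Integration.integral_diff[symmetric] bfun_integrable bfun_mult[OF b\<rho>]
        bfun_diff bfun_const f bfun_grad_diag bfun_log_z)
  also have "\<dots> = (\<integral>x. ?\<rho> x * (log_z x + (f x - ln (Z f) - grad n b f x x)) \<partial>\<Lambda>)"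
    unfolding right_diff_distrib[symmetric]
    by (intro Bochner_Integration.integral_cong refl arg_cong2[where f = "(*)"]) simp
  finally show ?thesis .
qed

end

subsection \<open>Measurability on separable metric spaces\<close>

lemma space_borel_of: "space (borel_of X) = topspace X"
  by (simp add: borel_of_def space_measure_of_conv)

lemma sets_borel_of: "sets (borel_of X) = sigma_sets (topspace X) {U. openin X U}"
  unfolding borel_of_def by (rule sets_measure_of) (auto dest: openin_subset)

lemma openin_in_borel_of: "openin X U \<Longrightarrow> U \<in> sets (borel_of X)"
  by (auto simp: sets_borel_of)

lemma separable_dense_sequence:
  assumes "separable_space (mtopology_of m)"
  obtains D where "countable D" "D \<subseteq> mspace m"
    "\<And>x e. x \<in> mspace m \<Longrightarrow> e > 0 \<Longrightarrow> \<exists>q\<in>D. mdist m x q < e"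
proof -
  interpret Metric_space "mspace m" "mdist m" by (rule Metric_space_mspace_mdist)
  obtain D where D: "countable D" "D \<subseteq> topspace (mtopology_of m)"
      "mtopology_of m closure_of D = topspace (mtopology_of m)"
    using assms unfolding separable_space_def by blast
  show ?thesis
  proof (rule that[OF D(1)])
    show "D \<subseteq> mspace m" using D(2) by simp
    fix x e assume x: "x \<in> mspace m" and e: "e > (0::real)"
    hence "x \<in> mtopology closure_of D" using D(3) by (simp add: mtopology_of_def)
    thus "\<exists>q\<in>D. mdist m x q < e" using e by (auto simp: metric_closure_of in_mball)
  qed
qed

lemma separable_countable_base:
  assumes "separable_space (mtopology_of m)"
  obtains \<B> where "countable \<B>" "\<And>V. V \<in> \<B> \<Longrightarrow> openin (mtopology_of m) V"
    "\<And>U x. openin (mtopology_of m) U \<Longrightarrow> x \<in> U \<Longrightarrow> \<exists>V\<in>\<B>. x \<in> V \<and> V \<subseteq> U"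
proof -
  interpret Metric_space "mspace m" "mdist m" by (rule Metric_space_mspace_mdist)
  obtain D where D: "countable D" "D \<subseteq> mspace m"
      "\<And>x e. x \<in> mspace m \<Longrightarrow> e > 0 \<Longrightarrow> \<exists>q\<in>D. mdist m x q < e"
    using separable_dense_sequence[OF assms] by metis
  let ?\<B> = "(\<lambda>(q, k). mball q (1 / real (Suc k))) ` (D \<times> UNIV)"
  show ?thesis
  proof (rule that[of ?\<B>])
    show "countable ?\<B>" using D(1) by auto
    show "openin (mtopology_of m) V" if "V \<in> ?\<B>" for V
      using that by (auto simp: mtopology_of_def)
    fix U x assume U: "openin (mtopology_of m) U" and x: "x \<in> U"
    obtain r where r: "r > 0" "mball x r \<subseteq> U"
      using U x by (auto simp: mtopology_of_def openin_mtopology)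
    have xm: "x \<in> mspace m" using openin_subset[OF U] x by auto
    obtain k where k: "1 / real (Suc k) < r / 2"
      using r(1) nat_approx_posE[of "r / 2"] by auto
    obtain q where q: "q \<in> D" "mdist m x q < 1 / real (Suc k)"
      using D(3)[OF xm, of "1 / real (Suc k)"] by auto
    have qm: "q \<in> mspace m" using q D by auto
    have "x \<in> mball q (1 / real (Suc k))"
      using q(2) qm xm by (simp add: in_mball commute)
    moreover have "mball q (1 / real (Suc k)) \<subseteq> mball x r"
    proof
      fix w assume "w \<in> mball q (1 / real (Suc k))"
      hence w: "w \<in> mspace m" "mdist m q w < 1 / real (Suc k)" by (auto simp: in_mball)
      have "mdist m x w \<le> mdist m x q + mdist m q w" by (rule triangle[OF xm qm w(1)])
      thus "w \<in> mball x r" using q(2) w k xm by (auto simp: in_mball)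
    qed
    ultimately show "\<exists>V\<in>?\<B>. x \<in> V \<and> V \<subseteq> U" using q(1) r(2) by blast
  qed
qed

text \<open>Only countably many boxes have all their sides in countable bases, and an open set is
  the union of those inside it. Hence continuous functions and Borel parts are measurable for the
  product sigma-algebra.\<close>

lemma openin_product_in_PiM:
  assumes fin: "finite I"
    and sep: "\<And>i. i \<in> I \<Longrightarrow> separable_space (mtopology_of (K i))"
    and sets: "\<And>i. i \<in> I \<Longrightarrow> sets (N i) = sets (borel_of (mtopology_of (K i)))"
    and U: "openin (product_topology (\<lambda>i. mtopology_of (K i)) I) U"
  shows "U \<in> sets (PiM I N)"
proof -
  have "\<exists>\<B>. countable \<B> \<and> (\<forall>V\<in>\<B>. openin (mtopology_of (K i)) V) \<and>
      (\<forall>U x. openin (mtopology_of (K i)) U \<longrightarrow> x \<in> U \<longrightarrow> (\<exists>V\<in>\<B>. x \<in> V \<and> V \<subseteq> U))" if "i \<in> I" for i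
    using separable_countable_base[OF sep[OF that]] by metis
  then obtain \<B> where \<B>: "\<And>i. i \<in> I \<Longrightarrow> countable (\<B> i)"
      "\<And>i V. i \<in> I \<Longrightarrow> V \<in> \<B> i \<Longrightarrow> openin (mtopology_of (K i)) V"
      "\<And>i U x. i \<in> I \<Longrightarrow> openin (mtopology_of (K i)) U \<Longrightarrow> x \<in> U \<Longrightarrow> \<exists>V\<in>\<B> i. x \<in> V \<and> V \<subseteq> U"
    by metis
  define \<R> where "\<R> = {R \<in> Pi\<^sub>E I ` Pi\<^sub>E I \<B>. R \<subseteq> U}"
  have "countable \<R>"
    unfolding \<R>_def using \<B>(1) fin by (auto intro!: countable_PiE countable_image countable_subset[of _ "Pi\<^sub>E I ` Pi\<^sub>E I \<B>"])
  moreover have "R \<in> sets (PiM I N)" if R: "R \<in> \<R>" for R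
  proof -
    obtain V where V: "V \<in> Pi\<^sub>E I \<B>" "R = Pi\<^sub>E I V" using R unfolding \<R>_def by blast
    have "V i \<in> sets (N i)" if "i \<in> I" for i
      using V that \<B>(2)[OF that, of "V i"] sets[OF that] by (auto intro: openin_in_borel_of)
    thus ?thesis unfolding V(2) by (intro sets_PiM_I_finite fin)
  qed
  moreover have "U = \<Union>\<R>"
  proof (intro equalityI subsetI)
    fix x assume x: "x \<in> U"
    from U[unfolded openin_product_topology_alt, rule_format, OF x]
    obtain W where W: "\<And>i. i \<in> I \<Longrightarrow> openin (mtopology_of (K i)) (W i)" "x \<in> Pi\<^sub>E I W" "Pi\<^sub>E I W \<subseteq> U"
      by auto
    have "\<exists>V\<in>\<B> i. x i \<in> V \<and> V \<subseteq> W i" if "i \<in> I" for i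
      using W that by (intro \<B>(3)) auto
    then obtain V where V: "\<And>i. i \<in> I \<Longrightarrow> V i \<in> \<B> i \<and> x i \<in> V i \<and> V i \<subseteq> W i" by metis
    \<comment> \<open>Restriction makes the chosen sides an extensional function, hence a member of
      the countable set \<open>Pi\<^sub>E I \<B>\<close>.\<close>
    have "Pi\<^sub>E I (restrict V I) \<subseteq> Pi\<^sub>E I W" using V by (intro PiE_mono) auto
    hence "Pi\<^sub>E I (restrict V I) \<subseteq> U" using W(3) by (rule subset_trans)
    moreover have "x \<in> Pi\<^sub>E I (restrict V I)" using V W(2) by (auto simp: PiE_iff)
    moreover have "restrict V I \<in> Pi\<^sub>E I \<B>" using V by auto
    ultimately show "x \<in> \<Union>\<R>"
      unfolding \<R>_def by (intro UnionI[of "Pi\<^sub>E I (restrict V I)"] CollectI conjI imageI)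
  qed (auto simp: \<R>_def)
  ultimately show ?thesis by (auto intro: sets.countable_Union)
qed

text \<open>The distance of \<open>u\<close> and \<open>v\<close> is below \<open>r\<close> exactly
  when some \<open>q\<close> in a countable dense set has distances to \<open>u\<close> and
  \<open>v\<close> of sum below \<open>r\<close>. Sublevel sets are thus countable unions of sets
  measurable for the product sigma-algebra.\<close>

lemma measurable_mdist:
  assumes sep: "separable_space (mtopology_of m)"
    and sets: "sets N = sets (borel_of (mtopology_of m))"
  shows "(\<lambda>(u, v). mdist m u v) \<in> borel_measurable (N \<Otimes>\<^sub>M N)"
proof -
  interpret Metric_space "mspace m" "mdist m" by (rule Metric_space_mspace_mdist)
  have space: "space N = mspace m"
    using sets_eq_imp_space_eq[OF sets] by (simp add: space_borel_of)
  obtain D where D: "countable D" "D \<subseteq> mspace m"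
      "\<And>x e. x \<in> mspace m \<Longrightarrow> e > 0 \<Longrightarrow> \<exists>q\<in>D. mdist m x q < e"
    using separable_dense_sequence[OF sep] by metis
  have meas: "(\<lambda>u. mdist m u q) \<in> borel_measurable N" if "q \<in> D" for q
  proof (rule borel_measurableI_less)
    fix r
    have "{u \<in> space N. mdist m u q < r} = mball q r"
      using that D(2) by (auto simp: space in_mball commute)
    thus "{u \<in> space N. mdist m u q < r} \<in> sets N"
      by (simp add: sets openin_in_borel_of mtopology_of_def)
  qed
  show ?thesis
  proof (rule borel_measurableI_less)
    fix r :: real
    have "{p \<in> space (N \<Otimes>\<^sub>M N). (case p of (u, v) \<Rightarrow> mdist m u v) < r}
        = (\<Union>q\<in>D. {p \<in> space (N \<Otimes>\<^sub>M N). mdist m (fst p) q + mdist m (snd p) q < r})"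
    proof (intro equalityI subsetI)
      fix p assume p: "p \<in> {p \<in> space (N \<Otimes>\<^sub>M N). (case p of (u, v) \<Rightarrow> mdist m u v) < r}"
      obtain u v where uv: "p = (u, v)" "u \<in> mspace m" "v \<in> mspace m" "mdist m u v < r"
        using p by (auto simp: space_pair_measure space)
      obtain q where q: "q \<in> D" "mdist m u q < (r - mdist m u v) / 2"
        using D(3)[OF uv(2), of "(r - mdist m u v) / 2"] uv(4) by auto
      have "mdist m v q \<le> mdist m v u + mdist m u q"
        using q(1) D(2) uv by (intro triangle) auto
      hence "mdist m u q + mdist m v q < r"
        using q(2) commute[of u v] by (simp add: field_simps)
      thus "p \<in> (\<Union>q\<in>D. {p \<in> space (N \<Otimes>\<^sub>M N). mdist m (fst p) q + mdist m (snd p) q < r})"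
        using q(1) uv p by auto
    next
      fix p assume "p \<in> (\<Union>q\<in>D. {p \<in> space (N \<Otimes>\<^sub>M N). mdist m (fst p) q + mdist m (snd p) q < r})"
      then obtain q u v where q: "q \<in> D" "p = (u, v)" "p \<in> space (N \<Otimes>\<^sub>M N)" "mdist m u q + mdist m v q < r"
        by (cases p) auto
      have "mdist m u v \<le> mdist m u q + mdist m q v"
        using q D(2) by (intro triangle) (auto simp: space_pair_measure space)
      thus "p \<in> {p \<in> space (N \<Otimes>\<^sub>M N). (case p of (u, v) \<Rightarrow> mdist m u v) < r}"
        using q commute[of q v] by auto
    qed
    also have "\<dots> \<in> sets (N \<Otimes>\<^sub>M N)"
    proof (intro sets.countable_UN'[OF D(1)] image_subsetI)
      fix q assume "q \<in> D"
      note [measurable] = meas[OF this]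
      show "{p \<in> space (N \<Otimes>\<^sub>M N). mdist m (fst p) q + mdist m (snd p) q < r} \<in> sets (N \<Otimes>\<^sub>M N)"
        by measurable
    qed
    finally show "{p \<in> space (N \<Otimes>\<^sub>M N). (case p of (u, v) \<Rightarrow> mdist m u v) < r} \<in> sets (N \<Otimes>\<^sub>M N)" .
  qed
qed

subsection \<open>Tilted product measures\<close>

context gibbs_space
begin

lemma nn_integral_exp_pdiff:
  assumes i: "i \<in> {1..n}" and w: "w \<in> space \<Lambda>"
  shows "(\<integral>\<^sup>+u. ennreal (exp (pdiff b f i w u)) \<partial>lam i) = ennreal (cond_Z i w)"
  unfolding cond_Z_def by (intro nn_integral_eq_integral pdiff_integrable_exp assms) auto

lemma measurable_pdiff:
  assumes i: "i \<in> {1..n}" and w: "w \<in> space \<Lambda>"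
  shows "pdiff b f i w \<in> borel_measurable (lam i)"
proof -
  have "(\<lambda>u. ln (exp (pdiff b f i w u))) \<in> borel_measurable (lam i)"
    by (intro borel_measurable_ln borel_measurable_integrable pdiff_integrable_exp assms)
  thus ?thesis by simp
qed

lemma Z_grad:
  assumes w: "w \<in> space \<Lambda>"
  shows "Z (grad n b f w) = (\<Prod>i=1..n. cond_Z i w)"
proof -
  have "ennreal (Z (grad n b f w)) = (\<integral>\<^sup>+x. ennreal (exp (grad n b f w x)) \<partial>\<Lambda>)"
    unfolding Z_def by (intro nn_integral_eq_integral[symmetric] bfun_integrable bfun_exp bfun_grad_snd w) auto
  also have "\<dots> = (\<integral>\<^sup>+x. (\<Prod>i=1..n. ennreal (exp (pdiff b f i w (x i)))) \<partial>\<Lambda>)"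
    by (simp add: grad_def exp_sum prod_ennreal)
  also have "\<dots> = (\<Prod>i=1..n. \<integral>\<^sup>+u. ennreal (exp (pdiff b f i w u)) \<partial>lam i)"
    by (intro product_nn_integral_prod measurable_compose[OF _ measurable_ennreal]
        measurable_compose[OF _ borel_measurable_exp] measurable_pdiff w) auto
  also have "\<dots> = (\<Prod>i=1..n. ennreal (cond_Z i w))"
    by (intro prod.cong refl nn_integral_exp_pdiff w)
  also have "\<dots> = ennreal (\<Prod>i=1..n. cond_Z i w)"
    using cond_Z_pos[OF _ w] by (intro prod_ennreal) (auto intro: less_imp_le)
  finally show ?thesis
    using Z_pos[OF bfun_grad_snd[OF w]] cond_Z_pos[OF _ w]
    by (subst (asm) ennreal_inj) (auto intro!: prod_nonneg intro: less_imp_le)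
qed

lemma ln_Z_grad:
  assumes w: "w \<in> space \<Lambda>" shows "ln (Z (grad n b f w)) = log_z w"
proof -
  have "cond_Z i w > 0" if "i \<in> {1..n}" for i by (rule cond_Z_pos[OF that w])
  hence "cond_Z i w \<noteq> 0" if "i \<in> {1..n}" for i using that by fastforce
  thus ?thesis unfolding log_z_def Z_grad[OF w] by (intro ln_prod) auto
qed

text \<open>The factors of the product measure at \<open>w\<close>. Off \<open>{1..n}\<close> the
  value only has to be a probability measure, as the product locale asks for one at every
  index.\<close>

definition tilt :: "(nat \<Rightarrow> 'b) \<Rightarrow> nat \<Rightarrow> 'b measure" where
  "tilt w i = (if i \<in> {1..n} then density (lam i) (\<lambda>u. ennreal (exp (pdiff b f i w u) / cond_Z i w)) else lam i)"

lemma sets_tilt [simp]: "sets (tilt w i) = sets (lam i)"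
  and space_tilt [simp]: "space (tilt w i) = space (lam i)"
  by (auto simp: tilt_def)

lemma emeasure_tilt:
  assumes i: "i \<in> {1..n}" and w: "w \<in> space \<Lambda>" and A: "A \<in> sets (lam i)"
  shows "emeasure (tilt w i) A = (\<integral>\<^sup>+u. ennreal (exp (pdiff b f i w u)) * indicator A u \<partial>lam i) / ennreal (cond_Z i w)"
proof -
  note [measurable] = measurable_pdiff[OF i w] A
  have "emeasure (tilt w i) A = (\<integral>\<^sup>+u. ennreal (exp (pdiff b f i w u)) * indicator A u / ennreal (cond_Z i w) \<partial>lam i)"
    using i cond_Z_pos[OF i w]
    by (auto simp: tilt_def emeasure_density divide_ennreal[symmetric] ennreal_times_divide mult.commute
        intro!: nn_integral_cong)
  thus ?thesis by (simp add: nn_integral_divide)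
qed

lemma prob_space_tilt:
  assumes w: "w \<in> space \<Lambda>" shows "prob_space (tilt w i)"
proof (cases "i \<in> {1..n}")
  case True
  have "(\<integral>\<^sup>+u. ennreal (exp (pdiff b f i w u)) * indicator (space (lam i)) u \<partial>lam i) = ennreal (cond_Z i w)"
    unfolding nn_integral_exp_pdiff[OF True w, symmetric] by (intro nn_integral_cong) auto
  thus ?thesis
    using cond_Z_pos[OF True w] by (intro prob_spaceI) (simp add: emeasure_tilt[OF True w] ennreal_divide_self)
next
  case False
  have "prob_space (lam i)" by (rule M.prob_space_axioms)
  thus ?thesis using False by (simp only: tilt_def if_False)
qed

lemma tilt_product:
  assumes w: "w \<in> space \<Lambda>" shows "nat_product_prob_space (tilt w) n"
  by (rule nat_product_prob_spaceI[OF prob_space_tilt[OF w]])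

text \<open>On a box the density, its normaliser and the indicator all factor over the coordinates.
  This makes the coupling theorem for product measures applicable with the tilted measure as
  reference.\<close>

lemma gibbs_grad_eq_PiM:
  assumes w: "w \<in> space \<Lambda>"
  shows "gibbs n lam (grad n b f w) = PiM {1..n} (tilt w)"
proof -
  interpret T: nat_product_prob_space "tilt w" n by (rule tilt_product[OF w])
  have zp: "cond_Z i w > 0" if "i \<in> {1..n}" for i by (rule cond_Z_pos[OF that w])
  have sets: "sets (PiM {1..n} (tilt w)) = sets \<Lambda>" by (intro sets_PiM_cong) auto
  show ?thesis
  proof (rule T.PiM_eqI)
    fix A assume A: "\<And>i. i \<in> {1..n} \<Longrightarrow> A i \<in> sets (tilt w i)"
    hence AS: "Pi\<^sub>E {1..n} A \<in> sets \<Lambda>" by (intro sets_PiM_I_finite) auto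
    note [measurable] = bfun_measurable[OF bfun_grad_snd[OF w]]
    have "emeasure (gibbs n lam (grad n b f w)) (Pi\<^sub>E {1..n} A)
        = (\<integral>\<^sup>+x. ennreal (exp (grad n b f w x) / Z (grad n b f w)) * indicator (Pi\<^sub>E {1..n} A) x \<partial>\<Lambda>)"
      unfolding gibbs_eq using AS by (intro emeasure_density) auto
    also have "\<dots> = (\<integral>\<^sup>+x. (\<Prod>i=1..n. ennreal (exp (pdiff b f i w (x i)) / cond_Z i w) * indicator (A i) (x i)) \<partial>\<Lambda>)"
    proof (intro nn_integral_cong)
      fix x assume x: "x \<in> space \<Lambda>"
      have "ennreal (exp (grad n b f w x) / Z (grad n b f w)) = (\<Prod>i=1..n. ennreal (exp (pdiff b f i w (x i)) / cond_Z i w))"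
      proof -
        have "(\<Prod>i=1..n. ennreal (exp (pdiff b f i w (x i)) / cond_Z i w)) = ennreal (\<Prod>i=1..n. exp (pdiff b f i w (x i)) / cond_Z i w)"
          using zp by (intro prod_ennreal) (auto intro!: divide_nonneg_nonneg less_imp_le)
        thus ?thesis by (simp add: Z_grad[OF w] grad_def exp_sum prod_dividef)
      qed
      moreover have "indicator (Pi\<^sub>E {1..n} A) x = (\<Prod>i=1..n. indicator (A i) (x i) :: ennreal)"
      proof (cases "x \<in> Pi\<^sub>E {1..n} A")
        case False
        then obtain i where i: "i \<in> {1..n}" "x i \<notin> A i" using x by (auto simp: space_PiM PiE_iff)
        hence "(\<Prod>i=1..n. indicator (A i) (x i) :: ennreal) = 0"
          by (intro prod_zero bexI[OF _ i(1)]) auto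
        thus ?thesis using False by simp
      qed (auto simp: PiE_iff intro!: prod.neutral[symmetric])
      ultimately show "ennreal (exp (grad n b f w x) / Z (grad n b f w)) * indicator (Pi\<^sub>E {1..n} A) x
          = (\<Prod>i=1..n. ennreal (exp (pdiff b f i w (x i)) / cond_Z i w) * indicator (A i) (x i))"
        by (simp add: prod.distrib)
    qed
    also have "\<dots> = (\<Prod>i=1..n. \<integral>\<^sup>+u. ennreal (exp (pdiff b f i w u) / cond_Z i w) * indicator (A i) u \<partial>lam i)"
    proof (intro product_nn_integral_prod)
      fix i assume i: "i \<in> {1..n}"
      note [measurable] = measurable_pdiff[OF i w] A[OF i, simplified]
      show "(\<lambda>u. ennreal (exp (pdiff b f i w u) / cond_Z i w) * indicator (A i) u) \<in> borel_measurable (lam i)"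
        by measurable
    qed simp
    also have "\<dots> = (\<Prod>i=1..n. emeasure (tilt w i) (A i))"
    proof (intro prod.cong refl)
      fix i assume i: "i \<in> {1..n}"
      note [measurable] = measurable_pdiff[OF i w] A[OF i, simplified]
      show "(\<integral>\<^sup>+u. ennreal (exp (pdiff b f i w u) / cond_Z i w) * indicator (A i) u \<partial>lam i) = emeasure (tilt w i) (A i)"
        using i by (simp add: tilt_def emeasure_density)
    qed
    finally show "emeasure (gibbs n lam (grad n b f w)) (Pi\<^sub>E {1..n} A) = (\<Prod>i=1..n. emeasure (tilt w i) (A i))" .
  qed (auto simp: sets)
qed

text \<open>The coupling theorem is applied to the density \<open>h\<close> of \<open>\<mu>\<close>
  conditioned on \<open>P\<close>, relative to the product measure at \<open>w\<close>. Trading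
  \<open>grad n b f w x\<close> for \<open>grad n b f x x\<close> in \<open>ln h\<close> costs at
  most \<open>\<epsilon>\<close>; after that, \<open>w\<close> enters the bound through
  \<open>log_z w\<close> alone, which is what makes it easy to average over
  \<open>w\<close>.\<close>

lemma tilt_coupling:
  assumes P: "P \<in> sets \<Lambda>" "measure (gibbs n lam f) P > 0"
    and w: "w \<in> space \<Lambda>"
    and osc: "\<And>x. x \<in> P \<Longrightarrow> grad n b f x x - grad n b f w x \<le> \<epsilon>"
    and d: "\<And>i. i \<in> {1..n} \<Longrightarrow> (\<lambda>(u, v). d i u v) \<in> borel_measurable (lam i \<Otimes>\<^sub>M lam i)"
      "\<And>i u v. i \<in> {1..n} \<Longrightarrow> u \<in> space (lam i) \<Longrightarrow> v \<in> space (lam i) \<Longrightarrow> d i u v \<in> {0..1::real}"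
      "\<And>i u. i \<in> {1..n} \<Longrightarrow> u \<in> space (lam i) \<Longrightarrow> d i u u = 0"
  obtains \<gamma> where "\<gamma> \<in> couplings (uniform_measure (gibbs n lam f) P) (gibbs n lam (grad n b f w))"
    "\<And>l. l > 0 \<Longrightarrow> l * (\<Sum>i=1..n. \<integral>q. d i (fst q i) (snd q i) \<partial>\<gamma>)
       \<le> log_z w - ln (measure (gibbs n lam f) P) + \<epsilon>
         + (\<integral>x. exp (f x) / Z f * (indicator P x * (f x - ln (Z f) - grad n b f x x)) \<partial>\<Lambda>) / measure (gibbs n lam f) P
         + real n * l\<^sup>2 / 8"
proof -
  let ?\<mu> = "gibbs n lam f" and ?g = "grad n b f w" and ?I = "indicator P :: _ \<Rightarrow> real"
  let ?\<Xi> = "PiM {1..n} (tilt w)"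
  let ?m = "measure ?\<mu> P"
  interpret T: nat_product_prob_space "tilt w" n by (rule tilt_product[OF w])
  interpret G: prob_space ?\<mu> by (rule prob_space_gibbs[OF f])
  have Zf: "Z f > 0" by (rule Z_pos[OF f])
  have Zg: "Z ?g > 0" by (rule Z_pos[OF bfun_grad_snd[OF w]])
  have bI: "bfun ?I" by (rule bfun_indicator[OF P(1)])
  note P(1)[measurable] bfun_measurable[OF f, measurable] bfun_measurable[OF bfun_grad_snd[OF w], measurable]
  have sets: "sets ?\<Xi> = sets \<Lambda>" by (intro sets_PiM_cong) auto
  have space: "space ?\<Xi> = space \<Lambda>" by (rule sets_eq_imp_space_eq[OF sets])
  define h where "h = (\<lambda>x. ?I x * exp (f x) * exp (- ?g x) * (Z ?g / (Z f * ?m)))"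
  have h0: "h x \<ge> 0" for x using Zf Zg P(2) by (simp add: h_def)
  have bh: "bfun h"
  proof -
    have "bfun (\<lambda>x. 0 - ?g x)" by (intro bfun_diff bfun_const bfun_grad_snd w)
    hence "bfun (\<lambda>x. exp (- ?g x))" using bfun_exp by fastforce
    thus ?thesis unfolding h_def by (intro bfun_mult bI bfun_exp[OF f] bfun_const)
  qed
  hence bh': "T.bfun h"
    by (simp add: bfun_def T.bfun_def space measurable_cong_sets[OF sets refl])
  have dens: "exp (?g x) / Z ?g * h x = exp (f x) / Z f * (?I x / ?m)" for x
    using Zf Zg P(2) by (simp add: h_def exp_minus field_simps)
  have int: "(\<integral>x. F x \<partial>?\<Xi>) = (\<integral>x. exp (?g x) / Z ?g * F x \<partial>\<Lambda>)"
    if "F \<in> borel_measurable \<Lambda>" for F :: "_ \<Rightarrow> real"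
    unfolding gibbs_grad_eq_PiM[OF w, symmetric] using bfun_grad_snd[OF w] that by (rule integral_gibbs)
  have int1: "(\<integral>x. h x \<partial>?\<Xi>) = 1"
  proof -
    have "(\<integral>x. h x \<partial>?\<Xi>) = (\<integral>x. exp (f x) / Z f * ?I x / ?m \<partial>\<Lambda>)"
      by (subst int[OF bfun_measurable[OF bh]]) (simp only: dens times_divide_eq_right)
    also have "\<dots> = ?m / ?m" by (simp only: integral_divide_zero measure_gibbs[OF f P(1)])
    finally show ?thesis using P(2) by simp
  qed
  have uniform: "density ?\<Xi> (\<lambda>x. ennreal (h x)) = uniform_measure ?\<mu> P"
  proof -
    have "density ?\<Xi> (\<lambda>x. ennreal (h x)) = density \<Lambda> (\<lambda>x. ennreal (exp (?g x) / Z ?g) * ennreal (h x))"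
      unfolding gibbs_grad_eq_PiM[OF w, symmetric] gibbs_eq
      using bfun_measurable[OF bh] by (intro density_density_eq) auto
    also have "\<dots> = density \<Lambda> (\<lambda>x. ennreal (exp (f x) / Z f) * (indicator P x / emeasure ?\<mu> P))"
    proof (intro density_cong AE_I2)
      fix x
      have "ennreal (exp (?g x) / Z ?g) * ennreal (h x) = ennreal (exp (?g x) / Z ?g * h x)"
        using Zg h0 by (intro ennreal_mult[symmetric]) auto
      also have "\<dots> = ennreal (exp (f x) / Z f * (?I x / ?m))"
        by (simp only: dens)
      also have "\<dots> = ennreal (exp (f x) / Z f) * (ennreal (?I x) / ennreal ?m)"
        using Zf P(2) by (subst ennreal_mult) (auto simp: divide_ennreal)
      finally show "ennreal (exp (?g x) / Z ?g) * ennreal (h x) = ennreal (exp (f x) / Z f) * (indicator P x / emeasure ?\<mu> P)"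
        by (simp add: G.emeasure_eq_measure ennreal_indicator)
    qed (use bfun_measurable[OF bh] in auto)
    also have "\<dots> = uniform_measure ?\<mu> P"
      unfolding uniform_measure_def gibbs_eq[of f] by (intro density_density_eq[symmetric]) auto
    finally show ?thesis .
  qed
  have entropy: "(\<integral>x. h x * ln (h x) \<partial>?\<Xi>)
      \<le> log_z w - ln ?m + \<epsilon> + (\<integral>x. exp (f x) / Z f * (?I x * (f x - ln (Z f) - grad n b f x x)) \<partial>\<Lambda>) / ?m"
  proof -
    let ?c = "log_z w - ln ?m + \<epsilon>"
    have b\<rho>: "bfun (\<lambda>x. exp (f x) / Z f)"
      using bfun_mult[OF bfun_exp[OF f] bfun_const[of "1 / Z f"]] by simp
    have b1: "bfun (\<lambda>x. exp (f x) / Z f * (?I x * (f x - ln (Z f) - grad n b f x x)))"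
      by (intro bfun_mult[OF b\<rho>] bfun_mult[OF bI] bfun_diff f bfun_const bfun_grad_diag)
    have b2: "bfun (\<lambda>x. exp (f x) / Z f * ?I x)" by (intro bfun_mult[OF b\<rho>] bI)
    have bhl: "bfun (\<lambda>x. h x * ln (h x))" by (rule bfun_mult_ln[OF bh h0])
    have "(\<integral>x. h x * ln (h x) \<partial>?\<Xi>) = (\<integral>x. exp (?g x) / Z ?g * (h x * ln (h x)) \<partial>\<Lambda>)"
      by (rule int[OF bfun_measurable[OF bhl]])
    also have "\<dots> \<le> (\<integral>x. exp (f x) / Z f * (?I x * (f x - ln (Z f) - grad n b f x x)) * (1 / ?m)
        + exp (f x) / Z f * ?I x * (?c / ?m) \<partial>\<Lambda>)"
    proof (intro integral_mono bfun_integrable)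
      show "bfun (\<lambda>x. exp (?g x) / Z ?g * (h x * ln (h x)))"
        using bfun_mult[OF bfun_mult[OF bfun_exp[OF bfun_grad_snd[OF w]] bfun_const[of "1 / Z ?g"]] bhl] by simp
      show "bfun (\<lambda>x. exp (f x) / Z f * (?I x * (f x - ln (Z f) - grad n b f x x)) * (1 / ?m)
        + exp (f x) / Z f * ?I x * (?c / ?m))"
        by (intro bfun_add bfun_mult[OF b1 bfun_const] bfun_mult[OF b2 bfun_const])
      fix x assume "x \<in> space \<Lambda>"
      show "exp (?g x) / Z ?g * (h x * ln (h x))
          \<le> exp (f x) / Z f * (?I x * (f x - ln (Z f) - grad n b f x x)) * (1 / ?m) + exp (f x) / Z f * ?I x * (?c / ?m)"
      proof (cases "x \<in> P")
        case True
        have "ln (h x) = f x - ?g x + log_z w - ln (Z f) - ln ?m"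
          using True Zf Zg P(2) by (simp add: h_def ln_mult ln_div ln_Z_grad[OF w])
        hence "ln (h x) \<le> (f x - ln (Z f) - grad n b f x x) + ?c"
          using osc[OF True] by simp
        hence "exp (f x) / Z f * (1 / ?m) * ln (h x) \<le> exp (f x) / Z f * (1 / ?m) * ((f x - ln (Z f) - grad n b f x x) + ?c)"
          using Zf by (intro mult_left_mono) auto
        moreover have "exp (?g x) / Z ?g * (h x * ln (h x)) = exp (f x) / Z f * (1 / ?m) * ln (h x)"
          using dens[of x] True by (simp only: mult.assoc[symmetric]) simp
        ultimately show ?thesis using True by (simp add: algebra_simps add_divide_distrib diff_divide_distrib)
      qed (simp add: h_def)
    qed
    also have "\<dots> = (\<integral>x. exp (f x) / Z f * (?I x * (f x - ln (Z f) - grad n b f x x)) \<partial>\<Lambda>) * (1 / ?m)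
        + (\<integral>x. exp (f x) / Z f * ?I x \<partial>\<Lambda>) * (?c / ?m)"
      unfolding integral_mult_left_zero[symmetric]
      by (intro Bochner_Integration.integral_add bfun_integrable bfun_mult[OF b1 bfun_const] bfun_mult[OF b2 bfun_const])
    also have "(\<integral>x. exp (f x) / Z f * ?I x \<partial>\<Lambda>) = ?m" by (rule measure_gibbs[OF f P(1), symmetric])
    finally have "(\<integral>x. h x * ln (h x) \<partial>?\<Xi>)
        \<le> (\<integral>x. exp (f x) / Z f * (?I x * (f x - ln (Z f) - grad n b f x x)) \<partial>\<Lambda>) * (1 / ?m) + ?m * (?c / ?m)" .
    moreover have "?m * (?c / ?m) = ?c" using P(2) by simp
    ultimately show ?thesis by simp
  qed
  obtain \<gamma> where \<gamma>: "\<gamma> \<in> couplings (density ?\<Xi> (\<lambda>x. ennreal (h x))) ?\<Xi>"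
      "\<And>l. l > 0 \<Longrightarrow> l * (\<Sum>i=1..n. \<integral>q. d i (fst q i) (snd q i) \<partial>\<gamma>)
       \<le> (\<integral>x. h x * ln (h x) \<partial>?\<Xi>) + real n * l\<^sup>2 / 8"
  proof (rule T.marton_coupling[OF bh' h0 int1, of d])
    show "(\<lambda>(u, v). d i u v) \<in> borel_measurable (tilt w i \<Otimes>\<^sub>M tilt w i)" if "i \<in> {1..n}" for i
    proof -
      have eq: "sets (tilt w i \<Otimes>\<^sub>M tilt w i) = sets (lam i \<Otimes>\<^sub>M lam i)"
        by (intro sets_pair_measure_cong sets_tilt)
      from d(1)[OF that] show ?thesis by (simp only: measurable_cong_sets[OF eq refl])
    qed
  qed (use d in auto)
  show ?thesis
  proof (rule that)
    show "\<gamma> \<in> couplings (uniform_measure ?\<mu> P) (gibbs n lam ?g)"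
      using \<gamma>(1) by (simp add: uniform gibbs_grad_eq_PiM[OF w])
    fix l :: real assume "l > 0"
    from \<gamma>(2)[OF this] entropy
    show "l * (\<Sum>i=1..n. \<integral>q. d i (fst q i) (snd q i) \<partial>\<gamma>)
       \<le> log_z w - ln ?m + \<epsilon>
         + (\<integral>x. exp (f x) / Z f * (?I x * (f x - ln (Z f) - grad n b f x x)) \<partial>\<Lambda>) / ?m
         + real n * l\<^sup>2 / 8"
      by linarith
  qed
qed

end

subsection \<open>The averaged transport cost\<close>

lemma le_sqrt_if_linear_bounds:
  fixes X a :: real
  assumes a: "a > 0" and X: "\<And>l. l > 0 \<Longrightarrow> l * X \<le> a + l\<^sup>2 / 8"
  shows "X \<le> sqrt (1 / 2 * a)"
proof -
  \<comment> \<open>This \<open>l\<close> minimises \<open>a / l + l / 8\<close>: both terms become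
    \<open>l / 8\<close>, and their sum \<open>l / 4\<close> is the root of
    \<open>a / 2\<close>.\<close>
  define l where "l = sqrt (8 * a)"
  have l: "l > 0" "l\<^sup>2 = 8 * a" using a by (simp_all add: l_def)
  have "l * X \<le> 2 * a" using X[OF l(1)] l(2) by simp
  hence "X \<le> 2 * a / l" using l(1) by (simp add: field_simps)
  also have "2 * a / l = l / 4" using l by (simp add: field_simps power2_eq_square)
  also have "l / 4 = sqrt (1 / 2 * a)"
  proof (rule real_sqrt_unique[symmetric])
    show "(l / 4)\<^sup>2 = 1 / 2 * a" using l(2) by (simp add: power_divide)
  qed (use l(1) in simp)
  finally show ?thesis .
qed

lemma (in prob_space) sum_measure_partition:
  assumes "finite \<P>" "partition_on (space M) \<P>" "\<P> \<subseteq> sets M"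
  shows "(\<Sum>P\<in>\<P>. measure M P) = 1"
proof -
  have "(\<Sum>P\<in>\<P>. measure M P) = measure M (\<Union>P\<in>\<P>. P)"
    using assms by (intro finite_measure_finite_Union[symmetric])
      (auto simp: partition_on_def disjoint_family_on_def disjoint_def)
  also have "(\<Union>P\<in>\<P>. P) = space M" using assms(2) by (simp add: partition_on_def)
  finally show ?thesis by (simp add: prob_space)
qed

context gibbs_space
begin

text \<open>\<open>R P\<close> stands for the transport distance at \<open>y P\<close>. The
  hypothesis on it combines the infimum over couplings with minimality over \<open>P\<close>: it is
  at most the cost of any coupling for any \<open>w\<close> in \<open>P\<close>.\<close>

lemma sum_transport_cost_le:
  assumes n: "n \<ge> 1"
    and fin: "finite \<P>" and part: "partition_on (space \<Lambda>) \<P>" and sets: "\<P> \<subseteq> sets \<Lambda>"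
    and \<delta>: "\<delta> > 0"
    and osc: "\<And>P x w. P \<in> \<P> \<Longrightarrow> x \<in> P \<Longrightarrow> w \<in> P \<Longrightarrow> grad n b f x x - grad n b f w x \<le> \<delta> * real n"
    and d: "\<And>i. i \<in> {1..n} \<Longrightarrow> (\<lambda>(u, v). d i u v) \<in> borel_measurable (lam i \<Otimes>\<^sub>M lam i)"
      "\<And>i u v. i \<in> {1..n} \<Longrightarrow> u \<in> space (lam i) \<Longrightarrow> v \<in> space (lam i) \<Longrightarrow> d i u v \<in> {0..1::real}"
      "\<And>i u. i \<in> {1..n} \<Longrightarrow> u \<in> space (lam i) \<Longrightarrow> d i u u = 0"
    and R: "\<And>P w \<gamma>. P \<in> \<P> \<Longrightarrow> measure (gibbs n lam f) P > 0 \<Longrightarrow> w \<in> P \<Longrightarrow>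
        \<gamma> \<in> couplings (uniform_measure (gibbs n lam f) P) (gibbs n lam (grad n b f w)) \<Longrightarrow>
        R P \<le> (\<Sum>i=1..n. \<integral>q. d i (fst q i) (snd q i) \<partial>\<gamma>) / real n"
  shows "(\<Sum>P\<in>\<P>. measure (gibbs n lam f) P * R P)
      \<le> sqrt (1 / 2 * (part_entropy (gibbs n lam f) \<P> / real n + \<delta>))"
proof -
  let ?\<mu> = "gibbs n lam f" and ?\<rho> = "\<lambda>x. exp (f x) / Z f"
  let ?Q = "\<lambda>x. f x - ln (Z f) - grad n b f x x"
  interpret G: prob_space ?\<mu> by (rule prob_space_gibbs[OF f])
  have n0: "real n > 0" using n by simp
  have Zf: "Z f > 0" by (rule Z_pos[OF f])
  have b\<rho>: "bfun ?\<rho>"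
    using bfun_mult[OF bfun_exp[OF f] bfun_const[of "1 / Z f"]] by simp
  have bQ: "bfun ?Q" by (intro bfun_diff f bfun_const bfun_grad_diag)
  have bI: "bfun (indicator P)" if "P \<in> \<P>" for P using sets that by (intro bfun_indicator) auto
  have bIF: "bfun (\<lambda>x. ?\<rho> x * (indicator P x * F x))" if "P \<in> \<P>" "bfun F" for P F
    by (intro bfun_mult[OF b\<rho>] bfun_mult[OF bI[OF that(1)]] that)
  have PS: "P \<in> sets \<Lambda>" if "P \<in> \<P>" for P using sets that by auto
  have m: "measure ?\<mu> P = (\<integral>x. ?\<rho> x * indicator P x \<partial>\<Lambda>)" if "P \<in> \<P>" for P
    by (rule measure_gibbs[OF f PS[OF that]])
  have bound: "l * real n * (measure ?\<mu> P * R P)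
      \<le> measure ?\<mu> P * (\<delta> * real n + real n * l\<^sup>2 / 8) - measure ?\<mu> P * ln (measure ?\<mu> P)
        + (\<integral>x. ?\<rho> x * (indicator P x * (log_z x + ?Q x)) \<partial>\<Lambda>)"
    if P: "P \<in> \<P>" and l: "l > 0" for P l
  proof (cases "measure ?\<mu> P > 0")
    case False
    hence 0: "measure ?\<mu> P = 0" using measure_nonneg[of ?\<mu> P] by linarith
    \<comment> \<open>On a null part the remaining integral is one against \<open>\<mu>\<close> over
      a null set, and every other term carries the factor \<open>measure ?\<mu> P\<close>.\<close>
    have "(\<integral>x. ?\<rho> x * (indicator P x * (log_z x + ?Q x)) \<partial>\<Lambda>)
        = (\<integral>x. indicator P x * (log_z x + ?Q x) \<partial>?\<mu>)"
      by (rule integral_gibbs[OF f, symmetric])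
        (intro bfun_measurable bfun_mult bI P bfun_add bfun_log_z bQ)
    also have "\<dots> = (\<integral>x. 0 \<partial>?\<mu>)"
    proof (rule integral_cong_AE)
      show "(\<lambda>x. indicator P x * (log_z x + ?Q x)) \<in> borel_measurable ?\<mu>"
        using bfun_measurable[OF bfun_mult[OF bI[OF P] bfun_add[OF bfun_log_z bQ]]]
        by (simp add: measurable_cong_sets[OF sets_gibbs refl])
      have "P \<in> null_sets ?\<mu>"
        using 0 PS[OF P] by (simp add: null_sets_def G.emeasure_eq_measure)
      from AE_not_in[OF this] show "AE x in ?\<mu>. indicator P x * (log_z x + ?Q x) = 0"
        by eventually_elim simp
    qed simp
    finally have "(\<integral>x. ?\<rho> x * (indicator P x * (log_z x + ?Q x)) \<partial>\<Lambda>) = 0" by simp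
    thus ?thesis by (simp only: 0)
  next
    case True
    let ?m = "measure ?\<mu> P"
    let ?A = "\<integral>x. ?\<rho> x * (indicator P x * ?Q x) \<partial>\<Lambda>"
    have each: "l * real n * R P \<le> log_z w - ln ?m + \<delta> * real n + ?A / ?m + real n * l\<^sup>2 / 8"
      if w: "w \<in> P" for w
    proof -
      have wS: "w \<in> space \<Lambda>" using w PS[OF P] sets.sets_into_space by blast
      obtain \<gamma> where \<gamma>: "\<gamma> \<in> couplings (uniform_measure ?\<mu> P) (gibbs n lam (grad n b f w))"
          "\<And>l. l > 0 \<Longrightarrow> l * (\<Sum>i=1..n. \<integral>q. d i (fst q i) (snd q i) \<partial>\<gamma>)
             \<le> log_z w - ln ?m + \<delta> * real n + ?A / ?m + real n * l\<^sup>2 / 8"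
        using tilt_coupling[OF PS[OF P] True wS osc[OF P _ w] d] by blast
      have "real n * R P \<le> (\<Sum>i=1..n. \<integral>q. d i (fst q i) (snd q i) \<partial>\<gamma>)"
        using R[OF P True w \<gamma>(1)] n0 by (simp add: field_simps)
      hence "l * (real n * R P) \<le> l * (\<Sum>i=1..n. \<integral>q. d i (fst q i) (snd q i) \<partial>\<gamma>)"
        using l by (intro mult_left_mono) auto
      also note \<gamma>(2)[OF l]
      finally show ?thesis by (simp add: mult.assoc)
    qed
    let ?c = "\<delta> * real n - ln ?m + ?A / ?m + real n * l\<^sup>2 / 8 - l * real n * R P"
    \<comment> \<open>The bound \<open>each\<close> is integrated in \<open>w\<close> over
      \<open>P\<close> against \<open>\<mu>\<close>. Only \<open>log_z\<close> varies with
      \<open>w\<close>, and the factor \<open>?m\<close> turns \<open>?A / ?m\<close> back into an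
      integral over \<open>P\<close>, so both merge into the integrand of the dual total
      correlation.\<close>
    have "0 \<le> (\<integral>x. ?\<rho> x * (indicator P x * (log_z x + ?c)) \<partial>\<Lambda>)"
    proof (rule Bochner_Integration.integral_nonneg)
      fix x
      have "0 \<le> log_z x + ?c" if "x \<in> P" using each[OF that] by simp
      thus "0 \<le> ?\<rho> x * (indicator P x * (log_z x + ?c))"
        using Zf by (cases "x \<in> P") auto
    qed
    also have "\<dots> = (\<integral>x. ?\<rho> x * (indicator P x * log_z x) + ?\<rho> x * indicator P x * ?c \<partial>\<Lambda>)"
      by (simp only: distrib_left mult.assoc)
    also have "\<dots> = (\<integral>x. ?\<rho> x * (indicator P x * log_z x) \<partial>\<Lambda>) + (\<integral>x. ?\<rho> x * indicator P x * ?c \<partial>\<Lambda>)"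
      by (intro Bochner_Integration.integral_add bfun_integrable bIF P bfun_log_z
          bfun_mult[OF bfun_mult[OF b\<rho> bI[OF P]] bfun_const])
    also have "(\<integral>x. ?\<rho> x * indicator P x * ?c \<partial>\<Lambda>) = ?m * ?c"
      unfolding m[OF P] by (rule integral_mult_left_zero)
    also have "?m * ?c = ?m * (\<delta> * real n + real n * l\<^sup>2 / 8) - ?m * ln ?m + ?A - l * real n * (?m * R P)"
      using True by (simp add: algebra_simps)
    finally have "l * real n * (?m * R P) \<le> ?m * (\<delta> * real n + real n * l\<^sup>2 / 8) - ?m * ln ?m
        + ((\<integral>x. ?\<rho> x * (indicator P x * log_z x) \<partial>\<Lambda>) + ?A)" by simp
    also have "(\<integral>x. ?\<rho> x * (indicator P x * log_z x) \<partial>\<Lambda>) + ?A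
        = (\<integral>x. ?\<rho> x * (indicator P x * log_z x) + ?\<rho> x * (indicator P x * ?Q x) \<partial>\<Lambda>)"
      by (intro Bochner_Integration.integral_add[symmetric] bfun_integrable bIF P bfun_log_z bQ)
    also have "\<dots> = (\<integral>x. ?\<rho> x * (indicator P x * (log_z x + ?Q x)) \<partial>\<Lambda>)"
      by (simp only: distrib_left)
    finally show ?thesis .
  qed
  have sum_ind: "(\<Sum>P\<in>\<P>. indicator P x) = (1::real)" if x: "x \<in> space \<Lambda>" for x
  proof -
    obtain P where P: "P \<in> \<P>" "x \<in> P" using x part by (auto simp: partition_on_def)
    have "(\<Sum>P'\<in>\<P>. indicator P' x) = (\<Sum>P'\<in>\<P>. if P' = P then 1 else (0::real))"
      using part P by (intro sum.cong refl) (auto simp: partition_on_def disjoint_def indicator_def)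
    thus ?thesis using fin P by simp
  qed
  have sum_m: "(\<Sum>P\<in>\<P>. measure ?\<mu> P) = 1"
    using fin part sets by (intro G.sum_measure_partition) auto
  have "(\<Sum>P\<in>\<P>. \<integral>x. ?\<rho> x * (indicator P x * (log_z x + ?Q x)) \<partial>\<Lambda>)
      = (\<integral>x. (\<Sum>P\<in>\<P>. ?\<rho> x * (indicator P x * (log_z x + ?Q x))) \<partial>\<Lambda>)"
    by (intro Bochner_Integration.integral_sum[symmetric] bfun_integrable bIF bfun_add bfun_log_z bQ)
  also have "\<dots> = (\<integral>x. ?\<rho> x * (log_z x + ?Q x) \<partial>\<Lambda>)"
    by (intro Bochner_Integration.integral_cong refl)
      (simp only: sum_distrib_left[symmetric] sum_distrib_right[symmetric] sum_ind mult_1_left)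
  also have "\<dots> \<le> 0" by (rule gibbs_dual_total_correlation)
  finally have dtc: "(\<Sum>P\<in>\<P>. \<integral>x. ?\<rho> x * (indicator P x * (log_z x + ?Q x)) \<partial>\<Lambda>) \<le> 0" .
  \<comment> \<open>Probabilities have nonpositive logarithms, so the entropy is nonnegative;
    together with \<open>\<delta> > 0\<close> this gives the strict positivity that the optimisation
    over \<open>l\<close> asks for.\<close>
  have "measure ?\<mu> P * ln (measure ?\<mu> P) \<le> 0" for P
  proof (cases "measure ?\<mu> P > 0")
    case True
    thus ?thesis using G.prob_le_1[of P] by (intro mult_nonneg_nonpos) auto
  qed (use measure_nonneg[of ?\<mu> P] in simp)
  hence H: "part_entropy ?\<mu> \<P> \<ge> 0"
    unfolding part_entropy_def by (simp add: sum_nonpos)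
  show ?thesis
  proof (rule le_sqrt_if_linear_bounds)
    show "part_entropy ?\<mu> \<P> / real n + \<delta> > 0" using H \<delta> n0 by (intro add_nonneg_pos) auto
    fix l :: real assume l: "l > 0"
    have "l * real n * (\<Sum>P\<in>\<P>. measure ?\<mu> P * R P)
        \<le> (\<Sum>P\<in>\<P>. measure ?\<mu> P * (\<delta> * real n + real n * l\<^sup>2 / 8) - measure ?\<mu> P * ln (measure ?\<mu> P)
          + (\<integral>x. ?\<rho> x * (indicator P x * (log_z x + ?Q x)) \<partial>\<Lambda>))"
      unfolding sum_distrib_left by (intro sum_mono bound l)
    also have "\<dots> = (\<delta> * real n + real n * l\<^sup>2 / 8) + part_entropy ?\<mu> \<P>
        + (\<Sum>P\<in>\<P>. \<integral>x. ?\<rho> x * (indicator P x * (log_z x + ?Q x)) \<partial>\<Lambda>)"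
      by (simp only: sum.distrib sum_subtractf sum_distrib_right[symmetric] sum_m part_entropy_def) simp
    also have "\<dots> \<le> (\<delta> * real n + real n * l\<^sup>2 / 8) + part_entropy ?\<mu> \<P>"
      using dtc by simp
    finally have "real n * (l * (\<Sum>P\<in>\<P>. measure ?\<mu> P * R P))
        \<le> real n * (part_entropy ?\<mu> \<P> / real n + \<delta> + l\<^sup>2 / 8)"
      using n0 by (simp add: algebra_simps)
    thus "l * (\<Sum>P\<in>\<P>. measure ?\<mu> P * R P) \<le> part_entropy ?\<mu> \<P> / real n + \<delta> + l\<^sup>2 / 8"
      using n0 by (simp only: mult_le_cancel_left_pos)
  qed
qed

end

subsection \<open>From transport costs to gradients\<close>

lemma (in finite_product_prob_space) bfun_integrable_prob_space:
  assumes "bfun h" "prob_space N" "sets N = sets (PiM I M)"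
  shows "integrable N h"
proof -
  interpret N: prob_space N by fact
  obtain B where "\<And>x. x \<in> space (PiM I M) \<Longrightarrow> \<bar>h x\<bar> \<le> B" using bfun_bound[OF assms(1)] by metis
  thus ?thesis using bfun_measurable[OF assms(1)] sets_eq_imp_space_eq[OF assms(3)]
    by (intro N.integrable_const_bound[of _ B]) (auto intro!: AE_I2 simp: measurable_cong_sets[OF assms(3) refl])
qed

lemma prob_space_coupling:
  assumes "\<gamma> \<in> couplings \<nu> \<nu>'" "prob_space \<nu>" shows "prob_space \<gamma>"
proof -
  have "fst \<in> \<gamma> \<rightarrow>\<^sub>M \<nu>"
    using assms(1) by (subst measurable_cong_sets[of _ "\<nu> \<Otimes>\<^sub>M \<nu>'" _ \<nu>]) (auto simp: couplings_def)
  thus ?thesis using assms by (auto simp: couplings_def intro: prob_space_distrD)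
qed

lemma integral_coupling:
  assumes \<gamma>: "\<gamma> \<in> couplings \<nu> \<nu>'"
  shows "F \<in> borel_measurable \<nu> \<Longrightarrow> (\<integral>p. F (fst p) \<partial>\<gamma>) = (\<integral>x. (F x :: real) \<partial>\<nu>)"
    and "F \<in> borel_measurable \<nu>' \<Longrightarrow> (\<integral>p. F (snd p) \<partial>\<gamma>) = (\<integral>x. F x \<partial>\<nu>')"
proof -
  note [measurable_cong] = \<gamma>[unfolded couplings_def, simplified, THEN conjunct1]
  have eq: "distr \<gamma> \<nu> fst = \<nu>" "distr \<gamma> \<nu>' snd = \<nu>'" using \<gamma> by (auto simp: couplings_def)
  have m: "fst \<in> \<gamma> \<rightarrow>\<^sub>M \<nu>" "snd \<in> \<gamma> \<rightarrow>\<^sub>M \<nu>'" by measurable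
  show "(\<integral>p. F (fst p) \<partial>\<gamma>) = (\<integral>x. F x \<partial>\<nu>)" if "F \<in> borel_measurable \<nu>"
    using integral_distr[OF m(1) that] by (simp only: eq)
  show "(\<integral>p. F (snd p) \<partial>\<gamma>) = (\<integral>x. F x \<partial>\<nu>')" if "F \<in> borel_measurable \<nu>'"
    using integral_distr[OF m(2) that] by (simp only: eq)
qed

lemma dn_nonneg: "0 \<le> dn n K x y"
  by (simp add: dn_def sum_nonneg)

lemma dn_bar_le:
  "\<gamma> \<in> couplings \<nu> \<nu>' \<Longrightarrow> dn_bar n K \<nu> \<nu>' \<le> (\<integral>p. dn n K (fst p) (snd p) \<partial>\<gamma>)"
  unfolding dn_bar_def
  by (rule cINF_lower) (auto intro!: bdd_belowI2[where m = 0] Bochner_Integration.integral_nonneg dn_nonneg)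

text \<open>Division by \<open>L\<close> reduces the claim to a lower bound for an infimum, which
  needs some coupling to exist. When \<open>L = 0\<close>, any such coupling already gives
  \<open>a \<le> 0\<close>.\<close>

lemma le_mult_dn_bar:
  assumes "couplings \<nu> \<nu>' \<noteq> {}" "L \<ge> 0"
    and le: "\<And>\<gamma>. \<gamma> \<in> couplings \<nu> \<nu>' \<Longrightarrow> a \<le> L * (\<integral>p. dn n K (fst p) (snd p) \<partial>\<gamma>)"
  shows "a \<le> L * dn_bar n K \<nu> \<nu>'"
proof (cases "L = 0")
  case True
  thus ?thesis using assms by fastforce
next
  case False
  hence L: "L > 0" using assms(2) by simp
  have "a / L \<le> dn_bar n K \<nu> \<nu>'"
    unfolding dn_bar_def using L le by (intro cINF_greatest assms(1)) (auto simp: field_simps)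
  thus ?thesis using L by (simp add: field_simps)
qed

theorem proposition4p1:
  fixes n :: nat
    and K :: "nat \<Rightarrow> 'a metric"
    and lam :: "nat \<Rightarrow> 'a measure"
    and b :: "nat \<Rightarrow> 'a"
    and f :: "(nat \<Rightarrow> 'a) \<Rightarrow> real"
    and \<delta> :: real
    and \<P> :: "(nat \<Rightarrow> 'a) set set"
    and y :: "(nat \<Rightarrow> 'a) set \<Rightarrow> (nat \<Rightarrow> 'a)"
  defines "\<mu> \<equiv> gibbs n lam f"
    and "g \<equiv> (\<lambda>P. grad n b f (y P))"
    and "L \<equiv> lip_const n K b f"
  assumes n: "n \<ge> 1"
    and nonempty: "\<And>i. i \<in> {1..n} \<Longrightarrow> mspace (K i) \<noteq> {}"
    and complete: "\<And>i. i \<in> {1..n} \<Longrightarrow> mcomplete_of (K i)"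
    and separable: "\<And>i. i \<in> {1..n} \<Longrightarrow> separable_space (mtopology_of (K i))"
    and diameter: "\<And>i u v. \<lbrakk>i \<in> {1..n}; u \<in> mspace (K i); v \<in> mspace (K i)\<rbrakk>
                     \<Longrightarrow> mdist (K i) u v \<le> 1"
    and lam_prob: "\<And>i. i \<in> {1..n} \<Longrightarrow> prob_space (lam i)"
    and lam_borel: "\<And>i. i \<in> {1..n} \<Longrightarrow> sets (lam i) = sets (borel_of (mtopology_of (K i)))"
    and base: "\<And>i. i \<in> {1..n} \<Longrightarrow> b i \<in> mspace (K i)"
    and f_cont: "continuous_map (prod_top n K) euclideanreal f"
    and f_bdd: "bounded (f ` prod_pts n K)"
    and lipschitz: "bdd_above (lip_quotients n K b f)"
    and delta: "\<delta> > 0"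
    and fin: "finite \<P>"
    and partition: "partition_on (prod_pts n K) \<P>"
    and parts_borel: "\<P> \<subseteq> sets (borel_of (prod_top n K))"
    and small_parts: "\<And>P x w. \<lbrakk>P \<in> \<P>; x \<in> P; w \<in> P\<rbrakk>
        \<Longrightarrow> unif_norm n K (\<lambda>z. grad n b f x z - grad n b f w z) < \<delta> * real n"
    and y_in: "\<And>P. P \<in> \<P> \<Longrightarrow> y P \<in> P"
    and y_min: "\<And>P w. \<lbrakk>P \<in> \<P>; measure \<mu> P > 0; w \<in> P\<rbrakk>
        \<Longrightarrow> dn_bar n K (uniform_measure \<mu> P) (gibbs n lam (grad n b f (y P)))
            \<le> dn_bar n K (uniform_measure \<mu> P) (gibbs n lam (grad n b f w))"
  shows "(\<Sum>P\<in>\<P>. measure \<mu> P *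
            unif_norm n K (\<lambda>z. g P z - (\<integral>x. grad n b f x z \<partial>gibbs n lam (g P))))
         \<le> \<delta> * real n + L * sqrt (1 / 2 * (part_entropy \<mu> \<P> / real n + \<delta>))"
proof -
  \<comment> \<open>The measures are probabilities for \<open>i \<in> {1..n}\<close> only, whereas
    the product locale asks for one at every index. A point mass fills the gap and leaves
    \<open>PiM\<close> over \<open>{1..n}\<close> unchanged.\<close>
  define lam' where "lam' = (\<lambda>i. if i \<in> {1..n} then lam i else return (count_space UNIV) undefined)"
  have lam': "lam' i = lam i" if "i \<in> {1..n}" for i using that by (simp add: lam'_def)
  have PiM_lam': "PiM {1..n} lam = PiM {1..n} lam'"
    by (intro PiM_cong) (auto simp: lam')
  have gibbs': "gibbs n lam = gibbs n lam'"
    by (simp add: gibbs_def PiM_lam' fun_eq_iff)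
  have space_lam: "space (lam' i) = mspace (K i)" if "i \<in> {1..n}" for i
    using sets_eq_imp_space_eq[OF lam_borel[OF that]] by (simp add: space_borel_of lam'[OF that])
  let ?S = "prod_pts n K" and ?\<Lambda> = "PiM {1..n} lam'"
  have space: "space ?\<Lambda> = ?S"
    unfolding space_PiM prod_top_def topspace_product_topology topspace_mtopology_of
    using space_lam by (rule PiE_cong)
  have prob': "prob_space (lam' i)" for i
    using lam_prob by (auto simp: lam'_def intro: prob_space_return)
  interpret nat_product_prob_space lam' n
    by (rule nat_product_prob_spaceI[OF prob'])
  have open_sets: "U \<in> sets ?\<Lambda>" if "openin (prod_top n K) U" for U
    using that unfolding prod_top_def
    by (intro openin_product_in_PiM[of _ K]) (auto simp: separable lam_borel lam')
  have borel_sets: "sets (borel_of (prod_top n K)) \<subseteq> sets ?\<Lambda>"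
    unfolding sets_borel_of space[symmetric]
    by (intro sets.sigma_sets_subset) (auto intro: open_sets)
  have bf: "bfun f"
  proof -
    obtain B where "\<And>x. x \<in> ?S \<Longrightarrow> \<bar>f x\<bar> \<le> B" using f_bdd by (auto simp: bounded_iff)
    moreover have "f \<in> borel_measurable ?\<Lambda>"
    proof (rule borel_measurableI)
      fix U :: "real set" assume "open U"
      hence "openin (prod_top n K) {x \<in> ?S. f x \<in> U}"
        using f_cont by (auto simp: continuous_map_def)
      from open_sets[OF this] show "f -` U \<inter> space ?\<Lambda> \<in> sets ?\<Lambda>"
        by (simp add: space vimage_def Int_def conj_commute)
    qed
    ultimately show ?thesis by (intro bfunI) (auto simp: space)
  qed
  interpret G: gibbs_space lam' n b f
    by unfold_locales (use base space_lam bf in auto)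
  have \<mu>: "\<mu> = gibbs n lam' f" by (simp add: \<mu>_def gibbs')
  interpret \<mu>: prob_space \<mu> unfolding \<mu> by (rule G.prob_space_gibbs[OF bf])
  have P_sets: "\<P> \<subseteq> sets ?\<Lambda>" using parts_borel borel_sets by blast
  have part: "partition_on (space ?\<Lambda>) \<P>" using partition by (simp add: space)
  have P_space: "x \<in> space ?\<Lambda>" if "P \<in> \<P>" "x \<in> P" for x P
    using that part by (auto simp: partition_on_def)
  have n0: "real n > 0" using n by simp
  \<comment> \<open>\<open>b\<close> need not be extensional; its restriction is a point of the
    product.\<close>
  have "restrict b {1..n} \<in> ?S" using base by (auto simp: prod_top_def)
  hence S_ne: "?S \<noteq> {}" by blast

  have unif_ge: "\<bar>h z\<bar> \<le> unif_norm n K h" if h: "bfun h" and z: "z \<in> space ?\<Lambda>" for h z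
  proof -
    obtain B where "\<And>x. x \<in> space ?\<Lambda> \<Longrightarrow> \<bar>h x\<bar> \<le> B" using bfun_bound[OF h] by metis
    thus ?thesis using z unfolding unif_norm_def space
      by (intro cSUP_upper) (auto intro!: bdd_aboveI2[where M = B])
  qed
  have unif_le: "unif_norm n K h \<le> C" if "\<And>z. z \<in> space ?\<Lambda> \<Longrightarrow> \<bar>h z\<bar> \<le> C" for h C
    unfolding unif_norm_def using S_ne that by (intro cSUP_least) (auto simp: space)
  have b_diff: "bfun (\<lambda>z. grad n b f x z - grad n b f w z)"
    if "x \<in> space ?\<Lambda>" "w \<in> space ?\<Lambda>" for x w
    using that by (intro bfun_diff G.bfun_grad_snd)
  have osc: "\<bar>grad n b f x z - grad n b f w z\<bar> \<le> \<delta> * real n"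
    if "P \<in> \<P>" "x \<in> P" "w \<in> P" "z \<in> space ?\<Lambda>" for P x w z
    using unif_ge[OF b_diff[OF P_space[OF that(1,2)] P_space[OF that(1,3)]] that(4)]
      small_parts[OF that(1-3)] by linarith

  have L0: "L \<ge> 0"
  proof (cases "lip_quotients n K b f = {}")
    case False
    then obtain q where q: "q \<in> lip_quotients n K b f" by blast
    then obtain x w where xw: "x \<in> ?S" "w \<in> ?S"
        "q = unif_norm n K (\<lambda>z. grad n b f x z - grad n b f w z) / dn n K x w"
      by (auto simp: lip_quotients_def)
    obtain z where z: "z \<in> space ?\<Lambda>" using S_ne space by blast
    have "0 \<le> unif_norm n K (\<lambda>z. grad n b f x z - grad n b f w z)"
      by (rule order_trans[OF abs_ge_zero unif_ge[OF b_diff z]]) (use xw(1,2) space in auto)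
    hence "0 \<le> q" by (simp add: xw dn_nonneg)
    also have "q \<le> L" using q False lipschitz by (simp add: L_def lip_const_def cSup_upper)
    finally show ?thesis .
  qed (simp add: L_def lip_const_def)
  have lip: "\<bar>grad n b f x z - grad n b f w z\<bar> \<le> L * dn n K x w"
    if x: "x \<in> space ?\<Lambda>" and w: "w \<in> space ?\<Lambda>" and z: "z \<in> space ?\<Lambda>" for x w z
  proof (cases "x = w")
    case True
    thus ?thesis using L0 by (simp add: dn_nonneg)
  next
    case False
    \<comment> \<open>Distinct extensional points differ at an index in \<open>{1..n}\<close>, which
      makes \<open>dn\<close> positive and the quotient a genuine one.\<close>
    obtain i where i: "i \<in> {1..n}" "x i \<noteq> w i"
      using PiE_ext[OF x[unfolded space_PiM] w[unfolded space_PiM]] False by blast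
    have xi: "x i \<in> mspace (K i)" "w i \<in> mspace (K i)"
      using x w i(1) space_lam by (auto simp: space_PiM PiE_iff)
    have "0 < mdist (K i) (x i) (w i)"
      using i xi mdist_nonneg[of "K i" "x i" "w i"] mdist_zero[OF xi] by linarith
    hence "0 < (\<Sum>i=1..n. mdist (K i) (x i) (w i))"
      using i by (intro sum_pos2[of _ i]) auto
    hence dpos: "dn n K x w > 0" using n0 by (simp add: dn_def)
    let ?q = "unif_norm n K (\<lambda>z. grad n b f x z - grad n b f w z) / dn n K x w"
    have "?q \<in> lip_quotients n K b f"
      using x w False unfolding lip_quotients_def space by blast
    hence "?q \<le> L" using lipschitz by (auto simp: L_def lip_const_def intro: cSup_upper)
    hence "unif_norm n K (\<lambda>z. grad n b f x z - grad n b f w z) \<le> L * dn n K x w"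
      using dpos by (simp add: field_simps)
    with unif_ge[OF b_diff[OF x w] z] show ?thesis by linarith
  qed

  have d_meas: "(\<lambda>(u, v). mdist (K i) u v) \<in> borel_measurable (lam' i \<Otimes>\<^sub>M lam' i)"
    if "i \<in> {1..n}" for i
    using that by (intro measurable_mdist) (auto simp: separable lam' lam_borel)
  have d_unit: "mdist (K i) u v \<in> {0..1}"
    if "i \<in> {1..n}" "u \<in> space (lam' i)" "v \<in> space (lam' i)" for i u v
    using that diameter by (auto simp: space_lam)
  have d_refl: "mdist (K i) u u = 0" if "i \<in> {1..n}" "u \<in> space (lam' i)" for i u
    using that by (simp add: space_lam)

  have int_d: "integrable \<gamma> (\<lambda>p. mdist (K i) (fst p i) (snd p i))"
    if \<gamma>: "\<gamma> \<in> couplings \<nu> \<nu>'" "prob_space \<nu>" "sets \<nu> = sets ?\<Lambda>" "sets \<nu>' = sets ?\<Lambda>"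
      and i: "i \<in> {1..n}" for \<gamma> \<nu> \<nu>' i
  proof -
    interpret \<gamma>: prob_space \<gamma> by (rule prob_space_coupling[OF \<gamma>(1,2)])
    have sets: "sets \<gamma> = sets (?\<Lambda> \<Otimes>\<^sub>M ?\<Lambda>)"
      using \<gamma> sets_pair_measure_cong[OF \<gamma>(3,4)] by (simp add: couplings_def)
    have sp: "space \<gamma> = space ?\<Lambda> \<times> space ?\<Lambda>"
      using sets_eq_imp_space_eq[OF sets] by (simp add: space_pair_measure)
    have "(\<lambda>p. (fst p i, snd p i)) \<in> ?\<Lambda> \<Otimes>\<^sub>M ?\<Lambda> \<rightarrow>\<^sub>M lam' i \<Otimes>\<^sub>M lam' i"
      using i by (intro measurable_Pair measurable_compose[OF measurable_fst] measurable_compose[OF measurable_snd]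
        measurable_component_singleton)
    hence "(\<lambda>p. (fst p i, snd p i)) \<in> \<gamma> \<rightarrow>\<^sub>M lam' i \<Otimes>\<^sub>M lam' i"
      by (simp only: measurable_cong_sets[OF sets refl])
    from measurable_compose[OF this d_meas[OF i]]
    have "(\<lambda>p. mdist (K i) (fst p i) (snd p i)) \<in> borel_measurable \<gamma>" by simp
    thus ?thesis
      using d_unit[OF i] i by (intro \<gamma>.integrable_const_bound[of _ 1] AE_I2) (auto simp: sp space_PiM PiE_iff)
  qed

  let ?\<mu>P = "\<lambda>P. uniform_measure \<mu> P" and ?\<xi> = "\<lambda>w. gibbs n lam' (grad n b f w)"
  have sets_\<mu>P: "sets (?\<mu>P P) = sets ?\<Lambda>" for P by (simp add: \<mu>)
  have prob_\<mu>P: "prob_space (?\<mu>P P)" if "P \<in> \<P>" "measure \<mu> P > 0" for P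
    using that by (intro prob_space_uniform_measure) (auto simp: \<mu>.emeasure_eq_measure)
  define R where "R = (\<lambda>P. dn_bar n K (?\<mu>P P) (?\<xi> (y P)))"
  have transport: "(\<Sum>P\<in>\<P>. measure \<mu> P * R P) \<le> sqrt (1 / 2 * (part_entropy \<mu> \<P> / real n + \<delta>))"
    unfolding \<mu>
  proof (rule G.sum_transport_cost_le[OF n fin part P_sets delta, of "\<lambda>i. mdist (K i)"])
    show "grad n b f x x - grad n b f w x \<le> \<delta> * real n" if "P \<in> \<P>" "x \<in> P" "w \<in> P" for P x w
      using osc[OF that P_space[OF that(1,2)]] by simp
    fix P w \<gamma>
    assume P: "P \<in> \<P>" "measure (gibbs n lam' f) P > 0" and w: "w \<in> P"
      and \<gamma>: "\<gamma> \<in> couplings (uniform_measure (gibbs n lam' f) P) (?\<xi> w)"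
    note P' = P(1) P(2)[folded \<mu>] and \<gamma>' = \<gamma>[folded \<mu>]
    \<comment> \<open>Minimality of \<open>y P\<close> replaces the distance at \<open>y P\<close>
      by the distance at an arbitrary \<open>w\<close> in the part.\<close>
    have "R P \<le> dn_bar n K (?\<mu>P P) (?\<xi> w)"
      using y_min[OF P' w] by (simp add: R_def gibbs')
    also have "\<dots> \<le> (\<integral>p. dn n K (fst p) (snd p) \<partial>\<gamma>)" by (rule dn_bar_le[OF \<gamma>'])
    also have "\<dots> = (\<Sum>i=1..n. \<integral>q. mdist (K i) (fst q i) (snd q i) \<partial>\<gamma>) / real n"
      unfolding dn_def using int_d[OF \<gamma>' prob_\<mu>P[OF P'] sets_\<mu>P]
      by (simp add: Bochner_Integration.integral_sum)
    finally show "R P \<le> (\<Sum>i=1..n. \<integral>q. mdist (K i) (fst q i) (snd q i) \<partial>\<gamma>) / real n" .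
  qed (use d_meas d_unit d_refl in auto)

  \<comment> \<open>Triangle inequality through the mean of the gradient under \<open>\<mu>\<close>
    conditioned on \<open>P\<close>: the first leg is controlled by the oscillation on
    \<open>P\<close>, the second by the Lipschitz constant and the transport distance.\<close>
  have part_bound: "unif_norm n K (\<lambda>z. g P z - (\<integral>x. grad n b f x z \<partial>gibbs n lam (g P))) \<le> \<delta> * real n + L * R P"
    if P: "P \<in> \<P>" "measure \<mu> P > 0" for P
  proof (rule unif_le)
    fix z assume z: "z \<in> space ?\<Lambda>"
    let ?G = "\<lambda>x. grad n b f x z"
    interpret \<mu>P: prob_space "?\<mu>P P" by (rule prob_\<mu>P[OF P])
    have yP: "y P \<in> space ?\<Lambda>" by (rule P_space[OF P(1) y_in[OF P(1)]])
    have PS: "P \<in> sets ?\<Lambda>" using P_sets P by auto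
    have bG: "bfun ?G" by (rule G.bfun_grad_fst[OF z])
    have iG: "integrable (?\<mu>P P) ?G"
      by (rule bfun_integrable_prob_space[OF bG prob_\<mu>P[OF P] sets_\<mu>P])
    have "\<bar>g P z - (\<integral>x. ?G x \<partial>?\<mu>P P)\<bar> = \<bar>\<integral>x. g P z - ?G x \<partial>?\<mu>P P\<bar>"
      using iG \<mu>P.prob_space by simp
    also have "\<dots> \<le> (\<integral>x. \<bar>g P z - ?G x\<bar> \<partial>?\<mu>P P)" by (rule integral_abs_bound)
    also have "\<dots> \<le> \<delta> * real n"
    proof (rule \<mu>P.integral_le_const)
      show "integrable (?\<mu>P P) (\<lambda>x. \<bar>g P z - ?G x\<bar>)" using iG by simp
      show "AE x in ?\<mu>P P. \<bar>g P z - ?G x\<bar> \<le> \<delta> * real n"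
        using osc[OF P(1) y_in[OF P(1)] _ z] PS
        by (intro AE_uniform_measureI AE_I2) (auto simp: \<mu> g_def)
    qed
    finally have 1: "\<bar>g P z - (\<integral>x. ?G x \<partial>?\<mu>P P)\<bar> \<le> \<delta> * real n" .
    have 2: "\<bar>(\<integral>x. ?G x \<partial>?\<mu>P P) - (\<integral>x. ?G x \<partial>?\<xi> (y P))\<bar> \<le> L * R P"
      unfolding R_def
    proof (rule le_mult_dn_bar[OF _ L0])
      \<comment> \<open>Only existence matters here, so any coupling will do.\<close>
      obtain \<gamma> where "\<gamma> \<in> couplings (?\<mu>P P) (?\<xi> (y P))"
      proof (rule G.tilt_coupling[OF PS P(2)[unfolded \<mu>] yP, of "\<delta> * real n" "\<lambda>i. mdist (K i)"])
        show "grad n b f x x - grad n b f (y P) x \<le> \<delta> * real n" if "x \<in> P" for x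
          using osc[OF P(1) that y_in[OF P(1)] P_space[OF P(1) that]] by simp
      qed (use d_meas d_unit d_refl in \<open>auto simp: \<mu>\<close>)
      thus "couplings (?\<mu>P P) (?\<xi> (y P)) \<noteq> {}" by blast
    next
      \<comment> \<open>The easy half of Kantorovich duality: both means are integrals against
        \<open>\<gamma>\<close>, and for fixed \<open>z\<close> the integrand is Lipschitz with
        constant \<open>L\<close>.\<close>
      fix \<gamma> assume \<gamma>: "\<gamma> \<in> couplings (?\<mu>P P) (?\<xi> (y P))"
      interpret \<gamma>: prob_space \<gamma> by (rule prob_space_coupling[OF \<gamma> prob_\<mu>P[OF P]])
      have sets: "sets \<gamma> = sets (?\<Lambda> \<Otimes>\<^sub>M ?\<Lambda>)"
        using \<gamma> sets_pair_measure_cong[OF sets_\<mu>P G.sets_gibbs] by (simp add: couplings_def)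
      have sp: "space \<gamma> = space ?\<Lambda> \<times> space ?\<Lambda>"
        using sets_eq_imp_space_eq[OF sets] by (simp add: space_pair_measure)
      obtain B where B: "\<And>x. x \<in> space ?\<Lambda> \<Longrightarrow> \<bar>?G x\<bar> \<le> B" using bfun_bound[OF bG] by metis
      have meas: "(\<lambda>p. ?G (fst p)) \<in> borel_measurable \<gamma>" "(\<lambda>p. ?G (snd p)) \<in> borel_measurable \<gamma>"
        unfolding measurable_cong_sets[OF sets refl]
        using bfun_measurable[OF bG] by (auto intro: measurable_compose[OF measurable_fst] measurable_compose[OF measurable_snd])
      have int: "integrable \<gamma> (\<lambda>p. ?G (fst p))" "integrable \<gamma> (\<lambda>p. ?G (snd p))"
        using meas by (auto intro!: \<gamma>.integrable_const_bound[of _ B] AE_I2 B simp: sp)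
      have int_dn: "integrable \<gamma> (\<lambda>p. dn n K (fst p) (snd p))"
        unfolding dn_def
        by (intro integrable_divide Bochner_Integration.integrable_sum int_d[OF \<gamma> prob_\<mu>P[OF P] sets_\<mu>P G.sets_gibbs])
      have "(\<integral>x. ?G x \<partial>?\<mu>P P) - (\<integral>x. ?G x \<partial>?\<xi> (y P)) = (\<integral>p. ?G (fst p) - ?G (snd p) \<partial>\<gamma>)"
        using int integral_coupling[OF \<gamma>, of ?G] bfun_measurable[OF bG]
        by (simp add: measurable_cong_sets[OF sets_\<mu>P refl] measurable_cong_sets[OF G.sets_gibbs refl])
      also have "\<bar>\<dots>\<bar> \<le> (\<integral>p. \<bar>?G (fst p) - ?G (snd p)\<bar> \<partial>\<gamma>)" by (rule integral_abs_bound)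
      also have "\<dots> \<le> (\<integral>p. L * dn n K (fst p) (snd p) \<partial>\<gamma>)"
        using int int_dn lip z by (intro integral_mono) (auto simp: sp)
      finally show "\<bar>(\<integral>x. ?G x \<partial>?\<mu>P P) - (\<integral>x. ?G x \<partial>?\<xi> (y P))\<bar> \<le> L * (\<integral>p. dn n K (fst p) (snd p) \<partial>\<gamma>)"
        by simp
    qed
    have "gibbs n lam (g P) = ?\<xi> (y P)" by (simp add: gibbs' g_def)
    thus "\<bar>g P z - (\<integral>x. ?G x \<partial>gibbs n lam (g P))\<bar> \<le> \<delta> * real n + L * R P"
      using 1 2 by simp
  qed
  have "(\<Sum>P\<in>\<P>. measure \<mu> P * unif_norm n K (\<lambda>z. g P z - (\<integral>x. grad n b f x z \<partial>gibbs n lam (g P))))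
      \<le> (\<Sum>P\<in>\<P>. measure \<mu> P * (\<delta> * real n + L * R P))"
  proof (rule sum_mono)
    fix P assume P: "P \<in> \<P>"
    show "measure \<mu> P * unif_norm n K (\<lambda>z. g P z - (\<integral>x. grad n b f x z \<partial>gibbs n lam (g P)))
        \<le> measure \<mu> P * (\<delta> * real n + L * R P)"
    proof (cases "measure \<mu> P > 0")
      case True
      thus ?thesis by (intro mult_left_mono part_bound P) auto
    next
      case False
      hence "measure \<mu> P = 0" using measure_nonneg[of \<mu> P] by linarith
      thus ?thesis by simp
    qed
  qed
  also have "\<dots> = (\<Sum>P\<in>\<P>. measure \<mu> P) * (\<delta> * real n) + L * (\<Sum>P\<in>\<P>. measure \<mu> P * R P)"
    by (simp add: distrib_left sum.distrib sum_distrib_left sum_distrib_right mult.left_commute)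
  also have "(\<Sum>P\<in>\<P>. measure \<mu> P) = 1"
    using fin part P_sets by (intro \<mu>.sum_measure_partition) (auto simp: \<mu>)
  also have "1 * (\<delta> * real n) + L * (\<Sum>P\<in>\<P>. measure \<mu> P * R P)
      \<le> \<delta> * real n + L * sqrt (1 / 2 * (part_entropy \<mu> \<P> / real n + \<delta>))"
    using transport L0 by (simp add: mult_left_mono)
  finally show ?thesis .
qed

end
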